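(* Let $G$ be a finite complex reflection group acting on $\mathbb C^d$, let $\Omega\subseteq\mathbb C^d$ be a bounded $G$-invariant domain, let $\boldsymbol\theta$ be a basic polynomial map associated to $G$, let $\widetilde\omega:\boldsymbol\theta(\Omega)\to(0,\infty)$ be continuous and let $\omega=\widetilde\omega\circ\boldsymbol\theta$. Suppose that $G$ is abelian. Then $\mathbb A^2_\omega(\Omega)$ is isometrically isomorphic to the orthogonal direct sum $$\mathbb A^2_\omega(\Omega)\cong\bigoplus_{\varrho\in\widehat G}\mathbb A^2_{\omega_\varrho}(\boldsymbol\theta(\Omega)),$$ and $$\mathcal B_\omega(\boldsymbol z,\boldsymbol w)=\frac1{|G|}\sum_{\varrho\in\widehat G}\ell_\varrho(\boldsymbol z)\,\mathcal B_{\omega_\varrho}(\boldsymbol\theta(\boldsymbol z),\boldsymbol\theta(\boldsymbol w))\,\overline{\ell_\varrho(\boldsymbol w)},\qquad\boldsymbol z,\boldsymbol w\in\Omega,$$ where $\mathcal B_\omega$ and $\mathcal B_{\omega_\varrho}$ are the reproducing kernels of $\mathbb A^2_\omega(\Omega)$ and $\mathbb A^2_{\omega_\varrho}(\boldsymbol\theta(\Omega))$, respectively.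
   Context: A complex reflection on $\mathbb C^d$ is a linear map $\sigma$ of finite order in $GL(d,\mathbb C)$ such that $\mathrm{id}-\sigma$ has rank $1$. A finite complex reflection group is a finite subgroup $G\subset GL(d,\mathbb C)$ generated by complex reflections. $G$ acts on $\mathbb C^d$ by $\sigma\cdot\boldsymbol z=\sigma^{-1}\boldsymbol z$; a domain $\Omega$ is $G$-invariant if it is preserved by this action. $\widehat G$ is the set of equivalence classes of irreducible representations of $G$ (all one-dimensional when $G$ is abelian). A basic polynomial map associated to $G$ is $\boldsymbol\theta=(\theta_1,\dots,\theta_d):\mathbb C^d\to\mathbb C^d$, where $\theta_1,\dots,\theta_d$ are algebraically independent homogeneous polynomials with $\mathbb C[z_1,\dots,z_d]^G=\mathbb C[\theta_1,\dots,\theta_d]$ (these exist by the Chevalley–Shephard–Todd theorem). For a $G$-invariant domain $\Omega$, $\boldsymbol\theta(\Omega)$ is a domain. $J_{\boldsymbol\theta}$ is the determinant of the complex Jacobian matrix of $\boldsymbol\theta$. The polynomial $\ell_\varrho$: let $H_1,\dots,H_t$ be the distinct reflecting hyperplanes of $G$ (the hyperplanes $\ker(\mathrm{id}-\sigma)$, $\sigma\in G$ a complex reflection), $\ell_i$ a linear form with zero set $H_i$, $G_i=\langle a_i\rangle$ the cyclic subgroup of elements of $G$ acting trivially on $H_i$. For a one-dimensional representation $\varrho$, let $c_i$ be the least non-negative integer with $\varrho(a_i)=(\det a_i)^{c_i}$, and set $\ell_\varrho=\prod_{i=1}^t\ell_i^{c_i}$. For a domain $D$ and weight $\nu>0$ (continuous,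 defined on $D$ off a closed set of measure zero), $\mathbb A^2_\nu(D)$ is the Hilbert space of holomorphic $f$ on $D$ with $\int_D|f|^2\nu\,dV<\infty$. $dV$ is Lebesgue measure normalized on $\Omega$; the same multiple of Lebesgue measure is used on $\boldsymbol\theta(\Omega)$. The weight $\omega_\varrho$ is defined on $\boldsymbol\theta(\Omega)\setminus\boldsymbol\theta(\bigcup_iH_i)$ by $\omega_\varrho(\boldsymbol\theta(\boldsymbol z))=\frac{|\ell_\varrho(\boldsymbol z)|^2}{|J_{\boldsymbol\theta}(\boldsymbol z)|^2}\,\widetilde\omega(\boldsymbol\theta(\boldsymbol z))$ (well defined). *)

theory Defs
  imports "Jordan_Normal_Form.Matrix" "HOL-Algebra.Generated_Groups" "HOL-Analysis.Analysis"
begin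

(* The group G consists of matrices of type complex^'d^'d; the matrix type of
   Jordan_Normal_Form serves only for representations, whose degree varies. Its names and
   notations that collide with HOL-Analysis are hidden. *)
no_notation vec_index (infixl \<open>$\<close> 100)
no_notation Matrix.scalar_prod (infix \<open>\<bullet>\<close> 70)
no_notation transpose_mat (\<open>(_\<^sup>T)\<close> [1000])
hide_type (open) Matrix.vec
hide_const (open) Matrix.vec Matrix.mat Matrix.row Matrix.rows Matrix.col Matrix.cols
  Matrix.orthogonal Matrix.scalar_prod Matrix.vec_index

section \<open>Complex reflection groups\<close>

definition GL :: "(complex^'d^'d) monoid" where
  "GL = \<lparr>carrier = {A. invertible A}, monoid.mult = (**), one = Finite_Cartesian_Product.mat 1\<rparr>"

definition complex_reflection :: "complex^'d^'d \<Rightarrow> bool" where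
  "complex_reflection \<sigma> \<longleftrightarrow> \<sigma> \<in> carrier GL \<and> (\<exists>n::nat. n > 0 \<and> \<sigma> [^]\<^bsub>GL\<^esub> n = \<one>\<^bsub>GL\<^esub>)
     \<and> rank (Finite_Cartesian_Product.mat 1 - \<sigma>) = 1"

definition finite_reflection_group :: "(complex^'d^'d) set \<Rightarrow> bool" where
  "finite_reflection_group G \<longleftrightarrow> finite G \<and> subgroup G GL
     \<and> generate GL {\<sigma>\<in>G. complex_reflection \<sigma>} = G"

definition act :: "complex^'d^'d \<Rightarrow> complex^'d \<Rightarrow> complex^'d" where
  "act \<sigma> z = matrix_inv \<sigma> *v z"

definition invariant_domain :: "(complex^'d^'d) set \<Rightarrow> (complex^'d) set \<Rightarrow> bool" where
  "invariant_domain G \<Omega> \<longleftrightarrow> open \<Omega> \<and> connected \<Omega> \<and> \<Omega> \<noteq> {} \<and> (\<forall>\<sigma>\<in>G. act \<sigma> ` \<Omega> = \<Omega>)"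

definition hyperplanes :: "(complex^'d^'d) set \<Rightarrow> (complex^'d) set set" where
  "hyperplanes G = (\<lambda>\<sigma>. {z. (Finite_Cartesian_Product.mat 1 - \<sigma>) *v z = 0})
     ` {\<sigma>\<in>G. complex_reflection \<sigma>}"

definition fixer :: "(complex^'d^'d) set \<Rightarrow> (complex^'d) set \<Rightarrow> (complex^'d^'d) set" where
  "fixer G H = {\<sigma>\<in>G. \<forall>z\<in>H. act \<sigma> z = z}"

section \<open>Basic polynomial maps\<close>

(* Polynomials are represented by the functions they induce, which is faithful over an
   infinite field. *)

definition monomial_fun :: "('d \<Rightarrow> nat) \<Rightarrow> complex^'d \<Rightarrow> complex" where
  "monomial_fun \<alpha> z = (\<Prod>i\<in>UNIV. (z $ i) ^ \<alpha> i)"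

definition polynomials :: "(complex^'d \<Rightarrow> complex) set" where
  "polynomials = {(\<lambda>z. \<Sum>\<alpha>\<in>S. c \<alpha> * monomial_fun \<alpha> z) | S c. finite S}"

definition homogeneous :: "(complex^'d \<Rightarrow> complex) \<Rightarrow> bool" where
  "homogeneous p \<longleftrightarrow> (\<exists>k S c. finite S \<and> (\<forall>\<alpha>\<in>S. (\<Sum>i\<in>UNIV. \<alpha> i) = k)
     \<and> p = (\<lambda>z. \<Sum>\<alpha>\<in>S. c \<alpha> * monomial_fun \<alpha> z))"

definition algebraically_independent :: "(complex^'d \<Rightarrow> complex^'d) \<Rightarrow> bool" where
  "algebraically_independent \<theta> \<longleftrightarrow>
     (\<forall>p\<in>polynomials. (\<forall>z. p (\<theta> z) = 0) \<longrightarrow> p = (\<lambda>_. 0))"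

definition basic_polynomial_map ::
    "(complex^'d^'d) set \<Rightarrow> (complex^'d \<Rightarrow> complex^'d) \<Rightarrow> bool" where
  "basic_polynomial_map G \<theta> \<longleftrightarrow>
     (\<forall>i. homogeneous (\<lambda>z. \<theta> z $ i)) \<and> algebraically_independent \<theta>
     \<and> {p\<in>polynomials. \<forall>\<sigma>\<in>G. \<forall>z. p (act \<sigma> z) = p z} = {p \<circ> \<theta> | p. p \<in> polynomials}"

definition jacobian_det :: "(complex^'d \<Rightarrow> complex^'d) \<Rightarrow> complex^'d \<Rightarrow> complex" where
  "jacobian_det \<theta> z =
     Determinants.det (\<chi> i j. deriv (\<lambda>t. \<theta> (z + t *s axis j 1) $ i) 0)"

section \<open>Irreducible representations\<close>

definition irreducible_rep ::
    "(complex^'d^'d) set \<Rightarrow> nat \<Rightarrow> (complex^'d^'d \<Rightarrow> complex Matrix.mat) \<Rightarrow> bool" where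
  "irreducible_rep G n \<rho> \<longleftrightarrow> n > 0
     \<and> \<rho> \<in> hom (GL\<lparr>carrier := G\<rparr>) (units_of (ring_mat TYPE(complex) n ()))
     \<and> (\<forall>W \<subseteq> carrier_vec n. 0\<^sub>v n \<in> W \<and> (\<forall>v\<in>W. \<forall>w\<in>W. v + w \<in> W) \<and> (\<forall>c. \<forall>v\<in>W. c \<cdot>\<^sub>v v \<in> W)
            \<and> (\<forall>\<sigma>\<in>G. \<forall>v\<in>W. \<rho> \<sigma> *\<^sub>v v \<in> W)
          \<longrightarrow> W = {0\<^sub>v n} \<or> W = carrier_vec n)"

(* Extensionality outside G makes two representations equal iff they agree on G. *)
definition irreducible_reps ::
    "(complex^'d^'d) set \<Rightarrow> (complex^'d^'d \<Rightarrow> complex Matrix.mat) set" where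
  "irreducible_reps G = {\<rho> \<in> extensional G. \<exists>n. irreducible_rep G n \<rho>}"

definition equivalent_reps ::
    "(complex^'d^'d) set \<Rightarrow> (complex^'d^'d \<Rightarrow> complex Matrix.mat) rel" where
  "equivalent_reps G = {(\<rho>, \<rho>'). \<rho> \<in> irreducible_reps G \<and> \<rho>' \<in> irreducible_reps G
     \<and> (\<exists>P Q. \<forall>\<sigma>\<in>G. similar_mat_wit (\<rho> \<sigma>) (\<rho>' \<sigma>) P Q)}"

definition dual ::
    "(complex^'d^'d) set \<Rightarrow> (complex^'d^'d \<Rightarrow> complex Matrix.mat) set set" where
  "dual G = irreducible_reps G // equivalent_reps G"

(* The exponent is meaningful only for a class R of one-dimensional representations; \<rho> a is
   then a 1-by-1 matrix, and R has a single element. *)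
definition exponent ::
    "(complex^'d^'d \<Rightarrow> complex Matrix.mat) set \<Rightarrow> complex^'d^'d \<Rightarrow> nat" where
  "exponent R a = (LEAST c. \<forall>\<rho>\<in>R. \<rho> a = (Determinants.det a) ^ c \<cdot>\<^sub>m 1\<^sub>m 1)"

(* L H is the chosen linear form vanishing on the hyperplane H, a H the chosen generator of
   the cyclic group of elements of G fixing H pointwise. *)
definition ell ::
    "(complex^'d^'d) set \<Rightarrow> ((complex^'d) set \<Rightarrow> complex^'d \<Rightarrow> complex)
      \<Rightarrow> ((complex^'d) set \<Rightarrow> complex^'d^'d)
      \<Rightarrow> (complex^'d^'d \<Rightarrow> complex Matrix.mat) set \<Rightarrow> complex^'d \<Rightarrow> complex" where
  "ell G L a R z = (\<Prod>H\<in>hyperplanes G. L H z ^ exponent R (a H))"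

(* This defines the weight at u = \<theta>(z), z in \<Omega>, through a chosen preimage z. On the image of
   the reflecting hyperplanes, a null set where the weight is left undefined in the
   literature, the value is irrelevant. *)
definition omega ::
    "(complex^'d) set \<Rightarrow> (complex^'d \<Rightarrow> complex^'d) \<Rightarrow> (complex^'d \<Rightarrow> complex)
      \<Rightarrow> (complex^'d \<Rightarrow> real) \<Rightarrow> complex^'d \<Rightarrow> real" where
  "omega \<Omega> \<theta> l wt u = (let z = (SOME z. z \<in> \<Omega> \<and> \<theta> z = u) in
     (cmod (l z))\<^sup>2 / (cmod (jacobian_det \<theta> z))\<^sup>2 * wt u)"

section \<open>Inner product spaces, direct sums, reproducing kernels\<close>

record 'v ip_space =
  vectors :: "'v set"
  vadd :: "'v \<Rightarrow> 'v \<Rightarrow> 'v"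
  vscale :: "complex \<Rightarrow> 'v \<Rightarrow> 'v"
  ip :: "'v \<Rightarrow> 'v \<Rightarrow> complex"

definition direct_sum :: "'i set \<Rightarrow> ('i \<Rightarrow> 'v ip_space) \<Rightarrow> ('i \<Rightarrow> 'v) ip_space" where
  "direct_sum I X = \<lparr>
     vectors = (\<Pi>\<^sub>E i\<in>I. vectors (X i)),
     vadd = (\<lambda>f g. \<lambda>i\<in>I. vadd (X i) (f i) (g i)),
     vscale = (\<lambda>c f. \<lambda>i\<in>I. vscale (X i) c (f i)),
     ip = (\<lambda>f g. \<Sum>i\<in>I. ip (X i) (f i) (g i))\<rparr>"

definition isometrically_isomorphic :: "'v ip_space \<Rightarrow> 'w ip_space \<Rightarrow> bool" where
  "isometrically_isomorphic X Y \<longleftrightarrow> (\<exists>U. bij_betw U (vectors X) (vectors Y)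
     \<and> (\<forall>f\<in>vectors X. \<forall>g\<in>vectors X. U (vadd X f g) = vadd Y (U f) (U g))
     \<and> (\<forall>c. \<forall>f\<in>vectors X. U (vscale X c f) = vscale Y c (U f))
     \<and> (\<forall>f\<in>vectors X. \<forall>g\<in>vectors X. ip Y (U f) (U g) = ip X f g))"

definition is_reproducing_kernel ::
    "('p \<Rightarrow> complex) ip_space \<Rightarrow> 'p set \<Rightarrow> ('p \<Rightarrow> 'p \<Rightarrow> complex) \<Rightarrow> bool" where
  "is_reproducing_kernel X D K \<longleftrightarrow> (\<forall>w\<in>D. (\<lambda>z. K z w) \<in> vectors X
     \<and> (\<forall>f\<in>vectors X. f w = ip X f (\<lambda>z. K z w)))"

definition reproducing_kernel :: "('p \<Rightarrow> complex) ip_space \<Rightarrow> 'p \<Rightarrow> 'p \<Rightarrow> complex" where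
  "reproducing_kernel X z w =
     (THE k. k \<in> vectors X \<and> (\<forall>f\<in>vectors X. f w = ip X f k)) z"

section \<open>Weighted Bergman spaces\<close>

definition holomorphic_several :: "(complex^'d \<Rightarrow> complex) \<Rightarrow> (complex^'d) set \<Rightarrow> bool" where
  "holomorphic_several f D \<longleftrightarrow> (\<forall>z\<in>D. \<exists>f'. (f has_derivative f') (at z)
     \<and> Vector_Spaces.linear (*s) (*) f')"

definition normalized_volume :: "(complex^'d) set \<Rightarrow> (complex^'d) measure" where
  "normalized_volume \<Omega> = scale_measure (1 / emeasure lebesgue \<Omega>) lebesgue"

(* Functions on D are represented by functions on the whole space that vanish outside D. *)
definition bergman_space ::
    "(complex^'d) measure \<Rightarrow> (complex^'d) set \<Rightarrow> (complex^'d \<Rightarrow> real)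
      \<Rightarrow> (complex^'d \<Rightarrow> complex) ip_space" where
  "bergman_space dV D \<nu> = \<lparr>
     vectors = {f. (\<forall>z. z \<notin> D \<longrightarrow> f z = 0) \<and> holomorphic_several f D
                   \<and> set_integrable dV D (\<lambda>z. (cmod (f z))\<^sup>2 * \<nu> z)},
     vadd = (\<lambda>f g z. f z + g z),
     vscale = (\<lambda>c f z. c * f z),
     ip = (\<lambda>f g. LINT z:D|dV. f z * cnj (g z) * of_real (\<nu> z))\<rparr>"

end

theory Submission
  imports Defs "HOL-Complex_Analysis.Conformal_Mappings"
begin

text \<open>
  An abelian reflection group is diagonal in suitable coordinates. A reflection generating the
  pointwise stabilizer of a hyperplane \<open>H\<close> with linear form \<open>l\<close> is
  \<open>z \<mapsto> z - (1 - \<mu>) l(z) v\<close> with \<open>l(v) = 1\<close>, and two such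
  maps for different hyperplanes commute only if each vector \<open>v\<close> lies on the other
  hyperplane. So the forms can be completed to a coordinate system \<open>y\<close> in which
  \<open>G\<close> consists of all \<open>y \<mapsto> \<zeta> y\<close> (componentwise) with
  \<open>\<zeta>_j ^ m_j = 1\<close> (\<open>abelian_reflection_group_diagonal\<close>). The
  irreducible representations are the characters \<open>\<zeta> \<mapsto> \<Prod> \<zeta>_j ^
  c_j\<close> with \<open>0 \<le> c_j < m_j\<close> (\<open>dual_diagonal\<close>), and the
  polynomial attached to the character is \<open>ell_c(z) = \<Prod> y_j(z) ^ c_j\<close>.

  The invariants of \<open>G\<close> are the polynomials in \<open>\<pi>(z) = (y_j(z) ^
  m_j)\<close>. Hence any basic map is \<open>\<theta> = \<Phi> \<circ> \<pi>\<close> with a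
  polynomial automorphism \<open>\<Phi>\<close> of \<open>\<complex>^d\<close>; in particular
  \<open>\<theta>\<close> is open, its fibres are the orbits, and its Jacobian determinant is a
  zero-free function times \<open>\<Prod> y_j ^ (m_j - 1)\<close> (\<open>theta_eq_iff\<close>,
  \<open>theta_open\<close>, \<open>jacobian_formula\<close>).

  A holomorphic function \<open>f\<close> on \<open>\<Omega>\<close> is the sum of its isotypic
  parts. The part that transforms by the character \<open>c\<close> vanishes on \<open>y_j =
  0\<close> to order at least \<open>c_j\<close>, so it is \<open>ell_c\<close> times an invariant
  holomorphic function (\<open>semi_invariant_divide\<close>), and the latter is \<open>h \<circ>
  \<theta>\<close> for a holomorphic \<open>h\<close> on \<open>\<theta> ` \<Omega>\<close>
  (\<open>invariant_descends\<close>). Both steps rest on a removability theorem for hyperplanes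
  in several variables (\<open>holomorphic_several_removable\<close>).

  Since \<open>\<theta>\<close> is \<open>|G|\<close>-to-one off a null set, with real Jacobian
  \<open>|J_\<theta>|\<^sup>2\<close>, the definition of the weight gives \<open>||ell_c (h
  \<circ> \<theta>)||\<^sup>2 = |G| ||h||\<^sup>2\<close>, the left norm taken with respect to
  \<open>\<omega>\<close> and the right one with respect to the weight of the character
  (\<open>distr_mu_theta\<close>, \<open>lift_ip\<close>). Parts belonging to different characters
  are orthogonal because \<open>G\<close> acts unitarily (\<open>lift_orthogonal\<close>). So
  \<open>(h_c) \<mapsto> |G| ^ (-1/2) \<Sum> ell_c (h_c \<circ> \<theta>)\<close> is an isometry
  of the direct sum onto the Bergman space of \<open>\<Omega>\<close>, and the kernel formula
  follows by testing its right-hand side against each summand (\<open>decomposition\<close>).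

  The reproducing kernels exist because all the weights are locally bounded below by positive
  constants. For \<open>|ell_c|\<^sup>2 / |J_\<theta>|\<^sup>2\<close> this is the inequality
  \<open>c_j \<le> m_j - 1\<close> (\<open>bergman_measure_nu\<close>). The mean value inequality
  then bounds point values by the norm (\<open>local_bound\<close>), and the kernel at
  \<open>w\<close> is zero or a multiple of the function of least norm among those with value 1 at
  \<open>w\<close> (\<open>kernel_exists\<close>).
\<close>

section \<open>Holomorphic functions of several variables\<close>

text \<open>Bilinear, not sesquilinear: these are all the complex-linear forms on
  \<open>\<complex>^d\<close>, so a function is holomorphic iff its derivative at each point is one
  of them, and the vector \<open>a\<close> is then its complex gradient.\<close>

definition cform :: "complex^'d \<Rightarrow> complex^'d \<Rightarrow> complex" where
  "cform a v = (\<Sum>i\<in>UNIV. a $ i * v $ i)"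

lemma cform_add: "cform a (v + w) = cform a v + cform a w"
  and cform_scale: "cform a (c *s v) = c * cform a v"
  and cform_axis: "cform a (axis i c) = a $ i * c"
  and cform_zero [simp]: "cform a 0 = 0"
  and cform_add_left: "cform (a + b) v = cform a v + cform b v"
  and cform_scale_left: "cform (c *s a) v = c * cform a v"
  and cform_diff: "cform a (v - w) = cform a v - cform a w"
  by (simp_all add: cform_def axis_def algebra_simps sum.distrib sum_distrib_left sum_subtractf
      if_distrib sum.delta cong: if_cong)

lemma scaleR_eq_vector_scale: "r *\<^sub>R v = complex_of_real r *s (v :: complex^'d)"
  by (simp add: vec_eq_iff) (simp add: scaleR_conv_of_real)

lemma norm_vector_scale: "norm (c *s (v :: complex^'d)) = cmod c * norm v"
  by (simp add: norm_vec_def norm_mult L2_set_right_distrib)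

lemma bounded_linear_cform: "bounded_linear (cform a)"
proof -
  have "bounded_linear (\<lambda>v. a $ i * v $ i)" for i
    by (intro bounded_linear_mult_right[THEN bounded_linear_compose] bounded_linear_vec_nth)
  then show ?thesis
    unfolding cform_def[abs_def] by (intro bounded_linear_sum)
qed

lemma linear_iff_cform: "Vector_Spaces.linear (*s) (*) f \<longleftrightarrow> (\<exists>a. f = cform a)"
proof
  assume f: "Vector_Spaces.linear (*s) (*) f"
  interpret f: Vector_Spaces.linear "(*s)" "(*)" f by (rule f)
  have "f v = cform (\<chi> i. f (axis i 1)) v" for v :: "complex^'a"
  proof -
    have "f v = f (\<Sum>i\<in>UNIV. v $ i *s axis i 1)"
      by (simp add: basis_expansion)
    also have "\<dots> = (\<Sum>i\<in>UNIV. v $ i * f (axis i 1))"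
      by (simp add: f.sum f.scale)
    finally show ?thesis
      by (simp add: cform_def mult.commute)
  qed
  then show "\<exists>a. f = cform a" by blast
next
  assume "\<exists>a. f = cform a"
  moreover have "vector_space ((*) :: complex \<Rightarrow> complex \<Rightarrow> complex)"
    by unfold_locales (auto simp: algebra_simps)
  moreover have "vector_space ((*s) :: complex \<Rightarrow> complex^'a \<Rightarrow> complex^'a)"
    by (simp add: vec.vector_space_axioms)
  ultimately show "Vector_Spaces.linear (*s) (*) f"
    by (auto simp: Vector_Spaces.linear_iff cform_add cform_scale)
qed

lemma holomorphic_several_iff:
  "holomorphic_several f D \<longleftrightarrow> (\<forall>z\<in>D. \<exists>a. (f has_derivative cform a) (at z))"
  unfolding holomorphic_several_def linear_iff_cform by metis

lemma has_derivative_vec_lambda: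
  fixes F :: "'i::finite \<Rightarrow> 'a::real_normed_vector \<Rightarrow> 'b::euclidean_space"
  assumes "\<And>i. (F i has_derivative F' i) (at z within S)"
  shows "((\<lambda>x. \<chi> i. F i x) has_derivative (\<lambda>v. \<chi> i. F' i v)) (at z within S)"
proof (subst has_derivative_componentwise_within, rule ballI)
  fix b :: "'b^'i" assume "b \<in> Basis"
  then obtain i c where b: "b = axis i c" "c \<in> Basis"
    by (auto simp: Basis_vec_def)
  show "((\<lambda>x. (\<chi> i. F i x) \<bullet> b) has_derivative (\<lambda>x. (\<chi> i. F' i x) \<bullet> b)) (at z within S)"
    using has_derivative_inner_left[OF assms[of i], of c] by (simp add: b inner_axis)
qed

lemma has_derivative_matrix_compose:
  fixes F :: "complex^'d \<Rightarrow> complex^'e"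
  assumes f: "(f has_derivative cform a) (at (F z))"
    and F: "(F has_derivative (*v) A) (at z)"
  shows "((\<lambda>z. f (F z)) has_derivative cform (a v* A)) (at z)"
proof -
  have "cform a (A *v v) = cform (a v* A) v" for v
    unfolding cform_def matrix_vector_mult_def vector_matrix_mult_def
    by (simp add: sum_distrib_left sum_distrib_right, subst sum.swap) (simp add: mult_ac)
  with has_derivative_compose[OF F f] show ?thesis
    by simp
qed

lemma has_derivative_matrix_of_components:
  assumes "\<And>i. ((\<lambda>z. F z $ i) has_derivative cform (A $ i)) (at z)"
  shows "(F has_derivative (*v) A) (at z)"
proof -
  have "((\<lambda>x. \<chi> i. F x $ i) has_derivative (\<lambda>v. \<chi> i. cform (A $ i) v)) (at z)"
    by (rule has_derivative_vec_lambda) (use assms in auto)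
  moreover have "(\<lambda>v. \<chi> i. cform (A $ i) v) = (*v) A"
    by (auto simp: matrix_vector_mult_def cform_def)
  ultimately show ?thesis by simp
qed

lemma has_derivative_matrix_component:
  assumes "(F has_derivative (*v) A) (at z)"
  shows "((\<lambda>z. F z $ i) has_derivative cform (A $ i)) (at z)"
  using bounded_linear.has_derivative[OF bounded_linear_vec_nth assms, of i]
  by (simp add: matrix_vector_mult_def cform_def[abs_def])

lemma has_derivative_matrix_mult:
  fixes F :: "complex^'d \<Rightarrow> complex^'e" and H :: "complex^'e \<Rightarrow> complex^'f"
  assumes "(H has_derivative (*v) B) (at (F z))" "(F has_derivative (*v) A) (at z)"
  shows "((\<lambda>z. H (F z)) has_derivative (*v) (B ** A)) (at z)"
  using has_derivative_compose[OF assms(2,1)] by (simp add: matrix_vector_mul_assoc)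

lemma has_derivative_linear_map: "((*v) A has_derivative (*v) A) (at (z :: complex^'d))"
proof (rule has_derivative_matrix_of_components)
  have "(\<lambda>z. (A *v z) $ i) = cform (A $ i)" for i
    by (simp add: matrix_vector_mult_def cform_def fun_eq_iff)
  then show "((\<lambda>z. (A *v z) $ i) has_derivative cform (A $ i)) (at z)" for i
    by (simp add: bounded_linear_imp_has_derivative bounded_linear_cform)
qed

lemma has_derivative_line:
  assumes "(f has_derivative cform a) (at (z + t *s v))"
  shows "((\<lambda>t. f (z + t *s v)) has_field_derivative cform a v) (at t)"
proof -
  have "((\<lambda>t. z + t *s v) has_derivative (\<lambda>t. t *s v)) (at t)"
  proof -
    have "bounded_linear (\<lambda>t. t *s v)"
    proof (rule bounded_linear_intro[where K = "norm v"])
      show "norm (x *s v) \<le> norm x * norm v" for x :: complex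
        by (simp add: norm_vector_scale)
    qed (simp_all add: vec_eq_iff algebra_simps)
    then show ?thesis
      by (auto intro!: derivative_eq_intros bounded_linear_imp_has_derivative)
  qed
  from has_derivative_compose[OF this assms] show ?thesis
    by (simp add: has_field_derivative_def cform_scale mult.commute[of _ "cform a v"])
qed

lemma has_derivative_cform_mult:
  assumes "(f has_derivative cform a) (at z)" "(g has_derivative cform b) (at z)"
  shows "((\<lambda>z. f z * g z) has_derivative cform (f z *s b + g z *s a)) (at z)"
  using has_derivative_mult[OF assms]
  by (simp add: cform_add_left[abs_def] cform_scale_left[abs_def] mult.commute)

lemma has_derivative_cform_add:
  assumes "(f has_derivative cform a) (at z)" "(g has_derivative cform b) (at z)"
  shows "((\<lambda>z. f z + g z) has_derivative cform (a + b)) (at z)"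
  using has_derivative_add[OF assms] by (simp add: cform_add_left[abs_def])

lemma has_derivative_cform_const: "((\<lambda>z. c) has_derivative cform 0) (at (z :: complex^'d))"
proof -
  have "cform 0 = (\<lambda>v :: complex^'d. 0)" by (simp add: fun_eq_iff cform_def)
  then show ?thesis by simp
qed

lemma holomorphic_several_const: "holomorphic_several (\<lambda>z. c) D"
  unfolding holomorphic_several_iff using has_derivative_cform_const by blast

lemma holomorphic_several_cform: "holomorphic_several (cform l) D"
  unfolding holomorphic_several_iff
  using bounded_linear_imp_has_derivative[OF bounded_linear_cform] by blast

lemma holomorphic_several_mult:
  "holomorphic_several f D \<Longrightarrow> holomorphic_several g D \<Longrightarrow> holomorphic_several (\<lambda>z. f z * g z) D"
  unfolding holomorphic_several_iff by (blast intro: has_derivative_cform_mult)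

lemma holomorphic_several_add:
  "holomorphic_several f D \<Longrightarrow> holomorphic_several g D \<Longrightarrow> holomorphic_several (\<lambda>z. f z + g z) D"
  unfolding holomorphic_several_iff by (blast intro: has_derivative_cform_add)

lemma holomorphic_several_power:
  "holomorphic_several f D \<Longrightarrow> holomorphic_several (\<lambda>z. f z ^ n) D"
  by (induction n) (auto intro: holomorphic_several_const holomorphic_several_mult)

lemma holomorphic_several_sum:
  "(\<And>i. i \<in> I \<Longrightarrow> holomorphic_several (f i) D) \<Longrightarrow> holomorphic_several (\<lambda>z. \<Sum>i\<in>I. f i z) D"
  by (induction I rule: infinite_finite_induct)
     (auto intro: holomorphic_several_const holomorphic_several_add)

lemma holomorphic_several_prod:
  "(\<And>i. i \<in> I \<Longrightarrow> holomorphic_several (f i) D) \<Longrightarrow> holomorphic_several (\<lambda>z. \<Prod>i\<in>I. f i z) D"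
  by (induction I rule: infinite_finite_induct)
     (auto intro: holomorphic_several_const holomorphic_several_mult)

lemma holomorphic_several_subset:
  "holomorphic_several f D \<Longrightarrow> E \<subseteq> D \<Longrightarrow> holomorphic_several f E"
  unfolding holomorphic_several_def by blast

lemma holomorphic_several_cong:
  assumes "open D" "\<And>z. z \<in> D \<Longrightarrow> f z = g z" "holomorphic_several f D"
  shows "holomorphic_several g D"
  unfolding holomorphic_several_iff
proof
  fix z assume z: "z \<in> D"
  then obtain a where "(f has_derivative cform a) (at z)"
    using assms(3) unfolding holomorphic_several_iff by blast
  then have "(g has_derivative cform a) (at z)"
    by (rule has_derivative_transform_within_open[OF _ assms(1) z assms(2)])
  then show "\<exists>a. (g has_derivative cform a) (at z)" ..
qed

lemma holomorphic_several_imp_continuous_on: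
  "holomorphic_several f D \<Longrightarrow> continuous_on D f"
  unfolding holomorphic_several_iff
  by (meson continuous_at_imp_continuous_on has_derivative_continuous)

lemma holomorphic_several_compose:
  fixes F :: "complex^'d \<Rightarrow> complex^'e"
  assumes "holomorphic_several f E" "\<And>i. holomorphic_several (\<lambda>z. F z $ i) D" "F ` D \<subseteq> E"
  shows "holomorphic_several (\<lambda>z. f (F z)) D"
  unfolding holomorphic_several_iff
proof
  fix z assume z: "z \<in> D"
  obtain A where "\<And>i. ((\<lambda>z. F z $ i) has_derivative cform (A i)) (at z)"
    using bchoice[of UNIV] assms(2) z unfolding holomorphic_several_iff by meson
  then have "(F has_derivative (*v) (\<chi> i. A i)) (at z)"
    by (intro has_derivative_matrix_of_components) simp
  moreover obtain a where "(f has_derivative cform a) (at (F z))"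
    using assms(1,3) z unfolding holomorphic_several_iff by blast
  ultimately show "\<exists>a. ((\<lambda>z. f (F z)) has_derivative cform a) (at z)"
    using has_derivative_matrix_compose by blast
qed

lemma holomorphic_several_field_compose:
  assumes "\<And>z. z \<in> D \<Longrightarrow> \<exists>p'. (p has_field_derivative p') (at (f z))" "holomorphic_several f D"
  shows "holomorphic_several (\<lambda>z. p (f z)) D"
  unfolding holomorphic_several_iff
proof
  fix z assume z: "z \<in> D"
  obtain p' where p': "(p has_field_derivative p') (at (f z))"
    using assms(1) z by blast
  obtain a where a: "(f has_derivative cform a) (at z)"
    using assms(2) z unfolding holomorphic_several_iff by blast
  have "((\<lambda>z. p (f z)) has_derivative cform (p' *s a)) (at z)"
    using has_derivative_compose[OF a p'[unfolded has_field_derivative_def]]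
    by (simp add: cform_scale_left[abs_def])
  then show "\<exists>a. ((\<lambda>z. p (f z)) has_derivative cform a) (at z)" by blast
qed

lemma open_line: "open {t. z + t *s v \<in> ball (w :: complex^'d) r}"
proof -
  have "continuous_on UNIV (\<lambda>t. z + t *s v)"
    unfolding vector_scalar_mult_def by (intro continuous_intros)
  then show ?thesis
    using open_vimage[OF open_ball] by (simp add: vimage_def)
qed

lemma holomorphic_on_line:
  assumes "holomorphic_several f D" "\<And>t. t \<in> T \<Longrightarrow> z + t *s v \<in> D"
  shows "(\<lambda>t. f (z + t *s v)) holomorphic_on T"
proof (rule holomorphic_onI)
  fix t assume "t \<in> T"
  then obtain a where "(f has_derivative cform a) (at (z + t *s v))"
    using assms unfolding holomorphic_several_iff by blast
  from has_derivative_line[OF this]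
  show "(\<lambda>t. f (z + t *s v)) field_differentiable at t within T"
    using field_differentiable_at_within field_differentiable_def by blast
qed

text \<open>Cauchy's estimate for the second derivative on discs of radius \<open>R/2\<close>
  about points of the unit disc. The point is the decay in \<open>R\<close>: a function of
  \<open>h\<close> near 0 is examined along the line through \<open>h\<close> with \<open>h\<close>
  itself as unit of length, and \<open>R\<close> is then inversely proportional to
  \<open>|h|\<close>.\<close>

lemma Taylor_remainder_bound:
  assumes holo: "f holomorphic_on ball 0 R" and R: "R \<ge> 4"
    and M: "\<And>t. t \<in> ball 0 R \<Longrightarrow> cmod (f t) \<le> M"
  shows "cmod (f 1 - f 0 - deriv f 0) \<le> 8 * M / R\<^sup>2"
proof -
  have bound: "cmod ((deriv ^^ 2) f x) \<le> 8 * M / R\<^sup>2" if x: "x \<in> cball 0 1" for x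
  proof -
    have sub: "cball x (R/2) \<subseteq> ball 0 R"
    proof
      fix y assume "y \<in> cball x (R/2)"
      then have "norm y \<le> R / 2 + 1"
        using x norm_triangle_ineq2[of y x] by (auto simp: dist_norm norm_minus_commute)
      then show "y \<in> ball 0 R" using R by simp
    qed
    have "cmod ((deriv ^^ 2) f x) \<le> fact 2 * M / (R/2)^2"
    proof (rule Cauchy_inequality)
      show "f holomorphic_on ball x (R/2)"
        using holo sub ball_subset_cball holomorphic_on_subset by blast
      show "continuous_on (cball x (R/2)) f"
        using holo sub holomorphic_on_imp_continuous_on continuous_on_subset by blast
      fix y assume "cmod (x - y) = R/2"
      then have "y \<in> cball x (R/2)" by (simp add: dist_norm)
      then show "cmod (f y) \<le> M" using sub M by blast
    qed (use R in auto)
    then show ?thesis by (simp add: power_divide fact_2)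
  qed
  have "cmod ((deriv ^^ 0) f 1 - (\<Sum>i\<le>1. (deriv ^^ i) f 0 * (1 - 0) ^ i / fact i))
      \<le> 8 * M / R\<^sup>2 * cmod (1 - 0) ^ Suc 1 / fact 1"
  proof (rule complex_Taylor[where S = "cball 0 1"])
    fix i :: nat and x :: complex assume x: "x \<in> cball 0 1" "i \<le> 1"
    have "x \<in> ball 0 R" using x R by auto
    then have "((deriv ^^ i) f has_field_derivative (deriv ^^ Suc i) f x) (at x)"
      using holomorphic_derivI[OF holomorphic_higher_deriv[OF holo]] by simp
    then show "((deriv ^^ i) f has_field_derivative (deriv ^^ Suc i) f x) (at x within cball 0 1)"
      by (rule has_field_derivative_at_within)
  qed (use bound in \<open>auto simp: numeral_2_eq_2\<close>)
  then show ?thesis by (simp add: algebra_simps)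
qed

text \<open>Along the line in direction \<open>h\<close> the function is holomorphic in a disc of
  radius \<open>r / |h|\<close>, so the Taylor remainder is at most a constant times
  \<open>|h|\<^sup>2\<close>, with one constant for all directions.\<close>

lemma has_derivative_cform_from_lines:
  fixes f :: "complex^'d \<Rightarrow> complex"
  assumes r: "r > 0" and M: "\<And>w. w \<in> ball z r \<Longrightarrow> cmod (f w) \<le> M"
    and holo: "\<And>v. (\<lambda>t. f (z + t *s v)) holomorphic_on {t. z + t *s v \<in> ball z r}"
    and der: "\<And>v. deriv (\<lambda>t. f (z + t *s v)) 0 = cform a v"
  shows "(f has_derivative cform a) (at z)"
proof -
  have M0: "M \<ge> 0"
    using M[of z] r norm_ge_zero[of "f z"] by (metis centre_in_ball order_trans)
  have bound: "norm (f (z + h) - f z - cform a h) / norm h \<le> 8 * M / r\<^sup>2 * norm h"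
    if h: "h \<noteq> 0" "norm h < r / 4" for h
  proof -
    define R where "R = r / norm h"
    have R: "R \<ge> 4" using h r by (simp add: R_def field_simps)
    have sub: "ball 0 R \<subseteq> {t. z + t *s h \<in> ball z r}"
      using h by (auto simp: R_def dist_norm norm_vector_scale field_simps)
    have "cmod ((\<lambda>t. f (z + t *s h)) 1 - (\<lambda>t. f (z + t *s h)) 0 - deriv (\<lambda>t. f (z + t *s h)) 0)
       \<le> 8 * M / R\<^sup>2"
      by (rule Taylor_remainder_bound[OF holomorphic_on_subset[OF holo sub] R])
         (use sub M in blast)
    then have "norm (f (z + h) - f z - cform a h) \<le> 8 * M / R\<^sup>2"
      by (simp add: der)
    also have "\<dots> = 8 * M / r\<^sup>2 * norm h * norm h"
      using r h by (simp add: R_def power2_eq_square field_simps)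
    finally show ?thesis using h by (simp add: field_simps)
  qed
  have "((\<lambda>h. norm (f (z + h) - f z - cform a h) / norm h) \<longlongrightarrow> 0) (at 0)"
  proof (rule tendsto_sandwich[of "\<lambda>_. 0" _ _ "\<lambda>h. 8 * M / r\<^sup>2 * norm h"])
    show "\<forall>\<^sub>F h in at 0. norm (f (z + h) - f z - cform a h) / norm h \<le> 8 * M / r\<^sup>2 * norm h"
      unfolding eventually_at using bound r by (intro exI[of _ "r/4"]) auto
    have "((\<lambda>h::complex^'d. 8 * M / r\<^sup>2 * norm h) \<longlongrightarrow> 8 * M / r\<^sup>2 * norm (0 :: complex^'d)) (at 0)"
      by (intro tendsto_intros)
    then show "((\<lambda>h::complex^'d. 8 * M / r\<^sup>2 * norm h) \<longlongrightarrow> 0) (at 0)" by simp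
  qed auto
  then show ?thesis
    unfolding has_derivative_at using bounded_linear_cform by blast
qed

text \<open>Along each line the derivatives converge by Weierstrass' theorem, and a limit of
  linear forms is a linear form. The \<open>f n\<close> need to be differentiable only at
  \<open>z\<close> and holomorphic only along the lines through \<open>z\<close>; this is the form
  in which the translates of a function with singularities on a hyperplane can be inserted.\<close>

lemma has_derivative_cform_limit:
  fixes f :: "nat \<Rightarrow> complex^'d \<Rightarrow> complex"
  assumes r: "r > 0" and lim: "uniform_limit (ball z r) f g sequentially"
    and holo: "\<And>n v. (\<lambda>t. f n (z + t *s v)) holomorphic_on {t. z + t *s v \<in> ball z r}"
    and der: "\<And>n. (f n has_derivative cform (a n)) (at z)"
    and M: "\<And>w. w \<in> ball z r \<Longrightarrow> cmod (g w) \<le> M"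
  shows "\<exists>a. (g has_derivative cform a) (at z)"
proof -
  define S where "S v = {t. z + t *s v \<in> ball z r}" for v
  have S: "open (S v)" "0 \<in> S v" for v
    using open_line r by (auto simp: S_def)
  have unif: "uniform_limit (S v) (\<lambda>n t. f n (z + t *s v)) (\<lambda>t. g (z + t *s v)) sequentially" for v
    using lim unfolding uniform_limit_iff S_def by (fast elim: eventually_mono)
  have conv: "(\<lambda>n. cform (a n) v) \<longlonglongrightarrow> deriv (\<lambda>t. g (z + t *s v)) 0" for v
  proof -
    have "(\<lambda>n. deriv (\<lambda>t. f n (z + t *s v)) 0) \<longlonglongrightarrow> deriv (\<lambda>t. g (z + t *s v)) 0"
      by (rule deriv_complex_uniform_limit[OF unif _ _ S(1) S(2)])
         (use holo in \<open>auto simp: S_def\<close>)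
    moreover have "deriv (\<lambda>t. f n (z + t *s v)) 0 = cform (a n) v" for n
      by (rule DERIV_imp_deriv) (rule has_derivative_line, use der in simp)
    ultimately show ?thesis by simp
  qed
  define b where "b = (\<chi> i. deriv (\<lambda>t. g (z + t *s axis i 1)) 0)"
  have "(\<lambda>n. a n $ i) \<longlonglongrightarrow> b $ i" for i
    using conv[of "axis i 1"] by (simp add: b_def cform_axis)
  then have "(\<lambda>n. cform (a n) v) \<longlonglongrightarrow> cform b v" for v
    unfolding cform_def by (intro tendsto_sum tendsto_mult tendsto_const)
  then have db: "deriv (\<lambda>t. g (z + t *s v)) 0 = cform b v" for v
    using conv LIMSEQ_unique by blast
  have "(\<lambda>t. g (z + t *s v)) holomorphic_on S v" for v
  proof (rule holomorphic_uniform_sequence[OF S(1)])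
    show "(\<lambda>t. f n (z + t *s v)) holomorphic_on S v" for n
      using holo by (simp add: S_def)
    fix x assume "x \<in> S v"
    then obtain d where "d > 0" "cball x d \<subseteq> S v"
      using S(1) open_contains_cball by blast
    then show "\<exists>d>0. cball x d \<subseteq> S v \<and>
        uniform_limit (cball x d) (\<lambda>n t. f n (z + t *s v)) (\<lambda>t. g (z + t *s v)) sequentially"
      using unif uniform_limit_on_subset by blast
  qed
  then show ?thesis
    using has_derivative_cform_from_lines[OF r M _ db] by (auto simp: S_def)
qed

text \<open>Weierstrass' theorem in several variables. A single \<open>f n\<close> within distance
  1 of \<open>g\<close> provides the local bound for \<open>g\<close>.\<close>

theorem holomorphic_several_uniform_limit:
  fixes f :: "nat \<Rightarrow> complex^'d \<Rightarrow> complex"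
  assumes f: "\<And>n. holomorphic_several (f n) D"
    and lim: "\<And>z. z \<in> D \<Longrightarrow> \<exists>r>0. ball z r \<subseteq> D \<and> uniform_limit (ball z r) f g sequentially"
  shows "holomorphic_several g D"
  unfolding holomorphic_several_iff
proof
  fix z assume z: "z \<in> D"
  then obtain r where r: "r > 0" "ball z r \<subseteq> D" "uniform_limit (ball z r) f g sequentially"
    using lim by blast
  define s where "s = r / 2"
  have s: "s > 0" "cball z s \<subseteq> ball z r" using r by (auto simp: s_def)
  have "\<forall>\<^sub>F n in sequentially. \<forall>w\<in>ball z r. dist (f n w) (g w) < 1"
    using r(3) unfolding uniform_limit_iff by (simp add: zero_less_one)
  then obtain n where n: "\<And>w. w \<in> ball z r \<Longrightarrow> dist (f n w) (g w) < 1"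
    unfolding eventually_sequentially by blast
  have "continuous_on (cball z s) (f n)"
    using holomorphic_several_imp_continuous_on[OF f] r s by (meson continuous_on_subset order_trans)
  then have "compact (f n ` cball z s)"
    using compact_continuous_image compact_cball by blast
  then obtain B where B: "\<And>w. w \<in> cball z s \<Longrightarrow> cmod (f n w) \<le> B"
    using compact_imp_bounded bounded_iff by (metis image_eqI)
  have M: "cmod (g w) \<le> B + 1" if "w \<in> ball z s" for w
  proof -
    have "w \<in> cball z s" using that by auto
    moreover from this have "w \<in> ball z r" using s by blast
    ultimately
    show ?thesis
      using B[of w] n[of w] norm_triangle_ineq2[of "g w" "f n w"]
      by (simp add: dist_norm norm_minus_commute)
  qed
  have "\<exists>a. \<forall>n. (f n has_derivative cform (a n)) (at z)"
    using f z unfolding holomorphic_several_iff by meson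
  then obtain a where a: "\<And>n. (f n has_derivative cform (a n)) (at z)" by blast
  show "\<exists>a. (g has_derivative cform a) (at z)"
  proof (rule has_derivative_cform_limit[OF s(1) _ _ a M])
    show "uniform_limit (ball z s) f g sequentially"
      using r(3) s by (meson ball_subset_cball order_trans uniform_limit_on_subset)
    show "(\<lambda>t. f n (z + t *s v)) holomorphic_on {t. z + t *s v \<in> ball z s}" for n v
      by (rule holomorphic_on_line[OF f]) (use r s ball_subset_cball in blast)
  qed
qed

text \<open>Near a point \<open>z\<close> of the hyperplane, \<open>f\<close> is the uniform limit
  of its translates \<open>w \<mapsto> f (w + \<epsilon> n *s e)\<close> in a direction
  \<open>e\<close> transversal to the hyperplane. These are differentiable at \<open>z\<close>,
  because \<open>z + \<epsilon> n *s e\<close> is off the hyperplane, and a line through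
  \<open>z\<close> meets the translated hyperplane in at most one point, which is a removable
  singularity of a continuous function of one variable.\<close>

theorem holomorphic_several_removable:
  fixes f :: "complex^'d \<Rightarrow> complex"
  assumes D: "open D" and f: "continuous_on D f" and l: "l \<noteq> 0"
    and holo: "holomorphic_several f {z\<in>D. cform l z \<noteq> 0}"
  shows "holomorphic_several f D"
  unfolding holomorphic_several_iff
proof
  fix z assume z: "z \<in> D"
  show "\<exists>a. (f has_derivative cform a) (at z)"
  proof (cases "cform l z = 0")
    case False
    then show ?thesis using holo z unfolding holomorphic_several_iff by blast
  next
    case True
    obtain i where i: "l $ i \<noteq> 0" using l by (auto simp: vec_eq_iff)
    define e :: "complex^'d" where "e = axis i (1 / l $ i)"
    have e: "cform l e = 1" using i by (simp add: e_def cform_axis)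
    then have e0: "norm e > 0" by auto
    obtain R where R: "R > 0" "cball z R \<subseteq> D" using D z open_contains_cball by blast
    define r where "r = R / 2"
    have r: "r > 0" using R by (simp add: r_def)
    define \<epsilon> where "\<epsilon> n = complex_of_real (r / (norm e * real (Suc n)))" for n
    have \<epsilon>: "\<epsilon> n \<noteq> 0" for n using r e0 by (simp add: \<epsilon>_def del: of_nat_Suc)
    have ne: "norm (\<epsilon> n *s e) = r / real (Suc n)" for n
      using r e0 by (simp add: norm_vector_scale \<epsilon>_def norm_divide norm_mult del: of_nat_Suc)
    have ner: "norm (\<epsilon> n *s e) \<le> r" for n
      using r by (simp add: ne divide_le_eq mult_le_cancel_left1 del: of_nat_Suc) 
    have shift: "w + \<epsilon> n *s e \<in> cball z R" if "w \<in> ball z r" for w n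
    proof -
      have "dist z (w + \<epsilon> n *s e) \<le> dist z w + norm (\<epsilon> n *s e)"
        by (metis dist_norm dist_triangle add_diff_cancel_left' norm_minus_commute)
      then show ?thesis using that ner[of n] by (simp add: r_def)
    qed
    have cont: "continuous_on (cball z R) f" using f R continuous_on_subset by blast
    then have "compact (f ` cball z R)" using compact_continuous_image compact_cball by blast
    then obtain M where M: "\<And>w. w \<in> cball z R \<Longrightarrow> cmod (f w) \<le> M"
      using compact_imp_bounded bounded_iff by (metis image_eqI)
    define g where "g n w = f (w + \<epsilon> n *s e)" for n w
    have "\<exists>a. \<forall>n. (g n has_derivative cform (a n)) (at z)"
    proof (rule choice, rule allI)
      fix n
      have "z + \<epsilon> n *s e \<in> {z\<in>D. cform l z \<noteq> 0}"
        using shift[of z n] r R \<epsilon> by (auto simp: cform_add cform_scale True e)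
      then obtain a where a: "(f has_derivative cform a) (at (z + \<epsilon> n *s e))"
        using holo unfolding holomorphic_several_iff by blast
      have "((\<lambda>w. w + \<epsilon> n *s e) has_derivative (\<lambda>w. w)) (at z)"
        by (auto intro!: derivative_eq_intros)
      from has_derivative_compose[OF this a]
      show "\<exists>a. (g n has_derivative cform a) (at z)" unfolding g_def by blast
    qed
    then obtain a where a: "\<And>n. (g n has_derivative cform (a n)) (at z)" by blast
    show ?thesis
    proof (rule has_derivative_cform_limit[OF r _ _ a, where g = f and M = M])
      show "uniform_limit (ball z r) g f sequentially"
        unfolding uniform_limit_iff
      proof (intro allI impI)
        fix \<eta> :: real assume \<eta>: "\<eta> > 0"
        have "uniformly_continuous_on (cball z R) f"
          using cont compact_uniformly_continuous compact_cball by blast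
        then obtain \<delta> where \<delta>: "\<delta> > 0"
          "\<And>x y. x \<in> cball z R \<Longrightarrow> y \<in> cball z R \<Longrightarrow> dist y x < \<delta> \<Longrightarrow> dist (f y) (f x) < \<eta>"
          using \<eta> unfolding uniformly_continuous_on_def by metis
        have "(\<lambda>n. r / real (Suc n)) \<longlonglongrightarrow> 0"
          using LIMSEQ_Suc[OF lim_const_over_n[of r]] by simp
        then have "\<forall>\<^sub>F n in sequentially. r / real (Suc n) < \<delta>"
          using \<delta>(1) order_tendstoD(2) by blast
        then show "\<forall>\<^sub>F n in sequentially. \<forall>x\<in>ball z r. dist (g n x) (f x) < \<eta>"
        proof eventually_elim
          case (elim n)
          show ?case
          proof
            fix x assume x: "x \<in> ball z r"
            then have "x \<in> cball z R" using r by (auto simp: r_def)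
            then show "dist (g n x) (f x) < \<eta>"
              unfolding g_def using \<delta>(2)[of x "x + \<epsilon> n *s e"] shift[OF x] elim ne[of n]
              by (simp add: dist_norm)
          qed
        qed
      qed
      show "cmod (f w) \<le> M" if "w \<in> ball z r" for w
        using M[of w] that R by (auto simp: r_def)
      show "(\<lambda>t. g n (z + t *s v)) holomorphic_on {t. z + t *s v \<in> ball z r}" for n v
      proof (rule no_isolated_singularity)
        let ?K = "{t. \<epsilon> n + t * cform l v = 0}"
        have "?K \<subseteq> {- \<epsilon> n / cform l v}"
          using \<epsilon>[of n] by (auto simp: eq_divide_eq add_eq_0_iff2 add_eq_0_iff)
        then show "finite ?K" using finite_subset by blast
        have eq: "g n (z + t *s v) = f ((z + \<epsilon> n *s e) + t *s v)" for t
          by (simp add: g_def add_ac)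
        have inD: "(z + \<epsilon> n *s e) + t *s v \<in> cball z R" if "z + t *s v \<in> ball z r" for t
          using shift[OF that, of n] by (simp add: add_ac)
        show "continuous_on {t. z + t *s v \<in> ball z r} (\<lambda>t. g n (z + t *s v))"
          unfolding eq
          by (rule continuous_on_compose2[OF cont])
             (use inD in \<open>auto intro!: continuous_intros simp: vector_scalar_mult_def\<close>)
        show "(\<lambda>t. g n (z + t *s v)) holomorphic_on {t. z + t *s v \<in> ball z r} - ?K"
          unfolding eq
        proof (rule holomorphic_on_line[OF holo])
          fix t assume t: "t \<in> {t. z + t *s v \<in> ball z r} - ?K"
          then have "(z + \<epsilon> n *s e) + t *s v \<in> D" using inD R(2) by blast
          moreover have "cform l ((z + \<epsilon> n *s e) + t *s v) \<noteq> 0"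
            using t by (simp add: cform_add cform_scale True e)
          ultimately show "(z + \<epsilon> n *s e) + t *s v \<in> {z\<in>D. cform l z \<noteq> 0}" by simp
        qed
      qed (rule open_line)
    qed
  qed
qed

text \<open>Continuity of directional derivatives: the functions \<open>t \<mapsto> f (X n + t *s
  v)\<close> converge uniformly near 0, hence so do their derivatives.\<close>

lemma tendsto_directional_derivative:
  fixes f :: "complex^'d \<Rightarrow> complex"
  assumes D: "open D" and z: "z \<in> D"
    and a: "\<And>w. w \<in> D \<Longrightarrow> (f has_derivative cform (a w)) (at w)"
  shows "((\<lambda>w. cform (a w) v) \<longlongrightarrow> cform (a z) v) (at z)"
  unfolding tendsto_at_iff_sequentially
proof (intro allI impI)
  fix X :: "nat \<Rightarrow> complex^'d" assume X: "X \<longlonglongrightarrow> z"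
  have f: "holomorphic_several f D" using a unfolding holomorphic_several_iff by blast
  obtain R where R: "R > 0" "cball z R \<subseteq> D" using D z open_contains_cball by blast
  define r where "r = R / 2"
  have r: "r > 0" using R by (simp add: r_def)
  let ?S = "{t. z + t *s v \<in> ball z r}"
  have near: "\<forall>\<^sub>F n in sequentially. dist (X n) z < r"
    using X r tendstoD by blast
  have shift: "X n + t *s v \<in> cball z R" if "dist (X n) z < r" "t \<in> ?S" for n t
  proof -
    have "dist z (X n + t *s v) \<le> dist (X n) z + dist z (z + t *s v)"
      using norm_triangle_ineq4[of "z - (z + t *s v)" "X n - z"]
      by (simp add: dist_norm algebra_simps)
    then show ?thesis using that by (simp add: r_def)
  qed
  have "(\<lambda>n. deriv (\<lambda>t. f (X n + t *s v)) 0) \<longlonglongrightarrow> deriv (\<lambda>t. f (z + t *s v)) 0"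
  proof (rule deriv_complex_uniform_limit[where A = ?S])
    show "uniform_limit ?S (\<lambda>n t. f (X n + t *s v)) (\<lambda>t. f (z + t *s v)) sequentially"
      unfolding uniform_limit_iff
    proof (intro allI impI)
      fix \<eta> :: real assume \<eta>: "\<eta> > 0"
      have "continuous_on (cball z R) f"
        using holomorphic_several_imp_continuous_on[OF f] R continuous_on_subset by blast
      then have "uniformly_continuous_on (cball z R) f"
        using compact_uniformly_continuous compact_cball by blast
      then obtain \<delta> where \<delta>: "\<delta> > 0"
        "\<And>x y. x \<in> cball z R \<Longrightarrow> y \<in> cball z R \<Longrightarrow> dist y x < \<delta> \<Longrightarrow> dist (f y) (f x) < \<eta>"
        using \<eta> unfolding uniformly_continuous_on_def by metis
      have "\<forall>\<^sub>F n in sequentially. dist (X n) z < \<delta>" using X \<delta>(1) tendstoD by blast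
      with near show "\<forall>\<^sub>F n in sequentially. \<forall>t\<in>?S. dist (f (X n + t *s v)) (f (z + t *s v)) < \<eta>"
      proof eventually_elim
        case (elim n)
        show ?case
        proof
          fix t assume t: "t \<in> ?S"
          have "z + t *s v \<in> cball z R" using t r by (auto simp: r_def)
          then show "dist (f (X n + t *s v)) (f (z + t *s v)) < \<eta>"
            using \<delta>(2) shift[OF elim(1) t] elim(2) by simp
        qed
      qed
    qed
    show "\<forall>\<^sub>F n in sequentially. (\<lambda>t. f (X n + t *s v)) holomorphic_on ?S"
      using near
    proof eventually_elim
      case (elim n)
      show ?case by (rule holomorphic_on_line[OF f]) (use shift[OF elim] R in blast)
    qed
  qed (use r open_line in auto)
  moreover have "deriv (\<lambda>t. f (w + t *s v)) 0 = cform (a w) v" if "w \<in> D" for w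
    by (rule DERIV_imp_deriv) (rule has_derivative_line, use a that in simp)
  moreover have "\<forall>\<^sub>F n in sequentially. X n \<in> D"
    using X D z topological_tendstoD by blast
  ultimately have "(\<lambda>n. cform (a (X n)) v) \<longlonglongrightarrow> cform (a z) v"
    using z by (auto elim!: Lim_transform_eventually eventually_mono)
  then show "((\<lambda>w. cform (a w) v) \<circ> X) \<longlonglongrightarrow> cform (a z) v" by (simp add: o_def)
qed

text \<open>On the hyperplane the quotient is given the value of the derivative of
  \<open>f\<close> in a direction \<open>e\<close> with \<open>cform l e = 1\<close>. The mean value
  inequality along \<open>e\<close> shows that this extension is continuous, so removability
  applies.\<close>

theorem holomorphic_several_divide_form:
  fixes f :: "complex^'d \<Rightarrow> complex"
  assumes D: "open D" and f: "holomorphic_several f D" and l: "l \<noteq> 0"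
    and zero: "\<And>z. z \<in> D \<Longrightarrow> cform l z = 0 \<Longrightarrow> f z = 0"
  obtains q where "holomorphic_several q D" "\<And>z. z \<in> D \<Longrightarrow> f z = cform l z * q z"
proof -
  obtain a where a: "\<And>w. w \<in> D \<Longrightarrow> (f has_derivative cform (a w)) (at w)"
    using f unfolding holomorphic_several_iff by metis
  obtain i where i: "l $ i \<noteq> 0" using l by (auto simp: vec_eq_iff)
  define e :: "complex^'d" where "e = axis i (1 / l $ i)"
  have e: "cform l e = 1" using i by (simp add: e_def cform_axis)
  define q where "q w = (if cform l w = 0 then cform (a w) e else f w / cform l w)" for w
  have eq: "f w = cform l w * q w" if "w \<in> D" for w
    using zero[OF that] by (simp add: q_def)
  have cont: "isCont q w" if w: "w \<in> D" for w
  proof (cases "cform l w = 0")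
    case False
    have cl: "isCont (cform l) w" "isCont f w"
      by (rule linear_continuous_at[OF bounded_linear_cform])
         (rule has_derivative_continuous[OF a[OF w]])
    have "isCont (\<lambda>w. f w / cform l w) w" using cl False by (intro continuous_intros) auto
    moreover have "\<forall>\<^sub>F x in nhds w. q x = f x / cform l x"
    proof -
      have "open {x. cform l x \<noteq> 0}"
        by (intro open_Collect_neq linear_continuous_on bounded_linear_cform continuous_on_const)
      then show ?thesis using False
        by (auto simp: eventually_nhds q_def intro!: exI[of _ "{x. cform l x \<noteq> 0}"])
    qed
    ultimately show ?thesis using isCont_cong by fast
  next
    case True
    show ?thesis unfolding isCont_def
    proof (rule tendstoI)
      fix \<eta>' :: real assume \<eta>': "\<eta>' > 0"
      define \<eta> where "\<eta> = \<eta>' / 2"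
      have \<eta>: "\<eta> > 0" "\<eta> < \<eta>'" using \<eta>' by (auto simp: \<eta>_def)
      have "\<forall>\<^sub>F x in at w. dist (cform (a x) e) (cform (a w) e) < \<eta>"
        using tendsto_directional_derivative[OF D w a, of e] \<eta> tendstoD by blast
      moreover have "\<forall>\<^sub>F x in at w. x \<in> D" using D w eventually_at_topological by blast
      ultimately have "\<forall>\<^sub>F x in at w. x \<in> D \<and> dist (cform (a x) e) (cform (a w) e) < \<eta>"
        by (simp add: eventually_conj_iff)
      then obtain \<delta> where \<delta>: "\<delta> > 0"
        "\<And>x. x \<noteq> w \<Longrightarrow> dist x w < \<delta> \<Longrightarrow> x \<in> D \<and> dist (cform (a x) e) (cform (a w) e) < \<eta>"
        unfolding eventually_at by auto
      have \<delta>': "x \<in> D \<and> cmod (cform (a x) e - cform (a w) e) \<le> \<eta>" if "dist x w < \<delta>" for x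
        using \<delta>(2)[of x] that w \<eta>(1) by (cases "x = w") (auto simp: dist_norm)
      have "((\<lambda>x. dist x w + cmod (cform l x) * norm e) \<longlongrightarrow> dist w w + cmod (cform l w) * norm e) (at w)"
        by (intro tendsto_intros bounded_linear.tendsto[OF bounded_linear_cform])
      then have "\<forall>\<^sub>F x in at w. dist x w + cmod (cform l x) * norm e < \<delta>"
        using \<delta>(1) by (auto simp: True intro: order_tendstoD(2))
      then show "\<forall>\<^sub>F x in at w. dist (q x) (q w) < \<eta>'"
      proof eventually_elim
        case (elim x)
        \<comment> \<open>\<open>y\<close> is the projection of \<open>x\<close> to the hyperplane
          along \<open>e\<close>, so that \<open>f y = 0\<close>, and \<open>f\<close> is followed
          from \<open>y\<close> to \<open>x = y + s *s e\<close>.\<close>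
        define s where "s = cform l x"
        define y where "y = x - s *s e"
        show ?case
        proof (cases "s = 0")
          case True
          then show ?thesis
            using elim \<delta>'[of x] \<open>cform l w = 0\<close> \<eta> by (simp add: q_def s_def dist_norm)
        next
          case False
          have ys: "y + s *s e = x" by (simp add: y_def)
          have seg: "dist (y + t *s e) w < \<delta>" if "t \<in> closed_segment 0 s" for t
          proof -
            have "y + t *s e - w = (x - w) + (t - s) *s e"
              by (simp add: y_def vec_eq_iff algebra_simps)
            then have "dist (y + t *s e) w \<le> dist x w + cmod (t - s) * norm e"
              by (metis dist_norm norm_triangle_ineq norm_vector_scale)
            moreover have "cmod (t - s) \<le> cmod s"
              using segment_bound(2)[OF that] by (simp add: norm_minus_commute)
            ultimately show ?thesis using elim s_def
              by (smt (verit) mult_right_mono norm_ge_zero)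
          qed
          have "cmod ((f (y + s *s e) - s * cform (a w) e) - (f (y + 0 *s e) - 0 * cform (a w) e))
             \<le> \<eta> * cmod (s - 0)"
          proof (rule field_differentiable_bound[where S = "closed_segment 0 s"])
            fix t assume t: "t \<in> closed_segment 0 s"
            have "(f has_derivative cform (a (y + t *s e))) (at (y + t *s e))"
              by (rule a) (use \<delta>'[OF seg[OF t]] in simp)
            from has_derivative_line[OF this]
            have "((\<lambda>t. f (y + t *s e) - t * cform (a w) e) has_field_derivative
                cform (a (y + t *s e)) e - 1 * cform (a w) e) (at t)"
              by (intro DERIV_diff DERIV_cmult_right DERIV_ident)
            then show "((\<lambda>t. f (y + t *s e) - t * cform (a w) e) has_field_derivative
                cform (a (y + t *s e)) e - cform (a w) e) (at t within closed_segment 0 s)"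
              by (simp add: has_field_derivative_at_within)
            show "cmod (cform (a (y + t *s e)) e - cform (a w) e) \<le> \<eta>"
              using \<delta>'[OF seg[OF t]] by simp
          qed (auto simp: convex_closed_segment)
          moreover have "f y = 0"
          proof (rule zero)
            show "y \<in> D" using \<delta>'[OF seg[of 0]] by simp
            show "cform l y = 0" by (simp add: y_def cform_diff cform_scale e s_def)
          qed
          ultimately have "cmod (f x - s * cform (a w) e) \<le> \<eta> * cmod s"
            by (simp add: ys)
          moreover have "f x - s * cform (a w) e = s * (q x - q w)"
            using False \<open>cform l w = 0\<close> by (simp add: q_def s_def algebra_simps)
          ultimately have "cmod (q x - q w) \<le> \<eta>"
            using False by (simp add: norm_mult mult.commute)
          then show ?thesis using \<eta> by (simp add: dist_norm)
        qed
      qed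
    qed
  qed
  have "holomorphic_several q D"
  proof (rule holomorphic_several_removable[OF D _ l])
    show "continuous_on D q" using cont by (simp add: continuous_at_imp_continuous_on)
    show "holomorphic_several q {z \<in> D. cform l z \<noteq> 0}"
    proof (rule holomorphic_several_cong)
      show "open {z \<in> D. cform l z \<noteq> 0}"
        using D by (intro open_Collect_conj open_Collect_neq linear_continuous_on
            bounded_linear_cform continuous_on_const) auto
      show "holomorphic_several (\<lambda>z. f z * inverse (cform l z)) {z \<in> D. cform l z \<noteq> 0}"
        by (intro holomorphic_several_mult holomorphic_several_subset[OF f]
            holomorphic_several_field_compose[where p = inverse] holomorphic_several_cform)
           (auto intro: DERIV_inverse)
    qed (simp add: q_def divide_inverse)
  qed
  then show thesis using that eq by blast
qed

section \<open>Determinants and change of variables\<close>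

text \<open>These matrices comprise the shears, the diagonal matrices with one entry different
  from 1, and the pivot steps of Gaussian elimination.\<close>

definition replace_column :: "'d \<Rightarrow> complex^'d \<Rightarrow> complex^'d^'d" where
  "replace_column k b = (\<chi> i j. if j = k then b $ i else if i = j then 1 else 0)"

lemma replace_column_mult_vec: "replace_column k b *v x = x + x $ k *s (b - axis k 1)"
proof -
  have "(\<Sum>j\<in>UNIV. (if j = k then b $ i else if i = j then 1 else 0) * x $ j)
     = x $ i + x $ k * (b $ i - (if i = k then 1 else 0))" for i
  proof -
    have "(\<Sum>j\<in>UNIV. (if j = k then b $ i else if i = j then 1 else 0) * x $ j)
      = (\<Sum>j\<in>UNIV. (if j = k then (b $ i - (if i = k then 1 else 0)) * x $ j else 0)
           + (if j = i then x $ j else 0))"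
      by (rule sum.cong) (auto simp: algebra_simps)
    then show ?thesis by (simp add: sum.distrib)
  qed
  then show ?thesis
    by (simp add: vec_eq_iff replace_column_def matrix_vector_mult_def axis_def algebra_simps)
qed

lemma det_replace_column: "det (replace_column k b) = b $ k"
proof -
  have "replace_column k b = (\<chi> i j. if j = k then (mat 1 *v b) $ i else mat 1 $ i $ j)"
    unfolding replace_column_def matrix_vector_mul_lid by (simp add: mat_def vec_eq_iff)
  then show ?thesis using cramer_lemma[of k "mat 1" b] by simp
qed

text \<open>A shear is conjugate to its own square by a diagonal matrix, so a multiplicative
  function is 1 on it. The diagonal matrices with one entry \<open>a\<close> are conjugate to each
  other by permutation matrices, so they share one value, which the hypothesis on scalar matrices
  determines. Gaussian elimination extends the formula to all invertible matrices. The real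
  determinant of a complex matrix is computed in this way below, without a block
  decomposition.\<close>

theorem multiplicative_eq_norm_det_squared:
  fixes f :: "complex^'d^'d \<Rightarrow> real"
  assumes mult: "\<And>A B. f (A ** B) = f A * f B"
    and scal: "\<And>a. a \<noteq> 0 \<Longrightarrow> f (mat a) = cmod a ^ (2 * CARD('d))"
    and nonneg: "\<And>A. f A \<ge> 0"
    and A: "det A \<noteq> 0"
  shows "f A = (cmod (det A))\<^sup>2"
proof -
  have f1: "f (mat 1) = 1" using scal[of 1] by simp
  define n where "n k a = f (replace_column k (axis k a))" for k a
  have shear: "f (replace_column k (axis k 1 + v)) = 1" if v: "v $ k = 0" for k v
  proof -
    let ?C = "replace_column k (axis k 1 + v)"
    let ?D = "replace_column k (axis k (1/2))" and ?D' = "replace_column k (axis k 2)"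
    have "?D ** ?D' = mat 1"
      by (simp add: matrix_eq replace_column_mult_vec matrix_vector_mul_assoc[symmetric] vec_eq_iff axis_def)
    then have DD: "f ?D * f ?D' = 1" using mult f1 by metis
    have "?C ** replace_column k (axis k 1 - v) = mat 1"
      using v by (simp add: matrix_eq replace_column_mult_vec matrix_vector_mul_assoc[symmetric] vec_eq_iff axis_def)
    then have C0: "f ?C \<noteq> 0" using mult f1 by (metis mult_zero_left zero_neq_one)
    have "?D ** ?C ** ?D' = ?C ** ?C"
      using v by (simp add: matrix_eq replace_column_mult_vec matrix_vector_mul_assoc[symmetric] vec_eq_iff axis_def)
    then have "f ?D * f ?C * f ?D' = f ?C * f ?C" by (metis mult)
    then have "f ?C = f ?C * f ?C" using DD by (simp add: algebra_simps)
    then show ?thesis using C0 by simp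
  qed
  have n_eq: "n k a = n l a" for k l a
  proof (cases "k = l")
    case False
    define W :: "complex^'d^'d" where "W = (\<chi> i j. if i = Transposition.transpose k l j then 1 else 0)"
    have Wv: "(W *v x) $ i = x $ Transposition.transpose k l i" for x i
    proof -
      have "(i = Transposition.transpose k l j) = (j = Transposition.transpose k l i)" for j
        by (metis transpose_involutory)
      then show ?thesis
        by (simp add: W_def matrix_vector_mult_def if_distrib[of "\<lambda>c. c * _"] cong: if_cong)
    qed
    have "W ** W = mat 1"
      by (simp add: matrix_eq matrix_vector_mul_assoc[symmetric] vec_eq_iff Wv)
    then have W1: "f W * f W = 1" using mult f1 by metis
    have "W ** replace_column k (axis k a) ** W = replace_column l (axis l a)"
      using False
      by (auto simp: matrix_eq matrix_vector_mul_assoc[symmetric] vec_eq_iff Wv replace_column_mult_vec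
          axis_def Transposition.transpose_def)
    then have "f W * n k a * f W = n l a" unfolding n_def by (metis mult)
    then show ?thesis using W1 by (metis mult.assoc mult.commute mult.right_neutral)
  qed simp
  have n_sq: "n k a = (cmod a)\<^sup>2" if a: "a \<noteq> 0" for k a
  proof -
    have "f (\<chi> i j. if i = j then (if i \<in> K then a else 1) else 0) = n k a ^ card K" for K
      using finite[of K]
    proof (induction K rule: finite_induct)
      case empty
      then show ?case using f1 by (simp add: mat_def cong: if_cong)
    next
      case (insert l K)
      have diag: "((\<chi> i j. if i = j then (if i \<in> K then a else 1) else 0) *v x) $ i
          = (if i \<in> K then a else 1) * x $ i" for K x i
        by (simp add: matrix_vector_mult_def if_distrib[of "\<lambda>c. c * _"] cong: if_cong)
      have "(\<chi> i j. if i = j then (if i \<in> insert l K then a else 1) else 0)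
          = replace_column l (axis l a) ** (\<chi> i j. if i = j then (if i \<in> K then a else 1) else 0)"
        using insert(2)
        by (auto simp: matrix_eq matrix_vector_mul_assoc[symmetric] vec_eq_iff diag replace_column_mult_vec
            axis_def algebra_simps)
      then show ?case
        using insert n_eq[of l a k] by (simp add: mult n_def)
    qed
    from this[of UNIV] have "n k a ^ CARD('d) = ((cmod a)\<^sup>2) ^ CARD('d)"
      using scal[OF a] by (simp add: mat_def power_mult cong: if_cong)
    then show ?thesis
      using nonneg by (simp add: n_def power_eq_iff_eq_base)
  qed
  define P where "P A \<longleftrightarrow> f A = (cmod (det A))\<^sup>2" for A
  have P_replace: "P (replace_column k b)" if "b $ k \<noteq> 0" for k b
  proof -
    define v where "v = (1 / b $ k) *s (b - axis k (b $ k))"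
    have v: "v $ k = 0" by (simp add: v_def axis_def)
    have "replace_column k b = replace_column k (axis k 1 + v) ** replace_column k (axis k (b $ k))"
      using that v by (auto simp: matrix_eq matrix_vector_mul_assoc[symmetric] replace_column_mult_vec
          vec_eq_iff axis_def v_def field_simps)
    then have "f (replace_column k b)
        = f (replace_column k (axis k 1 + v)) * f (replace_column k (axis k (b $ k)))"
      by (metis mult)
    then show ?thesis
      using shear[OF v] n_sq[OF that] by (simp add: P_def det_replace_column n_def)
  qed
  have P_cancel: "P B" if "P C" "P (C ** B)" "det C \<noteq> 0" for B C
    using that by (simp add: P_def mult det_mul norm_mult power_mult_distrib)
  have P_mult: "P (C ** B)" if "P C" "P B" for B C
    using that by (simp add: P_def mult det_mul norm_mult power_mult_distrib)
  have col: "(B *v axis j 1) $ i = B $ i $ j" for B :: "complex^'d^'d" and i j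
    by (simp add: matrix_vector_mult_def axis_def if_distrib[of "\<lambda>c. _ * c"] cong: if_cong)
  \<comment> \<open>Induction on the set \<open>K\<close> of the columns that may differ from the
    unit vectors.\<close>
  have "P A" if "det A \<noteq> 0" "\<And>j. j \<notin> K \<Longrightarrow> A *v axis j 1 = axis j 1" for K A
    using finite[of K] that
  proof (induction K arbitrary: A rule: finite_induct)
    case empty
    have "A $ i $ j = (mat 1 :: complex^'d^'d) $ i $ j" for i j
    proof -
      have "A $ i $ j = (A *v axis j 1) $ i" by (rule col[symmetric])
      also have "A *v axis j 1 = axis j 1" by (rule empty(2)) simp
      finally show ?thesis by (simp add: axis_def mat_def)
    qed
    then have "A = mat 1" by (simp add: vec_eq_iff)
    then show ?case using f1 by (simp add: P_def)
  next
    case (insert k K)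
    have pivot: "P B" if B: "det B \<noteq> 0" "B $ k $ k \<noteq> 0"
      "\<And>j. j \<notin> insert k K \<Longrightarrow> B *v axis j 1 = axis j 1" for B
    proof -
      define b where "b = B *v axis k 1"
      have bk: "b $ k \<noteq> 0" using B(2) by (simp add: b_def col)
      \<comment> \<open>\<open>replace_column k c\<close> is the inverse of \<open>replace_column
        k b\<close>; it turns column \<open>k\<close> of \<open>B\<close> into a unit
        vector.\<close>
      define c where "c = (1 / b $ k) *s (axis k 1 + axis k (b $ k) - b)"
      have ck: "c $ k \<noteq> 0" using bk by (simp add: c_def axis_def)
      have "replace_column k b ** replace_column k c = mat 1"
        using bk by (auto simp: matrix_eq matrix_vector_mul_assoc[symmetric] replace_column_mult_vec
          vec_eq_iff axis_def c_def field_simps)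
      moreover have "P (replace_column k c ** B)"
      proof (rule insert.IH)
        show "det (replace_column k c ** B) \<noteq> 0"
          using B ck by (simp add: det_mul det_replace_column)
        fix j assume j: "j \<notin> K"
        show "replace_column k c ** B *v axis j 1 = axis j 1"
        proof (cases "j = k")
          case True
          have "replace_column k c ** B *v axis k 1 = replace_column k c *v b"
            by (simp only: matrix_vector_mul_assoc[symmetric] b_def)
          also have "\<dots> = axis k 1" using bk
            by (auto simp: replace_column_mult_vec c_def vec_eq_iff axis_def field_simps)
          finally show ?thesis using True by simp
        next
          case False
          then show ?thesis using j B(3)
            by (simp add: matrix_vector_mul_assoc[symmetric] replace_column_mult_vec)
               (simp add: axis_def)
        qed
      qed
      ultimately show ?thesis
        using P_cancel[OF P_replace[OF ck], of B] ck by (simp add: det_replace_column)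
    qed
    \<comment> \<open>Otherwise column \<open>k\<close> would be a combination of the unit vectors
      in the columns outside \<open>insert k K\<close>, and \<open>A\<close> would be
      singular.\<close>
    have "\<exists>i\<in>insert k K. A $ i $ k \<noteq> 0"
    proof (rule ccontr)
      assume "\<not> (\<exists>i\<in>insert k K. A $ i $ k \<noteq> 0)"
      then have 0: "A $ i $ k = 0" if "i \<in> insert k K" for i using that by blast
      define x where "x = axis k 1 - (\<chi> i. if i \<in> insert k K then 0 else A $ i $ k)"
      have "A *v x = 0"
      proof -
        have "(A *v x) $ i = 0" for i
        proof -
        have "(A *v x) $ i = A $ i $ k - (\<Sum>j\<in>UNIV. if j \<in> insert k K then 0 else A $ i $ j * A $ j $ k)"
          by (simp add: x_def matrix_vector_mult_diff_distrib col)
             (simp add: matrix_vector_mult_def if_distrib cong: if_cong)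
        also have "(\<Sum>j\<in>UNIV. if j \<in> insert k K then 0 else A $ i $ j * A $ j $ k)
           = (\<Sum>j\<in>UNIV. if j = i then (if j \<in> insert k K then 0 else A $ j $ k) else 0)"
        proof (rule sum.cong)
          fix j
          show "(if j \<in> insert k K then 0 else A $ i $ j * A $ j $ k)
             = (if j = i then if j \<in> insert k K then 0 else A $ j $ k else 0)"
          proof (cases "j \<in> insert k K")
            case False
            then have "A $ i $ j = (axis j 1 :: complex^'d) $ i"
              using insert.prems(2) col[of A j i] by simp
            then show ?thesis using False by (auto simp: axis_def)
          qed auto
        qed simp
        finally show ?thesis using 0 by simp
        qed
        then show ?thesis by (simp add: vec_eq_iff)
      qed
      moreover have "x $ k = 1" by (simp add: x_def axis_def)
      ultimately show False
        using insert.prems(1) invertible_det_nz[of A] matrix_left_invertible_ker[of A]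
        by (metis invertible_def zero_index zero_neq_one)
    qed
    then obtain i where i: "i \<in> insert k K" "A $ i $ k \<noteq> 0" by blast
    show "P A"
    proof (cases "A $ k $ k = 0")
      case False
      then show ?thesis using pivot insert.prems by blast
    next
      case True
      then have ik: "i \<noteq> k" using i by metis
      \<comment> \<open>\<open>?S\<close> adds row \<open>i\<close> to row \<open>k\<close>, which
        makes the pivot nonzero.\<close>
      let ?S = "replace_column i (axis i 1 + axis k 1)"
      have Si: "(axis i 1 + axis k 1 :: complex^'d) $ i \<noteq> 0" using ik by (simp add: axis_def)
      have "P (?S ** A)"
      proof (rule pivot)
        show "det (?S ** A) \<noteq> 0"
          using insert.prems(1) Si by (simp add: det_mul det_replace_column)
        show "(?S ** A) $ k $ k \<noteq> 0"
          using True i ik by (simp add: col[symmetric] matrix_vector_mul_assoc[symmetric] replace_column_mult_vec)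
        fix j assume j: "j \<notin> insert k K"
        then have "j \<noteq> i" using i by metis
        then show "?S ** A *v axis j 1 = axis j 1"
          using insert.prems(2)[OF j] by (simp add: matrix_vector_mul_assoc[symmetric] replace_column_mult_vec)
             (simp add: axis_def)
      qed
      then show ?thesis
        using P_cancel[OF P_replace[OF Si], of A] Si by (simp add: det_replace_column)
    qed
  qed
  from this[of A UNIV] A show ?thesis by (simp add: P_def)
qed

text \<open>The index type \<open>'d bit0\<close> has twice as many elements as \<open>'d\<close>
  and is well-ordered, as the theory of change of variables in \<open>real^'n\<close> requires. The
  coordinates are those of an orthonormal basis, so \<open>E\<close> maps boxes to boxes of the same
  volume.\<close>

lemma real_coordinates:
  obtains R :: "complex^'d \<Rightarrow> real^('d bit0)" and E
  where "linear R" "linear E" "\<And>z. E (R z) = z" "\<And>x. R (E x) = x" "\<And>z. norm (R z) = norm z"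
    "distr lborel borel E = lborel"
proof -
  have "card (Basis :: (complex^'d) set) = CARD('d bit0)" by simp
  then obtain \<beta> :: "'d bit0 \<Rightarrow> complex^'d" where \<beta>: "bij_betw \<beta> UNIV Basis"
    by (metis finite_Basis finite finite_same_card_bij)
  define R where "R z = (\<chi> j. z \<bullet> \<beta> j)" for z
  define E where "E x = (\<Sum>j\<in>UNIV. x $ j *\<^sub>R \<beta> j)" for x :: "real^('d bit0)"
  have \<beta>B: "\<beta> j \<in> Basis" for j using \<beta> by (simp add: bij_betw_apply)
  have \<beta>i: "\<beta> i \<bullet> \<beta> j = (if i = j then 1 else 0)" for i j
    using \<beta>B inner_Basis \<beta> by (metis bij_betw_imp_inj_on inj_eq)
  have sumB: "(\<Sum>b\<in>Basis. h b) = (\<Sum>j\<in>UNIV. h (\<beta> j))" for h :: "complex^'d \<Rightarrow> complex^'d"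
    using sum.reindex_bij_betw[OF \<beta>, of h] by simp
  have ER: "E (R z) = z" for z
    using euclidean_representation[of z] by (simp add: E_def R_def sumB)
  have RE: "R (E x) = x" for x
    by (simp add: R_def E_def vec_eq_iff inner_sum_left \<beta>i if_distrib cong: if_cong)
  have lin: "linear R" "linear E"
    by (auto simp: R_def E_def linear_iff inner_add_left vec_eq_iff scaleR_add_left sum.distrib scaleR_sum_right)
  have norm: "norm (R z) = norm z" for z
  proof -
    have "R z \<bullet> R z = (\<Sum>j\<in>UNIV. (z \<bullet> \<beta> j) * (z \<bullet> \<beta> j))"
      by (simp add: inner_vec_def R_def)
    also have "\<dots> = z \<bullet> z"
      using sum.reindex_bij_betw[OF \<beta>, of "\<lambda>b. (z \<bullet> b) * (z \<bullet> b)"] by (simp add: euclidean_inner[of z z])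
    finally show ?thesis by (simp add: norm_eq_sqrt_inner)
  qed
  have Em: "E \<in> borel_measurable borel"
    by (intro borel_measurable_continuous_onI linear_continuous_on linear_conv_bounded_linear[THEN iffD1] lin)
  have "lborel = distr lborel borel E"
  proof (rule lborel_eqI)
    fix l u :: "complex^'d" assume le: "\<And>b. b \<in> Basis \<Longrightarrow> l \<bullet> b \<le> u \<bullet> b"
    have pre: "E -` box l u = box (R l) (R u)"
    proof -
      have "E x \<in> box l u \<longleftrightarrow> x \<in> box (R l) (R u)" for x
      proof -
        have "E x \<bullet> \<beta> j = x $ j" for j using RE[of x] by (simp add: R_def vec_eq_iff)
        then have "(\<forall>b\<in>Basis. l \<bullet> b < E x \<bullet> b \<and> E x \<bullet> b < u \<bullet> b) \<longleftrightarrow>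
           (\<forall>j. l \<bullet> \<beta> j < x $ j \<and> x $ j < u \<bullet> \<beta> j)"
          using \<beta> unfolding bij_betw_def by (metis (no_types, lifting) imageE rangeI)
        moreover have "E x \<in> box l u \<longleftrightarrow> (\<forall>b\<in>Basis. l \<bullet> b < E x \<bullet> b \<and> E x \<bullet> b < u \<bullet> b)"
          by (rule mem_box)
        moreover have "x \<in> box (R l) (R u) \<longleftrightarrow> (\<forall>j. l \<bullet> \<beta> j < x $ j \<and> x $ j < u \<bullet> \<beta> j)"
          unfolding mem_box_cart by (simp add: R_def)
        ultimately show ?thesis by blast
      qed
      then show ?thesis by auto
    qed
    have "emeasure (distr lborel borel E) (box l u) = emeasure lborel (box (R l) (R u))"
      using Em by (subst emeasure_distr) (auto simp: pre)
    also have "\<dots> = (\<Prod>b\<in>Basis. (R u - R l) \<bullet> b)"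
      using le \<beta>B by (intro emeasure_lborel_box) (auto simp: Basis_vec_def inner_axis R_def)
    also have "(\<Prod>b\<in>Basis. (R u - R l) \<bullet> b) = (\<Prod>j\<in>UNIV. (u - l) \<bullet> \<beta> j)"
    proof -
      have "bij_betw (\<lambda>j. axis j 1 :: real^('d bit0)) UNIV Basis"
        by (auto simp: bij_betw_def inj_on_def Basis_vec_def axis_eq_axis)
      from prod.reindex_bij_betw[OF this, of "\<lambda>b. (R u - R l) \<bullet> b"]
      show ?thesis by (simp add: inner_axis R_def inner_diff_left)
    qed
    also have "\<dots> = (\<Prod>b\<in>Basis. (u - l) \<bullet> b)"
      by (rule prod.reindex_bij_betw[OF \<beta>])
    finally show "emeasure (distr lborel borel E) (box l u) = (\<Prod>b\<in>Basis. (u - l) \<bullet> b)" .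
  qed simp
  then show thesis using that lin ER RE norm by metis
qed

text \<open>The left-hand side is multiplicative in \<open>A\<close>, and a scalar matrix
  \<open>a\<close> is \<open>|a|\<close> times an orthogonal transformation.\<close>

lemma det_real_coordinates:
  fixes R :: "complex^'d \<Rightarrow> real^('d bit0)" and A :: "complex^'d^'d"
  assumes R: "linear R" "linear E" "\<And>z. E (R z) = z" "\<And>x. R (E x) = x" "\<And>z. norm (R z) = norm z"
    and A: "det A \<noteq> 0"
  shows "\<bar>det (matrix (\<lambda>x. R (A *v E x)))\<bar> = (cmod (det A))\<^sup>2"
proof (rule multiplicative_eq_norm_det_squared[where f = "\<lambda>A. \<bar>det (matrix (\<lambda>x. R (A *v E x)))\<bar>", OF _ _ _ A])
  have lin: "linear (\<lambda>x. R (A *v E x))" for A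
  proof -
    have "linear ((*v) A)"
      by (rule bounded_linear.linear[OF has_derivative_bounded_linear[OF has_derivative_linear_map]])
    from linear_compose[OF linear_compose[OF R(2) this] R(1)] show ?thesis by (simp add: o_def)
  qed
  fix A B :: "complex^'d^'d"
  have "matrix (\<lambda>x. R (A ** B *v E x)) = matrix (\<lambda>x. R (A *v E x)) ** matrix (\<lambda>x. R (B *v E x))"
    by (subst matrix_compose[OF lin lin, symmetric]) (simp add: o_def R matrix_vector_mul_assoc)
  then show "\<bar>det (matrix (\<lambda>x. R (A ** B *v E x)))\<bar>
      = \<bar>det (matrix (\<lambda>x. R (A *v E x)))\<bar> * \<bar>det (matrix (\<lambda>x. R (B *v E x)))\<bar>"
    by (simp add: det_mul abs_mult)
next
  have lin: "linear (\<lambda>x. R (c *s E x))" for c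
  proof -
    have "linear ((*s) c)" for c :: complex
      by (auto simp: linear_iff vec_eq_iff algebra_simps)
    from linear_compose[OF linear_compose[OF R(2) this] R(1)] show ?thesis by (simp add: o_def)
  qed
  have normE: "norm (E x) = norm x" for x using R by metis
  fix a :: complex assume a: "a \<noteq> 0"
  define u where "u = a / cmod a"
  have u: "cmod u = 1" using a by (simp add: u_def norm_divide)
  have "orthogonal_transformation (\<lambda>x. R (u *s E x))"
    by (simp add: orthogonal_transformation lin R norm_vector_scale u normE)
  then have 1: "\<bar>det (matrix (\<lambda>x. R (u *s E x)))\<bar> = 1" by simp
  have mv: "mat c *v (x :: complex^'d) = c *s x" for c x
    by (simp add: mat_def matrix_vector_mult_def vec_eq_iff if_distrib[of "\<lambda>c. c * _"] cong: if_cong)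
  have "R (mat a *v E x) = cmod a *\<^sub>R R (u *s E x)" for x
    using a by (simp add: mv linear_scale[OF R(1), symmetric] scaleR_eq_vector_scale u_def)
  then have "matrix (\<lambda>x. R (mat a *v E x)) = (\<chi> i. cmod a *s (matrix (\<lambda>x. R (u *s E x)) $ i))"
    by (simp add: matrix_def vec_eq_iff)
  then have "det (matrix (\<lambda>x. R (mat a *v E x))) = cmod a ^ CARD('d bit0) * det (matrix (\<lambda>x. R (u *s E x)))"
    using det_rows_mul[of "\<lambda>_. cmod a" "\<lambda>i. matrix (\<lambda>x. R (u *s E x)) $ i"] by simp
  then show "\<bar>det (matrix (\<lambda>x. R (mat a *v E x)))\<bar> = cmod a ^ (2 * CARD('d))"
    by (simp add: abs_mult 1)
qed simp

text \<open>The real change of variables formula carried over to \<open>complex^'d\<close>; the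
  real Jacobian is the squared modulus of the complex one.\<close>

theorem emeasure_image_holomorphic:
  fixes g :: "complex^'d \<Rightarrow> complex^'d"
  assumes T: "T \<in> sets borel" and gT: "g ` T \<in> sets borel" "bounded (g ` T)"
    and der: "\<And>z. z \<in> T \<Longrightarrow> (g has_derivative (*v) (A z)) (at z)"
    and det: "\<And>z. z \<in> T \<Longrightarrow> det (A z) \<noteq> 0"
    and inj: "inj_on g T"
    and meas: "(\<lambda>z. indicator T z * (cmod (det (A z)))\<^sup>2) \<in> borel_measurable borel"
  shows "emeasure lborel (g ` T) = (\<integral>\<^sup>+z. ennreal (indicator T z * (cmod (det (A z)))\<^sup>2) \<partial>lborel)"
proof -
  obtain R :: "complex^'d \<Rightarrow> real^('d bit0)" and E where R: "linear R" "linear E"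
    "\<And>z. E (R z) = z" "\<And>x. R (E x) = x" "\<And>z. norm (R z) = norm z"
    and dist: "distr lborel borel E = lborel"
    using real_coordinates by metis
  have bl: "bounded_linear R" "bounded_linear E"
    using R linear_conv_bounded_linear by blast+
  have Em: "E \<in> borel_measurable borel"
    by (intro borel_measurable_continuous_onI linear_continuous_on bl)
  have img: "R ` B = E -` B" for B using R by (metis (no_types) equalityI image_subset_iff image_vimage_subset subsetI vimage_eq rev_image_eqI)
  have emR: "emeasure lborel (R ` B) = emeasure lborel B" if "B \<in> sets borel" for B
  proof -
    have "emeasure lborel B = emeasure (distr lborel borel E) B" by (simp add: dist)
    also have "\<dots> = emeasure lborel (E -` B)" using Em that by (subst emeasure_distr) auto
    finally show ?thesis by (simp add: img)
  qed
  have sR: "R ` B \<in> sets borel" if "B \<in> sets borel" for B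
    using measurable_sets[OF Em that] by (simp add: img)
  let ?f = "\<lambda>x. R (g (E x))" and ?f' = "\<lambda>x v. R (A (E x) *v E v)"
  have fim: "?f ` (R ` T) = R ` (g ` T)" by (simp add: image_image R)
  have lm: "R ` (g ` T) \<in> lmeasurable"
  proof (rule bounded_set_imp_lmeasurable)
    show "bounded (R ` g ` T)" using gT(2) bounded_linear_image bl(1) by blast
    show "R ` g ` T \<in> sets lebesgue" using sR[OF gT(1)] by simp
  qed
  have "((\<lambda>x. \<bar>det (matrix (?f' x))\<bar>) has_integral measure lebesgue (R ` g ` T)) (R ` T)"
  proof (rule iffD1[OF has_measure_differentiable_image])
    show "R ` T \<in> sets lebesgue" using sR[OF T] by simp
    show "inj_on ?f (R ` T)" using inj R by (auto simp: inj_on_def) metis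
    show "?f ` (R ` T) \<in> lmeasurable \<and> measure lebesgue (?f ` (R ` T)) = measure lebesgue (R ` g ` T)"
      using lm by (simp add: fim)
    fix x assume "x \<in> R ` T"
    then have x: "E x \<in> T" using R by auto
    have dE: "(E has_derivative E) (at x)" and dR: "(R has_derivative R) (at (g (E x)))"
      using bl by (auto intro: bounded_linear_imp_has_derivative)
    from has_derivative_compose[OF has_derivative_compose[OF dE der[OF x]] dR]
    show "(?f has_derivative ?f' x) (at x within R ` T)" by (rule has_derivative_at_withinI)
  qed
  from nn_integral_has_integral_lebesgue[OF _ this]
  have "ennreal (measure lebesgue (R ` g ` T))
      = (\<integral>\<^sup>+x. ennreal (indicator (R ` T) x * \<bar>det (matrix (?f' x))\<bar>) \<partial>lborel)"
    by simp
  also have "\<dots> = (\<integral>\<^sup>+x. ennreal (indicator T (E x) * (cmod (det (A (E x))))\<^sup>2) \<partial>lborel)"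
    by (intro nn_integral_cong) (auto simp: indicator_def img det_real_coordinates[OF R det])
  also have "\<dots> = (\<integral>\<^sup>+z. ennreal (indicator T z * (cmod (det (A z)))\<^sup>2) \<partial>distr lborel borel E)"
    using Em meas by (subst nn_integral_distr) auto
  finally show ?thesis
    using emR[OF gT(1)] emeasure_eq_measure2[OF lm] sR[OF gT(1)] by (simp add: dist)
qed

theorem distr_lborel_unimodular:
  fixes A :: "complex^'d^'d"
  assumes A: "cmod (det A) = 1"
  shows "distr lborel borel ((*v) A) = lborel"
proof (rule lborel_eqI[symmetric])
  fix l u :: "complex^'d" assume le: "\<And>b. b \<in> Basis \<Longrightarrow> l \<bullet> b \<le> u \<bullet> b"
  obtain B where B: "A ** B = mat 1" "B ** A = mat 1"
    using A invertible_det_nz[of A] unfolding invertible_def by fastforce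
  have detB: "cmod (det B) = 1"
    using A B(1) by (metis det_I det_mul mult.left_neutral norm_mult norm_one)
  have AB: "A *v (B *v x) = x" "B *v (A *v x) = x" for x
    by (simp_all add: matrix_vector_mul_assoc B)
  have bl: "bounded_linear ((*v) C)" for C :: "complex^'d^'d"
    using has_derivative_linear_map has_derivative_bounded_linear by blast
  have Am: "(*v) A \<in> borel_measurable borel"
    by (intro borel_measurable_continuous_onI linear_continuous_on bl)
  have pre: "(*v) A -` S = (*v) B ` S" for S
    using AB by (metis (no_types, lifting) equalityI image_subset_iff subsetI vimageE vimageI rev_image_eqI)
  have "emeasure (distr lborel borel ((*v) A)) (box l u) = emeasure lborel ((*v) B ` box l u)"
    using Am by (subst emeasure_distr) (auto simp: pre)
  also have "\<dots> = (\<integral>\<^sup>+z. ennreal (indicator (box l u) z * (cmod (det B))\<^sup>2) \<partial>lborel)"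
  proof (rule emeasure_image_holomorphic)
    show "(*v) B ` box l u \<in> sets borel"
      using measurable_sets[OF Am, of "box l u"] by (simp add: pre)
    show "bounded ((*v) B ` box l u)" using bounded_linear_image[OF bounded_box bl] .
    show "inj_on ((*v) B) (box l u)" using AB by (metis inj_onI)
  qed (use detB in \<open>auto intro: has_derivative_linear_map\<close>)
  also have "\<dots> = emeasure lborel (box l u)"
    by (simp add: detB ennreal_indicator)
  also have "\<dots> = (\<Prod>b\<in>Basis. (u - l) \<bullet> b)"
    using le by (intro emeasure_lborel_box) auto
  finally show "emeasure (distr lborel borel ((*v) A)) (box l u) = (\<Prod>b\<in>Basis. (u - l) \<bullet> b)" .
qed simp

section \<open>Hilbert spaces of holomorphic functions and their kernels\<close>

lemma nn_integral_rotate_about: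
  fixes F :: "complex^'d \<Rightarrow> ennreal"
  assumes F: "F \<in> borel_measurable borel" and c: "cmod c = 1"
  shows "(\<integral>\<^sup>+v. F (z + c *s v) \<partial>lborel) = (\<integral>\<^sup>+v. F v \<partial>lborel)"
proof -
  have mv: "mat c *v v = c *s v" for v :: "complex^'d"
    by (simp add: mat_def matrix_vector_mult_def vec_eq_iff if_distrib[of "\<lambda>c. c * _"] cong: if_cong)
  have "det (mat c :: complex^'d^'d) = c ^ CARD('d)"
    by (subst det_diagonal) (simp_all add: mat_def)
  then have rot: "distr lborel borel ((*v) (mat c :: complex^'d^'d)) = lborel"
    by (intro distr_lborel_unimodular) (simp add: norm_power c)
  have m1: "(*v) (mat c :: complex^'d^'d) \<in> borel_measurable borel"
    by (intro borel_measurable_continuous_onI linear_continuous_on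
        has_derivative_bounded_linear[OF has_derivative_linear_map])
  have m2: "(+) z \<in> borel_measurable borel" by measurable
  have "(\<integral>\<^sup>+v. F v \<partial>lborel) = (\<integral>\<^sup>+v. F v \<partial>distr lborel borel ((+) z))"
    by (simp only: lborel_distr_plus)
  also have "\<dots> = (\<integral>\<^sup>+v. F (z + v) \<partial>lborel)"
    using m2 F by (subst nn_integral_distr) auto
  also have "\<dots> = (\<integral>\<^sup>+v. F (z + v) \<partial>distr lborel borel ((*v) (mat c :: complex^'d^'d)))"
    by (simp only: rot)
  also have "\<dots> = (\<integral>\<^sup>+v. F (z + c *s v) \<partial>lborel)"
  proof -
    have "(\<lambda>v. F (z + v)) \<in> borel_measurable borel" using F m2 by measurable
    then show ?thesis using m1 by (subst nn_integral_distr) (auto simp: mv)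
  qed
  finally show ?thesis ..
qed

text \<open>Cauchy's formula is applied to the square of \<open>f\<close>, and the modulus is then
  taken under the integral sign.\<close>

lemma norm_square_le_circle_mean:
  assumes holo: "f holomorphic_on ball 0 R" and R: "R > 1"
  shows "ennreal ((cmod (f 0))\<^sup>2)
    \<le> (\<integral>\<^sup>+x. ennreal (indicator {0..1} x * (cmod (f (exp (2 * of_real pi * \<i> * of_real x))))\<^sup>2) \<partial>lborel)"
proof -
  let ?e = "\<lambda>x :: real. exp (2 * of_real pi * \<i> * of_real x)"
  have e: "cmod (?e x) = 1" for x by (simp add: norm_exp_eq_Re)
  have cf: "continuous_on (cball 0 1) f"
  proof (rule continuous_on_subset[OF holomorphic_on_imp_continuous_on[OF holo]])
    show "cball 0 1 \<subseteq> ball 0 R" using R by auto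
  qed
  have "((\<lambda>u. (f u)\<^sup>2 / (u - 0)) has_contour_integral (2 * of_real pi * \<i> * (f 0)\<^sup>2)) (circlepath 0 1)"
  proof (rule Cauchy_integral_circlepath)
    show "continuous_on (cball 0 1) (\<lambda>u. (f u)\<^sup>2)" using cf by (intro continuous_intros)
    show "(\<lambda>u. (f u)\<^sup>2) holomorphic_on ball 0 1"
    proof (rule holomorphic_on_power, rule holomorphic_on_subset[OF holo])
      show "ball 0 1 \<subseteq> ball 0 R" using R by auto
    qed
  qed simp
  then have "((\<lambda>x. 2 * of_real pi * \<i> * (f (?e x))\<^sup>2) has_integral 2 * of_real pi * \<i> * (f 0)\<^sup>2) {0..1}"
    unfolding has_contour_integral_def
  proof (rule has_integral_eq[rotated])
    fix x :: real assume "x \<in> {0..1}"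
    then have vd: "vector_derivative (circlepath 0 1) (at x within {0..1}) = 2 * of_real pi * \<i> * ?e x"
      using vector_derivative_circlepath01[of x 0 1] by (simp only: atLeastAtMost_iff mult_1_right of_real_1 of_real_mult of_real_numeral)
    have c: "circlepath 0 1 x = ?e x" by (simp add: circlepath)
    show "(f (circlepath 0 1 x))\<^sup>2 / (circlepath 0 1 x - 0) * vector_derivative (circlepath 0 1) (at x within {0..1})
       = 2 * of_real pi * \<i> * (f (?e x))\<^sup>2"
      unfolding vd c by simp
  qed
  from has_integral_mult_right[OF this, of "1 / (2 * of_real pi * \<i>)"]
  have sq: "((\<lambda>x. (f (?e x))\<^sup>2) has_integral (f 0)\<^sup>2) {0..1}" by simp
  have ce: "continuous_on {0..1} (\<lambda>x. (cmod (f (?e x)))\<^sup>2)"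
    by (intro continuous_intros continuous_on_compose2[OF cf]) (auto simp: e)
  then have int: "(\<lambda>x. (cmod (f (?e x)))\<^sup>2) integrable_on {0..1}"
    using integrable_continuous_interval by blast
  have "cmod ((f 0)\<^sup>2) \<le> integral {0..1} (\<lambda>x. (cmod (f (?e x)))\<^sup>2)"
    using integral_norm_bound_integral[OF has_integral_integrable[OF sq] int] integral_unique[OF sq]
    by (simp add: norm_power)
  moreover have "(\<integral>\<^sup>+x. ennreal (indicator {0..1} x * (cmod (f (?e x)))\<^sup>2) \<partial>lborel)
      = ennreal (integral {0..1} (\<lambda>x. (cmod (f (?e x)))\<^sup>2))"
    using nn_integral_has_integral_lebesgue[OF _ integrable_integral[OF int]] by simp
  ultimately show ?thesis by (simp add: norm_power ennreal_leI)
qed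

text \<open>The rotations \<open>v \<mapsto> exp(2 pi i x) v\<close> about \<open>z\<close>
  preserve Lebesgue measure, so the integral over the ball does not change when it is averaged over
  \<open>x\<close>. By Fubini, the averaged integrand at \<open>v\<close> is the mean of
  \<open>|f|\<^sup>2\<close> over a circle about \<open>z\<close> in the complex line through
  \<open>z\<close> in direction \<open>v\<close>.\<close>

theorem norm_square_le_ball_mean:
  fixes f :: "complex^'d \<Rightarrow> complex"
  assumes f: "holomorphic_several f (ball z r)" and r: "r > 0"
  shows "ennreal ((cmod (f z))\<^sup>2) * emeasure lborel (ball z r)
    \<le> (\<integral>\<^sup>+w. ennreal ((cmod (f w))\<^sup>2) * indicator (ball z r) w \<partial>lborel)"
proof -
  let ?e = "\<lambda>x :: real. exp (2 * of_real pi * \<i> * of_real x)"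
  have e: "cmod (?e x) = 1" for x by (simp add: norm_exp_eq_Re)
  define F where "F w = ennreal (indicator (ball z r) w * (cmod (f w))\<^sup>2)" for w
  have "(\<lambda>w. indicator (ball z r) w *\<^sub>R (cmod (f w))\<^sup>2) \<in> borel_measurable borel"
    by (intro borel_measurable_continuous_on_indicator continuous_intros
        holomorphic_several_imp_continuous_on f) simp
  then have F: "F \<in> borel_measurable borel" unfolding F_def by simp
  have pt: "ennreal ((cmod (f z))\<^sup>2) * indicator (ball 0 r) v
     \<le> (\<integral>\<^sup>+x. indicator {0..1} x * F (z + ?e x *s v) \<partial>lborel)" for v
  proof (cases "v \<in> ball 0 r")
    case True
    define R where "R = (if v = 0 then 2 else r / norm v)"
    have R: "R > 1" using True by (simp add: R_def)
    have sub: "z + t *s v \<in> ball z r" if "t \<in> ball 0 R" for t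
      using that True by (cases "v = 0") (auto simp: R_def dist_norm norm_vector_scale field_simps)
    have "(\<lambda>t. f (z + t *s v)) holomorphic_on ball 0 R"
      by (rule holomorphic_on_line[OF f]) (use sub in blast)
    from norm_square_le_circle_mean[OF this R]
    have "ennreal ((cmod (f z))\<^sup>2)
       \<le> (\<integral>\<^sup>+x. ennreal (indicator {0..1} x * (cmod (f (z + ?e x *s v)))\<^sup>2) \<partial>lborel)" by simp
    also have "\<dots> = (\<integral>\<^sup>+x. indicator {0..1} x * F (z + ?e x *s v) \<partial>lborel)"
      using sub R by (intro nn_integral_cong) (auto simp: F_def indicator_def e)
    finally show ?thesis using True by simp
  qed simp
  have cont: "continuous_on UNIV (\<lambda>p. z + ?e (fst p) *s snd p)"
    unfolding vector_scalar_mult_def by (intro continuous_intros)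
  have "ennreal ((cmod (f z))\<^sup>2) * emeasure lborel (ball z r)
      = ennreal ((cmod (f z))\<^sup>2) * emeasure lborel (ball (0 :: complex^'d) r)"
    using r by (simp add: emeasure_ball)
  also have "\<dots> = (\<integral>\<^sup>+v. ennreal ((cmod (f z))\<^sup>2) * indicator (ball (0 :: complex^'d) r) v \<partial>lborel)"
    by (subst nn_integral_cmult_indicator) auto
  also have "\<dots> \<le> (\<integral>\<^sup>+v. (\<integral>\<^sup>+x. indicator {0..1} x * F (z + ?e x *s v) \<partial>lborel) \<partial>lborel)"
    by (intro nn_integral_mono pt)
  also have "\<dots> = (\<integral>\<^sup>+x. (\<integral>\<^sup>+v. indicator {0..1} x * F (z + ?e x *s v) \<partial>lborel) \<partial>lborel)"
  proof (rule lborel_pair.Fubini')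
    have "(\<lambda>p. indicator {0..1} (fst p) * F (z + ?e (fst p) *s snd p)) \<in> borel_measurable (borel \<Otimes>\<^sub>M borel)"
      using borel_measurable_continuous_onI[OF cont] F unfolding borel_prod[symmetric] by measurable
    then show "(\<lambda>(x, v). indicator {0..1} x * F (z + ?e x *s v)) \<in> borel_measurable (lborel \<Otimes>\<^sub>M lborel)"
      by (simp add: case_prod_beta' cong: measurable_cong_sets sets_pair_measure_cong)
  qed
  also have "\<dots> = (\<integral>\<^sup>+x. indicator {0..1} (x :: real) * (\<integral>\<^sup>+v. F v \<partial>lborel) \<partial>lborel)"
  proof (rule nn_integral_cong)
    fix x :: real
    show "(\<integral>\<^sup>+v. indicator {0..1} x * F (z + ?e x *s v) \<partial>lborel) = indicator {0..1} x * (\<integral>\<^sup>+v. F v \<partial>lborel)"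
      using nn_integral_rotate_about[OF F e] by (cases "x \<in> {0..1}") auto
  qed
  also have "\<dots> = (\<integral>\<^sup>+v. F v \<partial>lborel)"
    by (simp add: nn_integral_multc)
  also have "\<dots> = (\<integral>\<^sup>+w. ennreal ((cmod (f w))\<^sup>2) * indicator (ball z r) w \<partial>lborel)"
    by (intro nn_integral_cong) (auto simp: F_def indicator_def)
  finally show ?thesis .
qed

lemma extended_holomorphic_borel:
  fixes f :: "complex^'d \<Rightarrow> complex"
  assumes "open D" "holomorphic_several f D" "\<And>z. z \<notin> D \<Longrightarrow> f z = 0"
  shows "f \<in> borel_measurable borel"
proof -
  have "(\<lambda>z. indicator D z *\<^sub>R f z) \<in> borel_measurable borel"
    using assms by (intro borel_measurable_continuous_on_indicator)
       (auto simp: holomorphic_several_imp_continuous_on)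
  moreover have "(\<lambda>z. indicator D z *\<^sub>R f z) = f"
    using assms(3) by (auto simp: indicator_def fun_eq_iff)
  ultimately show ?thesis by simp
qed

text \<open>As members vanish off \<open>D\<close>, functions that agree on \<open>D\<close> are
  equal.\<close>

definition L2_holo :: "(complex^'d) measure \<Rightarrow> (complex^'d) set \<Rightarrow> (complex^'d \<Rightarrow> complex) set" where
  "L2_holo M D = {f. (\<forall>z. z \<notin> D \<longrightarrow> f z = 0) \<and> holomorphic_several f D
     \<and> integrable M (\<lambda>z. (cmod (f z))\<^sup>2)}"

definition L2_ip :: "(complex^'d) measure \<Rightarrow> (complex^'d \<Rightarrow> complex) \<Rightarrow> (complex^'d \<Rightarrow> complex) \<Rightarrow> complex" where
  "L2_ip M f g = (LINT z|M. f z * cnj (g z))"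

text \<open>Locally the measure dominates a positive multiple of Lebesgue measure. A lower bound
  is what an estimate of point values by norms needs; densities that are unbounded near a
  hypersurface are to be included, so no upper bound is imposed.\<close>

locale bergman_measure =
  fixes M :: "(complex^'d) measure" and D :: "(complex^'d) set"
  assumes open_D: "open D" and sets_M: "sets M = sets borel"
    and lower: "\<And>z. z \<in> D \<Longrightarrow> \<exists>r>0. \<exists>\<delta>>0. ball z r \<subseteq> D \<and>
      (\<forall>g\<in>borel_measurable borel. ennreal \<delta> * (\<integral>\<^sup>+w. g w * indicator (ball z r) w \<partial>lborel) \<le> (\<integral>\<^sup>+w. g w \<partial>M))"
begin

abbreviation "H \<equiv> L2_holo M D"
abbreviation "inp \<equiv> L2_ip M"
abbreviation "N f \<equiv> LINT z|M. (cmod (f z))\<^sup>2"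

lemma measurable_M [simp]: "borel_measurable M = borel_measurable borel"
  by (rule measurable_cong_sets) (simp_all add: sets_M)

lemma H_measurable: "f \<in> H \<Longrightarrow> f \<in> borel_measurable borel"
  using extended_holomorphic_borel[OF open_D] by (auto simp: L2_holo_def)

lemma integrable_H: "f \<in> H \<Longrightarrow> integrable M (\<lambda>z. (cmod (f z))\<^sup>2)"
  by (simp add: L2_holo_def)

lemma integrable_inp:
  assumes "f \<in> H" "g \<in> H"
  shows "integrable M (\<lambda>z. f z * cnj (g z))"
proof (rule Bochner_Integration.integrable_bound)
  show "integrable M (\<lambda>z. (cmod (f z))\<^sup>2 + (cmod (g z))\<^sup>2)"
    using assms by (intro Bochner_Integration.integrable_add integrable_H)
  show "(\<lambda>z. f z * cnj (g z)) \<in> borel_measurable M"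
  proof -
    have [measurable]: "cnj \<in> borel_measurable borel"
      by (intro borel_measurable_continuous_onI continuous_intros)
    have [measurable]: "f \<in> borel_measurable borel" "g \<in> borel_measurable borel"
      using assms by (auto intro: H_measurable)
    have "(\<lambda>z. f z * cnj (g z)) \<in> borel_measurable borel" by measurable
    then show ?thesis by simp
  qed
  have "cmod (f z) * cmod (g z) \<le> (cmod (f z))\<^sup>2 + (cmod (g z))\<^sup>2" for z
    using sum_squares_bound[of "cmod (f z)" "cmod (g z)"]
      mult_nonneg_nonneg[OF norm_ge_zero[of "f z"] norm_ge_zero[of "g z"]] by linarith
  then show "AE z in M. norm (f z * cnj (g z)) \<le> norm ((cmod (f z))\<^sup>2 + (cmod (g z))\<^sup>2)"
    by (simp add: norm_mult)
qed

lemma H_zero: "(\<lambda>z. 0) \<in> H"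
  by (simp add: L2_holo_def holomorphic_several_const)

lemma H_scale: "f \<in> H \<Longrightarrow> (\<lambda>z. c * f z) \<in> H"
  by (auto simp: L2_holo_def norm_mult power_mult_distrib intro: holomorphic_several_mult holomorphic_several_const)

lemma H_add:
  assumes f: "f \<in> H" and g: "g \<in> H"
  shows "(\<lambda>z. f z + g z) \<in> H"
proof -
  have "integrable M (\<lambda>z. (cmod (f z + g z))\<^sup>2)"
  proof (rule Bochner_Integration.integrable_bound)
    show "integrable M (\<lambda>z. 2 * (cmod (f z))\<^sup>2 + 2 * (cmod (g z))\<^sup>2)"
      using assms by (intro Bochner_Integration.integrable_add Bochner_Integration.integrable_mult_right integrable_H)
    show "(\<lambda>z. (cmod (f z + g z))\<^sup>2) \<in> borel_measurable M"
      using assms[THEN H_measurable] by simp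
    have "(cmod (f z + g z))\<^sup>2 \<le> 2 * (cmod (f z))\<^sup>2 + 2 * (cmod (g z))\<^sup>2" for z
    proof -
      have "(cmod (f z + g z))\<^sup>2 \<le> (cmod (f z) + cmod (g z))\<^sup>2"
        by (intro power_mono norm_triangle_ineq norm_ge_zero)
      also have "\<dots> \<le> 2 * (cmod (f z))\<^sup>2 + 2 * (cmod (g z))\<^sup>2"
        using sum_squares_bound[of "cmod (f z)" "cmod (g z)"] by (simp add: power2_sum)
      finally show ?thesis .
    qed
    then show "AE z in M. norm ((cmod (f z + g z))\<^sup>2) \<le> norm (2 * (cmod (f z))\<^sup>2 + 2 * (cmod (g z))\<^sup>2)"
      by simp
  qed
  then show ?thesis
    using assms by (auto simp: L2_holo_def intro: holomorphic_several_add)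
qed

lemma H_diff: "f \<in> H \<Longrightarrow> g \<in> H \<Longrightarrow> (\<lambda>z. f z - g z) \<in> H"
  using H_add[OF _ H_scale[of g "-1"]] by simp

lemma H_sum: "(\<And>i. i \<in> I \<Longrightarrow> f i \<in> H) \<Longrightarrow> (\<lambda>z. \<Sum>i\<in>I. f i z) \<in> H"
  by (induction I rule: infinite_finite_induct) (auto intro: H_zero H_add)

lemma inp_add_left: "f \<in> H \<Longrightarrow> g \<in> H \<Longrightarrow> h \<in> H \<Longrightarrow> inp (\<lambda>z. f z + g z) h = inp f h + inp g h"
  unfolding L2_ip_def by (simp add: distrib_right integrable_inp)

lemma inp_scale_left: "inp (\<lambda>z. c * f z) h = c * inp f h"
  unfolding L2_ip_def by (simp add: mult.assoc)

lemma inp_commute: "inp g f = cnj (inp f g)"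
  unfolding L2_ip_def by (subst Bochner_Integration.integral_cnj[symmetric]) (simp add: mult.commute)

lemma inp_scale_right: "inp h (\<lambda>z. c * f z) = cnj c * inp h f"
  by (subst (1 2) inp_commute) (simp add: inp_scale_left)

lemma inp_add_right: "f \<in> H \<Longrightarrow> g \<in> H \<Longrightarrow> h \<in> H \<Longrightarrow> inp h (\<lambda>z. f z + g z) = inp h f + inp h g"
  by (subst (1 2 3) inp_commute) (simp add: inp_add_left)

lemma inp_zero: "inp (\<lambda>z. 0) h = 0" "inp h (\<lambda>z. 0) = 0"
  by (simp_all add: L2_ip_def)

lemma inp_sum_left:
  "finite I \<Longrightarrow> (\<And>i. i \<in> I \<Longrightarrow> f i \<in> H) \<Longrightarrow> h \<in> H \<Longrightarrow> inp (\<lambda>z. \<Sum>i\<in>I. f i z) h = (\<Sum>i\<in>I. inp (f i) h)"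
  by (induction I rule: finite_induct) (simp_all add: inp_zero inp_add_left H_sum)

lemma inp_sum_right:
  "finite I \<Longrightarrow> (\<And>i. i \<in> I \<Longrightarrow> f i \<in> H) \<Longrightarrow> h \<in> H \<Longrightarrow> inp h (\<lambda>z. \<Sum>i\<in>I. f i z) = (\<Sum>i\<in>I. inp h (f i))"
  by (induction I rule: finite_induct) (simp_all add: inp_zero inp_add_right H_sum)

lemma inp_self: "inp f f = of_real (N f)"
proof -
  have "(\<lambda>z. f z * cnj (f z)) = (\<lambda>z. of_real ((cmod (f z))\<^sup>2))"
    by (simp only: complex_norm_square)
  then show ?thesis by (simp only: L2_ip_def integral_complex_of_real)
qed

lemma N_add:
  assumes "f \<in> H" "g \<in> H"
  shows "N (\<lambda>z. f z + c * g z) = N f + 2 * Re (cnj c * inp f g) + (cmod c)\<^sup>2 * N g"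
proof -
  have cg: "(\<lambda>z. c * g z) \<in> H" using assms H_scale by blast
  have fg: "(\<lambda>z. f z + c * g z) \<in> H" using assms cg H_add by blast
  have "complex_of_real (N (\<lambda>z. f z + c * g z)) = inp f f + cnj c * inp f g + (c * inp g f + c * cnj c * inp g g)"
    using assms cg fg by (simp add: inp_self[symmetric] inp_add_left inp_add_right inp_scale_left inp_scale_right distrib_left)
  also have "\<dots> = of_real (N f) + (cnj c * inp f g + cnj (cnj c * inp f g)) + of_real ((cmod c)\<^sup>2 * N g)"
    by (simp add: inp_self inp_commute[of g f] complex_norm_square[symmetric])
  also have "\<dots> = of_real (N f + 2 * Re (cnj c * inp f g) + (cmod c)\<^sup>2 * N g)"
    by (simp only: complex_add_cnj of_real_add)
  finally show ?thesis by (simp only: of_real_eq_iff)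
qed

lemma local_bound:
  assumes "z0 \<in> D"
  shows "\<exists>r>0. \<exists>C>0. ball z0 r \<subseteq> D \<and> (\<forall>f\<in>H. \<forall>z\<in>ball z0 r. (cmod (f z))\<^sup>2 \<le> C * N f)"
proof -
  obtain r \<delta> where r: "r > 0" "\<delta> > 0" "ball z0 r \<subseteq> D" and
    low: "\<And>g. g \<in> borel_measurable borel \<Longrightarrow>
       ennreal \<delta> * (\<integral>\<^sup>+w. g w * indicator (ball z0 r) w \<partial>lborel) \<le> (\<integral>\<^sup>+w. g w \<partial>M)"
    using lower[OF assms] by blast
  \<comment> \<open>Balls of radius \<open>r/2\<close> about the points of \<open>ball z0
    (r/2)\<close> stay inside \<open>ball z0 r\<close> and all have volume \<open>V\<close>, so that
    one constant serves the whole neighbourhood.\<close>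
  define V where "V = measure lborel (ball (0 :: complex^'d) (r/2))"
  have V: "V > 0" using r(1) by (simp add: V_def content_ball_pos)
  have "(cmod (f z))\<^sup>2 \<le> 1 / (\<delta> * V) * N f" if f: "f \<in> H" and z: "z \<in> ball z0 (r/2)" for f z
  proof -
    have sub: "ball z (r/2) \<subseteq> ball z0 r"
    proof
      fix w assume "w \<in> ball z (r/2)"
      then show "w \<in> ball z0 r" using z dist_triangle[of z0 w z] by simp
    qed
    have fm: "f \<in> borel_measurable borel" using f by (rule H_measurable)
    have hs: "holomorphic_several f (ball z (r/2))"
      using f sub r(3) by (auto simp: L2_holo_def intro: holomorphic_several_subset)
    have vz: "emeasure lborel (ball z (r/2)) = ennreal V"
      using r(1) by (simp add: V_def emeasure_ball content_ball)
    have "ennreal ((cmod (f z))\<^sup>2 * V * \<delta>) = ennreal \<delta> * (ennreal ((cmod (f z))\<^sup>2) * emeasure lborel (ball z (r/2)))"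
      using V r(2) by (simp add: vz ennreal_mult' mult_ac)
    also have "\<dots> \<le> ennreal \<delta> * (\<integral>\<^sup>+w. ennreal ((cmod (f w))\<^sup>2) * indicator (ball z (r/2)) w \<partial>lborel)"
      using r(1) by (intro mult_left_mono norm_square_le_ball_mean hs) auto
    also have "\<dots> \<le> ennreal \<delta> * (\<integral>\<^sup>+w. ennreal ((cmod (f w))\<^sup>2) * indicator (ball z0 r) w \<partial>lborel)"
      using sub by (intro mult_left_mono nn_integral_mono) (auto simp: indicator_def)
    also have "\<dots> \<le> (\<integral>\<^sup>+w. ennreal ((cmod (f w))\<^sup>2) \<partial>M)"
      by (rule low) (use fm in simp)
    also have "\<dots> = ennreal (N f)"
      by (rule nn_integral_eq_integral[OF integrable_H[OF f]]) simp
    finally have "(cmod (f z))\<^sup>2 * V * \<delta> \<le> N f" by (simp add: ennreal_le_iff)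
    then show ?thesis using V r(2) by (simp add: field_simps)
  qed
  moreover have "1 / (\<delta> * V) > 0" using V r by simp
  moreover have "ball z0 (r/2) \<subseteq> D" using r subset_ball[of "r/2" r z0] by auto
  ultimately show ?thesis using r(1) by (intro exI[of _ "r/2"] conjI exI[of _ "1 / (\<delta> * V)"]) auto
qed

lemma N_eq_0: 
  assumes "f \<in> H" "N f = 0"
  shows "f = (\<lambda>z. 0)"
proof
  fix z show "f z = 0"
  proof (cases "z \<in> D")
    case True
    then obtain r C where "r > 0" "\<forall>f\<in>H. \<forall>z\<in>ball z r. (cmod (f z))\<^sup>2 \<le> C * N f"
      using local_bound[OF True] by blast
    then have "(cmod (f z))\<^sup>2 \<le> C * N f" using assms(1) centre_in_ball by blast
    then show ?thesis by (simp add: assms(2))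
  qed (use assms in \<open>simp add: L2_holo_def\<close>)
qed

text \<open>If not all members vanish at \<open>w\<close>, the kernel is a multiple of the
  function \<open>g\<close> of least norm among those with value 1 at \<open>w\<close>. A minimizing
  sequence is Cauchy by the parallelogram identity, and locally uniformly Cauchy by
  \<open>local_bound\<close>, so it has a holomorphic limit \<open>g\<close>; Fatou's lemma shows
  that \<open>g\<close> attains the minimum. Being minimal, \<open>g\<close> is orthogonal to every
  member that vanishes at \<open>w\<close>, in particular to \<open>h - h w * g\<close> for every
  \<open>h\<close>.\<close>

theorem kernel_exists:
  assumes w: "w \<in> D"
  shows "\<exists>k\<in>H. \<forall>f\<in>H. f w = inp f k"
proof (cases "\<forall>f\<in>H. f w = 0")
  case True
  then show ?thesis using H_zero inp_zero by metis
next
  case False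
  define S where "S = {f\<in>H. f w = 1}"
  obtain f0 where f0: "f0 \<in> H" "f0 w \<noteq> 0" using False by blast
  have "(\<lambda>z. (1 / f0 w) * f0 z) \<in> S" using f0 H_scale[OF f0(1), of "1 / f0 w"] by (simp add: S_def)
  then have S_ne: "S \<noteq> {}" by blast
  define d where "d = Inf (N ` S)"
  have bdd: "bdd_below (N ` S)" by (rule bdd_belowI2[of _ 0]) simp
  have d_le: "d \<le> N f" if "f \<in> S" for f
    using that bdd by (simp add: d_def cInf_lower)
  have "\<exists>f\<in>S. N f < d + 1 / real (Suc n)" for n
  proof -
    have "d < d + 1 / real (Suc n)" by simp
    then show ?thesis using S_ne bdd unfolding d_def by (subst (asm) cInf_less_iff) auto
  qed
  then obtain f where f: "\<And>n. f n \<in> S" "\<And>n. N (f n) < d + 1 / real (Suc n)" by metis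
  have fH: "f n \<in> H" "f n w = 1" for n using f(1) by (auto simp: S_def)
  have cauchy: "N (\<lambda>z. f n z - f m z) \<le> 2 / real (Suc n) + 2 / real (Suc m)" for n m
  proof -
    have "(\<lambda>z. (1/2) * (f n z + f m z)) \<in> S"
      using fH(2) H_scale[OF H_add[OF fH(1)[of n] fH(1)[of m]], of "1/2"] by (simp add: S_def)
    then have "d \<le> N (\<lambda>z. (1/2) * (f n z + f m z))" by (rule d_le)
    also have "\<dots> = (1/4) * N (\<lambda>z. f n z + 1 * f m z)"
      by (simp add: norm_mult power_mult_distrib power2_eq_square)
    finally have "4 * d \<le> N (f n) + 2 * Re (inp (f n) (f m)) + N (f m)"
      using N_add[OF fH(1) fH(1), of n 1 m] by simp
    moreover have "N (\<lambda>z. f n z + (-1) * f m z) = N (f n) - 2 * Re (inp (f n) (f m)) + N (f m)"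
      by (subst N_add[OF fH(1) fH(1)]) simp
    moreover have "N (f n) < d + 1 / real (Suc n)" "N (f m) < d + 1 / real (Suc m)" using f(2) by blast+
    ultimately show ?thesis by simp
  qed
  have unif: "\<exists>r>0. ball z r \<subseteq> D \<and> uniform_limit (ball z r) f (\<lambda>z. lim (\<lambda>n. f n z)) sequentially"
    if z: "z \<in> D" for z
  proof -
    obtain r C where r: "r > 0" "C > 0" "ball z r \<subseteq> D" and
      C: "\<And>f u. f \<in> H \<Longrightarrow> u \<in> ball z r \<Longrightarrow> (cmod (f u))\<^sup>2 \<le> C * N f"
      using local_bound[OF z] by blast
    have "uniformly_Cauchy_on (ball z r) f"
    proof (rule uniformly_Cauchy_onI)
      fix e :: real assume e: "e > 0"
      obtain K :: nat where K: "real K > 4 * C / e\<^sup>2" using reals_Archimedean2 by blast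
      show "\<exists>K. \<forall>x\<in>ball z r. \<forall>m\<ge>K. \<forall>n\<ge>K. dist (f m x) (f n x) < e"
      proof (intro exI[of _ K] ballI allI impI)
        fix x m n assume x: "x \<in> ball z r" and mn: "m \<ge> K" "n \<ge> K"
        have K0: "real (Suc K) > 0" by simp
        have "(cmod (f m x - f n x))\<^sup>2 \<le> C * N (\<lambda>z. f m z - f n z)"
          by (rule C[OF H_diff[OF fH(1) fH(1)] x])
        also have "\<dots> \<le> C * (2 / real (Suc m) + 2 / real (Suc n))"
          using cauchy r(2) by (intro mult_left_mono) auto
        also have "\<dots> \<le> C * (2 / real (Suc K) + 2 / real (Suc K))"
          using r(2) mn by (intro mult_left_mono add_mono divide_left_mono) auto
        also have "\<dots> = 4 * C / real (Suc K)" by simp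
        also have "\<dots> < e\<^sup>2"
        proof -
          have "4 * C / e\<^sup>2 < real (Suc K)" using K by simp
          then show ?thesis using e K0 by (simp add: divide_less_eq mult.commute del: of_nat_Suc)
        qed
        finally show "dist (f m x) (f n x) < e"
          using e by (simp add: dist_norm power_less_imp_less_base)
      qed
    qed
    then have "uniformly_convergent_on (ball z r) f" by (rule Cauchy_uniformly_convergent)
    then show ?thesis using r by (auto simp: uniformly_convergent_uniform_limit_iff)
  qed
  define g where "g z = lim (\<lambda>n. f n z)" for z
  have conv: "(\<lambda>n. f n z) \<longlonglongrightarrow> g z" for z
  proof (cases "z \<in> D")
    case True
    then obtain r where r: "r > 0" "uniform_limit (ball z r) f (\<lambda>z. lim (\<lambda>n. f n z)) sequentially"
      using unif by blast
    then show ?thesis using tendsto_uniform_limitI[OF r(2), of z] by (simp add: g_def)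
  next
    case False
    then have "f n z = 0" for n using fH(1)[of n] by (simp add: L2_holo_def)
    then show ?thesis by (simp add: g_def)
  qed
  have gD: "g z = 0" if "z \<notin> D" for z
  proof -
    have "f n z = 0" for n using fH(1)[of n] that by (simp add: L2_holo_def)
    then show ?thesis using conv[of z] by (simp add: LIMSEQ_const_iff)
  qed
  have gholo: "holomorphic_several g D"
    unfolding g_def[abs_def]
    by (rule holomorphic_several_uniform_limit[of f]) (use fH unif in \<open>auto simp: L2_holo_def\<close>)
  have gm: "g \<in> borel_measurable borel"
    by (rule extended_holomorphic_borel[OF open_D gholo gD])
  have Ng: "(\<integral>\<^sup>+z. ennreal ((cmod (g z))\<^sup>2) \<partial>M) \<le> ennreal d"
  proof -
    have "(\<lambda>n. ennreal ((cmod (f n z))\<^sup>2)) \<longlonglongrightarrow> ennreal ((cmod (g z))\<^sup>2)" for z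
      by (intro tendsto_ennrealI tendsto_intros conv)
    then have "liminf (\<lambda>n. ennreal ((cmod (f n z))\<^sup>2)) = ennreal ((cmod (g z))\<^sup>2)" for z
      by (rule lim_imp_Liminf[OF trivial_limit_sequentially])
    then have "(\<integral>\<^sup>+z. ennreal ((cmod (g z))\<^sup>2) \<partial>M) = (\<integral>\<^sup>+z. liminf (\<lambda>n. ennreal ((cmod (f n z))\<^sup>2)) \<partial>M)"
      by simp
    also have "\<dots> \<le> liminf (\<lambda>n. \<integral>\<^sup>+z. ennreal ((cmod (f n z))\<^sup>2) \<partial>M)"
      by (rule nn_integral_liminf) (use H_measurable[OF fH(1)] in simp)
    also have "\<dots> = liminf (\<lambda>n. ennreal (N (f n)))"
      by (simp add: nn_integral_eq_integral integrable_H[OF fH(1)])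
    also have "\<dots> \<le> liminf (\<lambda>n. ennreal (d + 1 / real (Suc n)))"
      using f(2) by (intro Liminf_mono always_eventually) (simp add: ennreal_leI less_imp_le)
    also have "\<dots> = ennreal d"
    proof (rule lim_imp_Liminf[OF trivial_limit_sequentially])
      have "(\<lambda>n. d + 1 / real (Suc n)) \<longlonglongrightarrow> d + 0"
        by (intro tendsto_add tendsto_const LIMSEQ_inverse_real_of_nat[unfolded inverse_eq_divide])
      then show "(\<lambda>n. ennreal (d + 1 / real (Suc n))) \<longlonglongrightarrow> ennreal d"
        by (intro tendsto_ennrealI) simp
    qed
    finally show ?thesis .
  qed
  have "integrable M (\<lambda>z. (cmod (g z))\<^sup>2)"
    using gm Ng by (intro integrableI_nonneg) (auto simp: le_less_trans[OF _ ennreal_less_top])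
  then have gH: "g \<in> H" using gholo gD by (simp add: L2_holo_def)
  have gw: "g w = 1" using conv[of w] fH(2) by (simp add: LIMSEQ_const_iff)
  have d0: "d \<ge> 0" unfolding d_def by (rule cInf_greatest) (use S_ne in auto)
  have Ngd: "N g = d"
  proof (rule antisym)
    show "d \<le> N g" by (rule d_le) (simp add: S_def gH gw)
    show "N g \<le> d" using Ng d0 nn_integral_eq_integral[OF integrable_H[OF gH]] by (simp add: ennreal_le_iff)
  qed
  have orth: "inp h g = 0" if h: "h \<in> H" "h w = 0" for h
  proof -
    define p where "p = inp g h"
    define nh where "nh = N h"
    \<comment> \<open>Moving \<open>g\<close> by \<open>c * h\<close> gains
      \<open>2\<epsilon>|p|\<^sup>2\<close> to first order and loses \<open>\<epsilon>\<^sup>2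
      |p|\<^sup>2 nh\<close>; for this \<open>\<epsilon>\<close> the gain prevails unless \<open>p =
      0\<close>.\<close>
    define \<epsilon> where "\<epsilon> = 1 / (nh + 1)"
    have "nh \<ge> 0" by (simp add: nh_def)
    then have \<epsilon>: "\<epsilon> > 0" "\<epsilon> * nh < 1" by (auto simp: \<epsilon>_def divide_less_eq)
    define c where "c = - of_real \<epsilon> * p"
    have "(\<lambda>z. g z + c * h z) \<in> S" using gH gw h H_add H_scale by (simp add: S_def)
    then have "d \<le> N (\<lambda>z. g z + c * h z)" by (rule d_le)
    also have "\<dots> = d + 2 * Re (cnj c * p) + (cmod c)\<^sup>2 * nh"
      by (simp add: N_add[OF gH h(1)] Ngd p_def nh_def)
    also have "cnj c * p = - of_real (\<epsilon> * (cmod p)\<^sup>2)"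
      by (simp only: c_def of_real_mult complex_norm_square) (simp add: mult_ac)
    also have "(cmod c)\<^sup>2 = \<epsilon>\<^sup>2 * (cmod p)\<^sup>2"
      using \<epsilon> by (simp add: c_def norm_mult power_mult_distrib)
    finally have "0 \<le> \<epsilon> * (cmod p)\<^sup>2 * (\<epsilon> * nh - 2)"
      by (simp add: algebra_simps power2_eq_square)
    then have "(cmod p)\<^sup>2 \<le> 0"
      using \<epsilon> by (smt (verit) mult_neg_pos mult_pos_pos mult.commute zero_le_power2)
    then show ?thesis by (subst inp_commute) (simp add: p_def[symmetric])
  qed
  have d_pos: "d \<noteq> 0"
    using N_eq_0[OF gH] Ngd gw by (metis zero_neq_one)
  show ?thesis
  proof (intro bexI[of _ "\<lambda>z. of_real (1 / d) * g z"] ballI)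
    show "(\<lambda>z. of_real (1 / d) * g z) \<in> H" using gH H_scale by blast
    fix h assume h: "h \<in> H"
    have "(\<lambda>z. h z + (- h w) * g z) \<in> H" using h gH H_add H_scale by blast
    then have "inp (\<lambda>z. h z + (- h w) * g z) g = 0" by (rule orth) (simp add: gw)
    moreover have "inp (\<lambda>z. h z + (- h w) * g z) g = inp h g + (- h w) * inp g g"
      using inp_add_left[OF h H_scale[OF gH, of "- h w"] gH] inp_scale_left by metis
    ultimately have "inp h g = h w * of_real d"
      by (simp add: inp_self Ngd)
    then show "h w = inp h (\<lambda>z. of_real (1 / d) * g z)"
      using d_pos by (subst inp_scale_right) simp
  qed
qed

lemma kernel_unique:
  assumes "k \<in> H" "k' \<in> H" "\<And>f. f \<in> H \<Longrightarrow> inp f k = inp f k'"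
  shows "k = k'"
proof -
  have d: "(\<lambda>z. k z + (-1) * k' z) \<in> H" using assms H_add H_scale by blast
  have "inp (\<lambda>z. k z + (-1) * k' z) (\<lambda>z. k z + (-1) * k' z) = 0"
    using assms(3)[OF d] by (simp only: inp_add_right[OF assms(1) H_scale[OF assms(2)] d] inp_scale_right) simp
  then have "N (\<lambda>z. k z + (-1) * k' z) = 0" unfolding inp_self by simp
  from N_eq_0[OF d this] show ?thesis by (auto simp: fun_eq_iff)
qed

end

section \<open>Diagonal groups and their characters\<close>

lemma geometric_sum_root_of_unity:
  fixes w :: complex
  assumes "w ^ n = 1" "n > 0"
  shows "(\<Sum>k<n. w ^ k) = (if w = 1 then of_nat n else 0)"
  using assms sum_gp_strict[of w n] by (auto simp: geometric_sum)

lemma cmod_root_of_unity: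
  fixes w :: complex
  assumes "w ^ n = 1" "n > 0"
  shows "cmod w = 1"
proof -
  have "cmod w ^ n = 1" using assms by (simp flip: norm_power)
  then show ?thesis using power_eq_imp_eq_base[of "cmod w" n 1] assms(2) by simp
qed

lemma primitive_root_of_unity:
  assumes n: "n > 0"
  shows "\<exists>w :: complex. \<forall>k. w ^ k = 1 \<longleftrightarrow> n dvd k"
proof -
  define w where "w = cis (2 * pi / real (n))"
  have w: "w ^ k = 1 \<longleftrightarrow> n dvd k" for k
  proof -
    have "w ^ k = cis (real k * (2 * pi / real (n)))" unfolding w_def by (rule Complex.DeMoivre)
    also have "real k * (2 * pi / real (n)) = 2 * pi * real k / real (n)" by simp
    also have "cis (2 * pi * real k / real (n)) = 1 \<longleftrightarrow> n dvd k"
    proof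
      assume "cis (2 * pi * real k / real (n)) = 1"
      then obtain i :: int where "2 * pi * real k / real (n) = of_int i * 2 * pi"
        by (auto simp: complex_eq_iff cos_one_2pi_int)
      then have "real k = of_int i * real (n)" using n by (simp add: field_simps)
      then have "int k = i * int (n)" by (metis of_int_eq_iff of_int_mult of_int_of_nat_eq)
      then show "n dvd k" by (metis dvd_triv_right int_dvd_int_iff)
    next
      assume "n dvd k"
      then obtain i where "k = n * i" by blast
      then have "2 * pi * real k / real (n) = 2 * pi * real i" using n by simp
      then show "cis (2 * pi * real k / real (n)) = 1"
        by (metis cis_multiple_2pi Ints_of_nat of_nat_in_Nats mult.commute mult.assoc)
    qed
    finally show ?thesis .
  qed
  then show ?thesis by blast
qed

text \<open>The rows of \<open>P\<close> are the coordinate forms \<open>y j\<close>. The group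
  elements \<open>D \<zeta>\<close> multiply \<open>y j\<close> by \<open>\<zeta> j\<close>, an
  arbitrary \<open>m j\<close>-th root of unity, and the characters are given by exponent vectors
  \<open>c \<in> C\<close>. The same function \<open>monomial_fun c\<close> appears in two roles:
  \<open>monomial_fun c \<zeta>\<close> is the value of the character at \<open>D \<zeta>\<close>,
  and \<open>monomial_fun c (y z)\<close> is the semi-invariant polynomial attached to it.\<close>

locale diagonal_group =
  fixes P Q :: "complex^'d^'d" and m :: "'d \<Rightarrow> nat"
  assumes PQ: "P ** Q = mat 1" and QP: "Q ** P = mat 1" and m_pos: "\<And>j. m j > 0"
begin

definition y :: "complex^'d \<Rightarrow> complex^'d" where "y z = P *v z"
definition D :: "complex^'d \<Rightarrow> complex^'d^'d" where
  "D \<zeta> = Q ** (\<chi> i j. if i = j then \<zeta> $ i else 0) ** P"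
definition Z :: "(complex^'d) set" where "Z = {\<zeta>. \<forall>j. \<zeta> $ j ^ m j = 1}"
definition C :: "('d \<Rightarrow> nat) set" where "C = {c. \<forall>j. c j < m j}"
definition conjv :: "complex^'d \<Rightarrow> complex^'d" where "conjv \<zeta> = (\<chi> j. cnj (\<zeta> $ j))"

lemma Qy: "Q *v y z = z" and yQ: "y (Q *v u) = u"
  by (simp_all add: y_def matrix_vector_mul_assoc PQ QP)

lemma y_inj: "y z = y w \<Longrightarrow> z = w" by (metis Qy)

lemma y_D: "y (D \<zeta> *v z) = \<zeta> * y z"
proof -
  have "(\<chi> i j. if i = j then \<zeta> $ i else 0) *v u = \<zeta> * u" for u
    by (simp add: vec_eq_iff matrix_vector_mult_def if_distrib[of "\<lambda>c. c * _"] cong: if_cong)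
  then have "D \<zeta> *v z = Q *v (\<zeta> * y z)"
    by (simp add: D_def y_def matrix_vector_mul_assoc[symmetric])
  then show ?thesis by (simp add: yQ)
qed

lemma D_eqI: "(\<And>z. y (A *v z) = \<zeta> * y z) \<Longrightarrow> A = D \<zeta>"
  by (subst matrix_eq) (metis y_D y_inj)

lemma D_mult: "D \<zeta> ** D \<eta> = D (\<zeta> * \<eta>)"
  by (rule D_eqI) (simp add: matrix_vector_mul_assoc[symmetric] y_D mult.assoc)

lemma D_one: "D 1 = mat 1"
  by (rule D_eqI[symmetric]) simp

lemma D_inj: assumes "D \<zeta> = D \<eta>" shows "\<zeta> = \<eta>"
proof -
  have "y (D \<zeta> *v (Q *v 1)) = y (D \<eta> *v (Q *v 1))" using assms by simp
  then show ?thesis by (simp add: y_D yQ)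
qed

lemma det_D: "det (D \<zeta>) = (\<Prod>j\<in>UNIV. \<zeta> $ j)"
proof -
  have "det (D \<zeta>) = det Q * (\<Prod>j\<in>UNIV. \<zeta> $ j) * det P"
    unfolding D_def by (simp add: det_mul det_diagonal)
  moreover have "det Q * det P = 1" by (metis QP det_I det_mul)
  ultimately show ?thesis by (simp add: mult.assoc mult.commute[of _ "det P"])
qed

lemma Z_cmod: "\<zeta> \<in> Z \<Longrightarrow> cmod (\<zeta> $ j) = 1"
  using cmod_root_of_unity[of "\<zeta> $ j" "m j"] m_pos[of j] by (simp add: Z_def)

lemma Z_conj: "\<zeta> \<in> Z \<Longrightarrow> \<zeta> * conjv \<zeta> = 1" and Z_conj': "\<zeta> \<in> Z \<Longrightarrow> conjv \<zeta> * \<zeta> = 1"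
  using Z_cmod by (simp_all add: vec_eq_iff conjv_def complex_norm_square[symmetric] mult.commute)

lemma Z_one: "1 \<in> Z" and Z_mult: "\<zeta> \<in> Z \<Longrightarrow> \<eta> \<in> Z \<Longrightarrow> \<zeta> * \<eta> \<in> Z"
  and conjv_Z: "\<zeta> \<in> Z \<Longrightarrow> conjv \<zeta> \<in> Z"
  by (simp_all add: Z_def power_mult_distrib conjv_def flip: complex_cnj_power)

lemma conjv_conjv [simp]: "conjv (conjv \<zeta>) = \<zeta>" by (simp add: conjv_def vec_eq_iff)

lemma bij_mult_Z: "\<eta> \<in> Z \<Longrightarrow> bij_betw ((*) \<eta>) Z Z"
  by (rule bij_betw_byWitness[where f' = "(*) (conjv \<eta>)"])
     (auto simp: mult.assoc[symmetric] Z_conj Z_conj' intro: Z_mult conjv_Z)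

lemma matrix_inv_D:
  assumes "\<zeta> \<in> Z" shows "matrix_inv (D \<zeta>) = D (conjv \<zeta>)"
proof -
  have "D \<zeta> ** D (conjv \<zeta>) = mat 1" "D (conjv \<zeta>) ** D \<zeta> = mat 1"
    using assms by (simp_all add: D_mult Z_conj Z_conj' D_one)
  then have inv: "D \<zeta> ** matrix_inv (D \<zeta>) = mat 1 \<and> matrix_inv (D \<zeta>) ** D \<zeta> = mat 1"
    unfolding matrix_inv_def by (intro someI conjI)
  have "matrix_inv (D \<zeta>) = matrix_inv (D \<zeta>) ** (D \<zeta> ** D (conjv \<zeta>))"
    using assms by (simp add: D_mult Z_conj D_one)
  also have "\<dots> = D (conjv \<zeta>)" using inv by (simp add: matrix_mul_assoc)
  finally show ?thesis .
qed

lemma act_D: "\<zeta> \<in> Z \<Longrightarrow> act (D \<zeta>) z = D (conjv \<zeta>) *v z"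
  by (simp add: act_def matrix_inv_D)

lemma chi_mult: "monomial_fun c (\<zeta> * \<eta>) = monomial_fun c \<zeta> * monomial_fun c \<eta>"
  by (simp add: monomial_fun_def power_mult_distrib prod.distrib)

lemma chi_one [simp]: "monomial_fun c 1 = 1" by (simp add: monomial_fun_def)

lemma chi_conjv: "monomial_fun c (conjv \<zeta>) = cnj (monomial_fun c \<zeta>)"
  by (simp add: monomial_fun_def conjv_def)

lemma chi_cmod: "\<zeta> \<in> Z \<Longrightarrow> cmod (monomial_fun c \<zeta>) = 1"
  by (simp add: monomial_fun_def prod_norm[symmetric] norm_power Z_cmod)

lemma chi_cnj: "\<zeta> \<in> Z \<Longrightarrow> monomial_fun c \<zeta> * cnj (monomial_fun c \<zeta>) = 1"
  using chi_cmod by (simp add: complex_norm_square[symmetric])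

lemma C_PiE: "C = PiE UNIV (\<lambda>j. {..<m j})"
  by (auto simp: C_def PiE_def)

lemma finite_C: "finite C" unfolding C_PiE by (intro finite_PiE) auto

lemma card_Z: "card Z = (\<Prod>j\<in>UNIV. m j)" and finite_Z: "finite Z"
proof -
  have bij: "bij_betw vec_nth Z (PiE UNIV (\<lambda>j. {w. w ^ m j = 1}))"
    by (rule bij_betw_byWitness[where f' = vec_lambda]) (auto simp: Z_def)
  have m1: "m j \<ge> 1" for j using m_pos[of j] by simp
  have fin: "finite (PiE UNIV (\<lambda>j::'d. {w :: complex. w ^ m j = 1}))"
    using finite_roots_unity[OF m1] by (intro finite_PiE) auto
  show "finite Z" using bij_betw_finite[OF bij] fin by simp
  have "card Z = (\<Prod>j\<in>UNIV. card {w :: complex. w ^ m j = 1})"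
    using bij_betw_same_card[OF bij] by (simp add: card_PiE)
  then show "card Z = (\<Prod>j\<in>UNIV. m j)"
    by (simp add: card_roots_unity_eq m_pos)
qed

lemma card_Z_pos: "card Z > 0" by (simp add: card_Z prod_pos m_pos)

text \<open>Orthogonality of the columns of the character table, as a product of geometric
  sums.\<close>

lemma sum_chi_C:
  assumes "\<zeta> \<in> Z"
  shows "(\<Sum>c\<in>C. monomial_fun c \<zeta>) = (if \<zeta> = 1 then of_nat (card Z) else 0)"
proof -
  have "(\<Sum>c\<in>C. monomial_fun c \<zeta>) = (\<Prod>j\<in>UNIV. \<Sum>k<m j. \<zeta> $ j ^ k)"
    unfolding C_PiE monomial_fun_def by (subst prod_sum_PiE) auto
  also have "\<dots> = (\<Prod>j\<in>UNIV. if \<zeta> $ j = 1 then of_nat (m j) else 0)"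
    using assms m_pos by (intro prod.cong) (auto simp: Z_def geometric_sum_root_of_unity)
  also have "\<dots> = (if \<zeta> = 1 then of_nat (card Z) else 0)"
    by (auto simp: vec_eq_iff card_Z)
  finally show ?thesis .
qed

text \<open>The element with a primitive \<open>m j\<close>-th root of unity in place
  \<open>j\<close> and 1 elsewhere determines \<open>c j\<close>.\<close>

lemma chi_separates:
  assumes "c \<in> C" "c' \<in> C" "\<And>\<zeta>. \<zeta> \<in> Z \<Longrightarrow> monomial_fun c \<zeta> = monomial_fun c' \<zeta>"
  shows "c = c'"
proof
  fix j
  obtain w :: complex where w: "\<And>k. w ^ k = 1 \<longleftrightarrow> m j dvd k"
    using primitive_root_of_unity[OF m_pos] by blast
  define \<zeta> :: "complex^'d" where "\<zeta> = (\<chi> i. if i = j then w else 1)"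
  have "\<zeta> \<in> Z" using w[of "m j"] by (simp add: Z_def \<zeta>_def)
  moreover have "monomial_fun c \<zeta> = w ^ c j" for c
  proof -
    have "monomial_fun c \<zeta> = (\<Prod>i\<in>UNIV. if i = j then w ^ c i else 1)"
      unfolding monomial_fun_def \<zeta>_def by (rule prod.cong) auto
    then show ?thesis by simp
  qed
  ultimately have eq: "w ^ c j = w ^ c' j" using assms(3) by metis
  have w0: "w \<noteq> 0" using w[of "m j"] m_pos[of j] by (auto simp: power_0_left)
  have lt: "c j < m j" "c' j < m j" using assms by (auto simp: C_def)
  have "c j \<ge> c' j \<Longrightarrow> c j = c' j" "c' j \<ge> c j \<Longrightarrow> c j = c' j"
  proof -
    have *: "a = b" if "w ^ a = w ^ b" "b \<le> a" "a < m j" for a b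
    proof -
      have "w ^ b * w ^ (a - b) = w ^ b" using that by (simp flip: power_add)
      then have "w ^ (a - b) = 1" using w0 by simp
      then have "m j dvd a - b" using w by simp
      then show ?thesis using that by (metis diff_is_0_eq' dvd_imp_le le_antisym less_imp_diff_less not_less zero_less_diff le_neq_implies_less)
    qed
    show "c j \<ge> c' j \<Longrightarrow> c j = c' j" using *[OF eq] lt by simp
    show "c' j \<ge> c j \<Longrightarrow> c j = c' j" using *[OF eq[symmetric]] lt by simp
  qed
  then show "c j = c' j" by linarith
qed

definition G :: "(complex^'d^'d) set" where "G = D ` Z"

lemma inj_D: "inj_on D Z" using D_inj by (auto intro: inj_onI)

lemma card_G: "card G = card Z" unfolding G_def by (rule card_image[OF inj_D])

text \<open>This recovers \<open>\<zeta>\<close> from \<open>D \<zeta>\<close>, because \<open>Q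
  *v 1\<close> is the point all of whose coordinates are 1.\<close>

definition coord :: "complex^'d^'d \<Rightarrow> complex^'d" where "coord \<sigma> = y (\<sigma> *v (Q *v 1))"

lemma coord_D [simp]: "coord (D \<zeta>) = \<zeta>" by (simp add: coord_def y_D yQ)

definition rep :: "('d \<Rightarrow> nat) \<Rightarrow> complex^'d^'d \<Rightarrow> complex Matrix.mat" where
  "rep c = (\<lambda>\<sigma>\<in>G. monomial_fun c (coord \<sigma>) \<cdot>\<^sub>m 1\<^sub>m 1)"

lemma rep_D: "\<zeta> \<in> Z \<Longrightarrow> rep c (D \<zeta>) = monomial_fun c \<zeta> \<cdot>\<^sub>m 1\<^sub>m 1"
  by (simp add: rep_def G_def)

lemma scalar_mat_mult: "(a \<cdot>\<^sub>m 1\<^sub>m 1) * (b \<cdot>\<^sub>m 1\<^sub>m 1) = ((a * b) \<cdot>\<^sub>m 1\<^sub>m 1 :: complex Matrix.mat)"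
  by (rule eq_matI) (simp_all add: scalar_prod_def)

lemma scalar_mat_eq: "a \<cdot>\<^sub>m 1\<^sub>m 1 = (b \<cdot>\<^sub>m 1\<^sub>m 1 :: complex Matrix.mat) \<longleftrightarrow> a = b"
proof
  assume "a \<cdot>\<^sub>m 1\<^sub>m 1 = (b \<cdot>\<^sub>m 1\<^sub>m 1 :: complex Matrix.mat)"
  then have "(a \<cdot>\<^sub>m 1\<^sub>m 1) $$ (0, 0) = (b \<cdot>\<^sub>m 1\<^sub>m 1 :: complex Matrix.mat) $$ (0, 0)" by simp
  then show "a = b" by simp
qed simp

lemma irreducible_rep_rep: "irreducible_rep G 1 (rep c)"
  unfolding irreducible_rep_def
proof (intro conjI allI impI)
  show "rep c \<in> hom (GL\<lparr>carrier := G\<rparr>) (units_of (ring_mat TYPE(complex) 1 ()))"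
  proof (rule homI)
    fix \<sigma> assume "\<sigma> \<in> carrier (GL\<lparr>carrier := G\<rparr>)"
    then obtain \<zeta> where \<zeta>: "\<sigma> = D \<zeta>" "\<zeta> \<in> Z" by (auto simp: G_def)
    have "\<exists>B\<in>carrier_mat 1 1. B * rep c \<sigma> = 1\<^sub>m 1 \<and> rep c \<sigma> * B = 1\<^sub>m 1"
    proof (intro bexI conjI)
      show "cnj (monomial_fun c \<zeta>) \<cdot>\<^sub>m 1\<^sub>m 1 * rep c \<sigma> = 1\<^sub>m 1" "rep c \<sigma> * (cnj (monomial_fun c \<zeta>) \<cdot>\<^sub>m 1\<^sub>m 1) = 1\<^sub>m 1"
        using chi_cnj[OF \<zeta>(2)] by (auto simp: \<zeta> rep_D scalar_mat_mult mult.commute intro!: eq_matI)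
    qed simp
    moreover have "rep c \<sigma> \<in> carrier_mat 1 1" by (simp add: \<zeta> rep_D)
    ultimately show "rep c \<sigma> \<in> carrier (units_of (ring_mat TYPE(complex) 1 ()))"
      by (simp add: units_of_def Units_def ring_mat_def)
  next
    fix \<sigma> \<tau> assume "\<sigma> \<in> carrier (GL\<lparr>carrier := G\<rparr>)" "\<tau> \<in> carrier (GL\<lparr>carrier := G\<rparr>)"
    then obtain \<zeta> \<eta> where \<zeta>: "\<sigma> = D \<zeta>" "\<zeta> \<in> Z" "\<tau> = D \<eta>" "\<eta> \<in> Z" by (auto simp: G_def)
    then show "rep c (\<sigma> \<otimes>\<^bsub>GL\<lparr>carrier := G\<rparr>\<^esub> \<tau>) = rep c \<sigma> \<otimes>\<^bsub>units_of (ring_mat TYPE(complex) 1 ())\<^esub> rep c \<tau>"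
      by (simp add: GL_def units_of_def ring_mat_def D_mult rep_D Z_mult scalar_mat_mult chi_mult del: One_nat_def)
  qed
  fix W :: "complex Matrix.vec set"
  assume W: "W \<subseteq> carrier_vec 1"
    "0\<^sub>v 1 \<in> W \<and> (\<forall>v\<in>W. \<forall>w\<in>W. v + w \<in> W) \<and> (\<forall>c. \<forall>v\<in>W. c \<cdot>\<^sub>v v \<in> W)
      \<and> (\<forall>\<sigma>\<in>G. \<forall>v\<in>W. rep c \<sigma> *\<^sub>v v \<in> W)"
  show "W = {0\<^sub>v 1} \<or> W = carrier_vec 1"
  proof (cases "W \<subseteq> {0\<^sub>v 1}")
    case False
    then obtain w where w: "w \<in> W" "w \<noteq> 0\<^sub>v 1" by blast
    have wd: "w \<in> carrier_vec 1" using w W by blast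
    have w0: "Matrix.vec_index w 0 \<noteq> 0"
    proof
      assume "Matrix.vec_index w 0 = 0"
      then have "w = 0\<^sub>v 1" using wd by (intro eq_vecI) auto
      then show False using w by simp
    qed
    have "v \<in> W" if v: "v \<in> carrier_vec 1" for v
    proof -
      have "v = (Matrix.vec_index v 0 / Matrix.vec_index w 0) \<cdot>\<^sub>v w"
        using v wd w0 by (intro eq_vecI) auto
      then show ?thesis using W w(1) by metis
    qed
    then show ?thesis using W by blast
  qed (use W in blast)
qed simp

text \<open>The vectors \<open>w c\<close> obtained by averaging a fixed \<open>v \<noteq>
  0\<close> over the group against the conjugate of the character \<open>c\<close> are common
  eigenvectors, and by column orthogonality their sum is \<open>card Z\<close> times
  \<open>v\<close>. So some \<open>w c\<close> is nonzero; it spans an invariant line, which by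
  irreducibility is the whole space.\<close>

lemma irreducible_rep_eq_rep:
  assumes irr: "irreducible_rep G n \<rho>"
  shows "\<exists>c\<in>C. \<forall>\<sigma>\<in>G. \<rho> \<sigma> = rep c \<sigma>"
proof -
  note irr' = irr[unfolded irreducible_rep_def]
  have n: "n > 0" by (rule conjunct1[OF irr'])
  have hom: "\<rho> \<in> hom (GL\<lparr>carrier := G\<rparr>) (units_of (ring_mat TYPE(complex) n ()))"
    by (rule conjunct1[OF conjunct2[OF irr']])
  have inv: "W = {0\<^sub>v n} \<or> W = carrier_vec n"
    if W: "W \<subseteq> carrier_vec n" "0\<^sub>v n \<in> W" "\<And>v w. v \<in> W \<Longrightarrow> w \<in> W \<Longrightarrow> v + w \<in> W"
      "\<And>c v. v \<in> W \<Longrightarrow> c \<cdot>\<^sub>v v \<in> W" "\<And>\<sigma> v. \<sigma> \<in> G \<Longrightarrow> v \<in> W \<Longrightarrow> \<rho> \<sigma> *\<^sub>v v \<in> W" for W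
    by (rule mp[OF mp[OF spec[OF conjunct2[OF conjunct2[OF irr']]]]])
       (use W in \<open>simp_all\<close>)
  define r where "r \<zeta> = \<rho> (D \<zeta>)" for \<zeta>
  have r_carrier: "r \<zeta> \<in> carrier_mat n n" if "\<zeta> \<in> Z" for \<zeta>
    using hom_in_carrier[OF hom, of "D \<zeta>"] that by (simp add: r_def G_def units_of_def Units_def ring_mat_def)
  have r_unit: "\<exists>B\<in>carrier_mat n n. B * r \<zeta> = 1\<^sub>m n" if "\<zeta> \<in> Z" for \<zeta>
    using hom_in_carrier[OF hom, of "D \<zeta>"] that by (auto simp: r_def G_def units_of_def Units_def ring_mat_def)
  have r_mult: "r (\<zeta> * \<eta>) = r \<zeta> * r \<eta>" if "\<zeta> \<in> Z" "\<eta> \<in> Z" for \<zeta> \<eta>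
    using hom_mult[OF hom, of "D \<zeta>" "D \<eta>"] that
    by (simp add: r_def G_def GL_def units_of_def ring_mat_def D_mult)
  have r_one: "r 1 = 1\<^sub>m n"
  proof -
    obtain B where B: "B \<in> carrier_mat n n" "B * r 1 = 1\<^sub>m n" using r_unit[OF Z_one] by blast
    have "r 1 = B * r 1 * r 1" using B r_carrier[OF Z_one] by simp
    also have "\<dots> = B * (r 1 * r 1)" by (rule assoc_mult_mat[OF B(1) r_carrier[OF Z_one] r_carrier[OF Z_one]])
    also have "r 1 * r 1 = r 1" using r_mult[OF Z_one Z_one] by simp
    finally show ?thesis using B by simp
  qed
  define v :: "complex Matrix.vec" where "v = unit_vec n 0"
  have v: "v \<in> carrier_vec n" by (simp add: v_def)
  define w where "w c = Matrix.vec n (\<lambda>i. \<Sum>\<zeta>\<in>Z. cnj (monomial_fun c \<zeta>) * Matrix.vec_index (r \<zeta> *\<^sub>v v) i)" for c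
  have w_carrier: "w c \<in> carrier_vec n" for c by (simp add: w_def)
  have eigen: "r \<eta> *\<^sub>v w c = monomial_fun c \<eta> \<cdot>\<^sub>v w c" if \<eta>: "\<eta> \<in> Z" for \<eta> c
  proof (rule eq_vecI)
    show "dim_vec (r \<eta> *\<^sub>v w c) = dim_vec (monomial_fun c \<eta> \<cdot>\<^sub>v w c)" using r_carrier[OF \<eta>] by (simp add: w_def)
    fix i assume "i < dim_vec (monomial_fun c \<eta> \<cdot>\<^sub>v w c)"
    then have i: "i < n" by (simp add: w_def)
    have mv: "Matrix.vec_index (r \<eta> *\<^sub>v u) i = (\<Sum>k<n. r \<eta> $$ (i, k) * Matrix.vec_index u k)" if "u \<in> carrier_vec n" for u
      using r_carrier[OF \<eta>] that i by (auto simp: scalar_prod_def lessThan_atLeast0 intro!: sum.cong)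
    have "Matrix.vec_index (r \<eta> *\<^sub>v w c) i
        = (\<Sum>k<n. r \<eta> $$ (i, k) * (\<Sum>\<zeta>\<in>Z. cnj (monomial_fun c \<zeta>) * Matrix.vec_index (r \<zeta> *\<^sub>v v) k))"
      by (subst mv[OF w_carrier]) (simp add: w_def)
    also have "\<dots> = (\<Sum>\<zeta>\<in>Z. cnj (monomial_fun c \<zeta>) * (\<Sum>k<n. r \<eta> $$ (i, k) * Matrix.vec_index (r \<zeta> *\<^sub>v v) k))"
      by (simp add: sum_distrib_left) (subst sum.swap, simp add: mult_ac)
    also have "\<dots> = (\<Sum>\<zeta>\<in>Z. cnj (monomial_fun c \<zeta>) * Matrix.vec_index (r \<eta> *\<^sub>v (r \<zeta> *\<^sub>v v)) i)"
      by (intro sum.cong refl, subst mv) (use r_carrier v in \<open>auto intro: mult_mat_vec_carrier\<close>)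
    also have "\<dots> = (\<Sum>\<zeta>\<in>Z. monomial_fun c \<eta> * (cnj (monomial_fun c (\<eta> * \<zeta>)) * Matrix.vec_index (r (\<eta> * \<zeta>) *\<^sub>v v) i))"
    proof (intro sum.cong refl)
      fix \<zeta> assume \<zeta>: "\<zeta> \<in> Z"
      have "r \<eta> *\<^sub>v (r \<zeta> *\<^sub>v v) = r (\<eta> * \<zeta>) *\<^sub>v v"
        by (simp add: r_mult[OF \<eta> \<zeta>] assoc_mult_mat_vec[OF r_carrier[OF \<eta>] r_carrier[OF \<zeta>] v])
      moreover have "monomial_fun c \<eta> * cnj (monomial_fun c (\<eta> * \<zeta>)) = cnj (monomial_fun c \<zeta>)"
        using chi_cnj[OF \<eta>] by (simp add: chi_mult mult.assoc[symmetric])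
      ultimately show "cnj (monomial_fun c \<zeta>) * Matrix.vec_index (r \<eta> *\<^sub>v (r \<zeta> *\<^sub>v v)) i
          = monomial_fun c \<eta> * (cnj (monomial_fun c (\<eta> * \<zeta>)) * Matrix.vec_index (r (\<eta> * \<zeta>) *\<^sub>v v) i)"
        by (simp add: mult.assoc[symmetric])
    qed
    also have "\<dots> = (\<Sum>\<zeta>\<in>Z. monomial_fun c \<eta> * (cnj (monomial_fun c \<zeta>) * Matrix.vec_index (r \<zeta> *\<^sub>v v) i))"
      using sum.reindex_bij_betw[OF bij_mult_Z[OF \<eta>],
        of "\<lambda>\<zeta>. monomial_fun c \<eta> * (cnj (monomial_fun c \<zeta>) * Matrix.vec_index (r \<zeta> *\<^sub>v v) i)"] by simp
    also have "\<dots> = Matrix.vec_index (monomial_fun c \<eta> \<cdot>\<^sub>v w c) i"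
      using i by (simp add: w_def sum_distrib_left)
    finally show "Matrix.vec_index (r \<eta> *\<^sub>v w c) i = Matrix.vec_index (monomial_fun c \<eta> \<cdot>\<^sub>v w c) i" .
  qed
  have "\<exists>c\<in>C. w c \<noteq> 0\<^sub>v n"
  proof (rule ccontr)
    assume "\<not> (\<exists>c\<in>C. w c \<noteq> 0\<^sub>v n)"
    then have 0: "Matrix.vec_index (w c) 0 = 0" if "c \<in> C" for c using that n by simp
    have "0 = (\<Sum>c\<in>C. Matrix.vec_index (w c) 0)" using 0 by simp
    also have "\<dots> = (\<Sum>\<zeta>\<in>Z. (\<Sum>c\<in>C. monomial_fun c (conjv \<zeta>)) * Matrix.vec_index (r \<zeta> *\<^sub>v v) 0)"
      using n by (simp add: w_def chi_conjv sum_distrib_right) (rule sum.swap)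
    also have "\<dots> = (\<Sum>\<zeta>\<in>Z. if \<zeta> = 1 then of_nat (card Z) * Matrix.vec_index (r \<zeta> *\<^sub>v v) 0 else 0)"
    proof (intro sum.cong refl)
      fix \<zeta> assume \<zeta>: "\<zeta> \<in> Z"
      have "conjv \<zeta> = 1 \<longleftrightarrow> \<zeta> = 1" by (metis Z_conj \<zeta> mult.right_neutral Z_one conjv_Z mult.left_neutral)
      then show "(\<Sum>c\<in>C. monomial_fun c (conjv \<zeta>)) * Matrix.vec_index (r \<zeta> *\<^sub>v v) 0 =
          (if \<zeta> = 1 then of_nat (card Z) * Matrix.vec_index (r \<zeta> *\<^sub>v v) 0 else 0)"
        by (simp add: sum_chi_C[OF conjv_Z[OF \<zeta>]])
    qed
    also have "\<dots> = of_nat (card Z) * Matrix.vec_index v 0"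
      using finite_Z Z_one v by (simp add: r_one)
    also have "\<dots> = of_nat (card Z)" using n by (simp add: v_def)
    finally show False using card_Z_pos by simp
  qed
  then obtain c where c: "c \<in> C" "w c \<noteq> 0\<^sub>v n" by blast
  define W where "W = {k \<cdot>\<^sub>v w c | k. True}"
  have "W = {0\<^sub>v n} \<or> W = carrier_vec n"
  proof (rule inv)
    show "W \<subseteq> carrier_vec n" using w_carrier by (auto simp: W_def)
    have "0 \<cdot>\<^sub>v w c = 0\<^sub>v n" using w_carrier[of c] by (intro eq_vecI) auto
    then show "0\<^sub>v n \<in> W" unfolding W_def by (intro CollectI exI[of _ 0]) simp
    show "a + b \<in> W" if ab: "a \<in> W" "b \<in> W" for a b
    proof -
      obtain k k' where "a = k \<cdot>\<^sub>v w c" "b = k' \<cdot>\<^sub>v w c" using ab by (auto simp: W_def)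
      then have "a + b = (k + k') \<cdot>\<^sub>v w c" by (simp add: add_smult_distrib_vec)
      then show ?thesis unfolding W_def by blast
    qed
    show "k \<cdot>\<^sub>v a \<in> W" if a: "a \<in> W" for k a
    proof -
      obtain k' where "a = k' \<cdot>\<^sub>v w c" using a by (auto simp: W_def)
      then have "k \<cdot>\<^sub>v a = (k * k') \<cdot>\<^sub>v w c" by (simp add: smult_smult_assoc)
      then show ?thesis unfolding W_def by blast
    qed
    show "\<rho> \<sigma> *\<^sub>v a \<in> W" if sa: "\<sigma> \<in> G" "a \<in> W" for \<sigma> a
    proof -
      obtain \<zeta> k where \<zeta>: "\<sigma> = D \<zeta>" "\<zeta> \<in> Z" "a = k \<cdot>\<^sub>v w c" using sa by (auto simp: G_def W_def)
      have "\<rho> \<sigma> *\<^sub>v a = k \<cdot>\<^sub>v (r \<zeta> *\<^sub>v w c)"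
        using mult_mat_vec[OF r_carrier[OF \<zeta>(2)] w_carrier] by (simp add: \<zeta> r_def)
      then have "\<rho> \<sigma> *\<^sub>v a = (k * monomial_fun c \<zeta>) \<cdot>\<^sub>v w c" by (simp add: eigen[OF \<zeta>(2)] smult_smult_assoc)
      then show ?thesis unfolding W_def by blast
    qed
  qed
  moreover have "w c \<in> W"
  proof -
    have "w c = 1 \<cdot>\<^sub>v w c" by simp
    then show ?thesis unfolding W_def by blast
  qed
  ultimately have W: "W = carrier_vec n" using c(2) by auto
  have n1: "n = 1"
  proof (rule ccontr)
    assume "n \<noteq> 1"
    then have n2: "1 < n" using n by simp
    have "unit_vec n 0 \<in> W" "unit_vec n 1 \<in> W" unfolding W by simp_all
    then obtain k k' where k: "unit_vec n 0 = k \<cdot>\<^sub>v w c" "unit_vec n 1 = k' \<cdot>\<^sub>v w c"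
      unfolding W_def by blast
    have "Matrix.vec_index (unit_vec n 0) i = k * Matrix.vec_index (w c) i" "Matrix.vec_index (unit_vec n 1) i = k' * Matrix.vec_index (w c) i"
      if "i < n" for i
      using that w_carrier[of c] by (simp_all add: k del: One_nat_def)
    from this[of 0] this[of 1] n2 show False
      by (metis index_unit_vec(1) mult_eq_0_iff n zero_neq_one)
  qed
  have "\<rho> \<sigma> = rep c \<sigma>" if sg: "\<sigma> \<in> G" for \<sigma>
  proof -
    obtain \<zeta> where \<zeta>: "\<sigma> = D \<zeta>" "\<zeta> \<in> Z" using sg by (auto simp: G_def)
    have rc: "r \<zeta> \<in> carrier_mat 1 1" using r_carrier[OF \<zeta>(2)] n1 by simp
    have w1: "w c \<in> carrier_vec 1" using w_carrier[of c] n1 by simp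
    have w0: "Matrix.vec_index (w c) 0 \<noteq> 0"
    proof
      assume "Matrix.vec_index (w c) 0 = 0"
      then have "w c = 0\<^sub>v n" using w1 n1 by (intro eq_vecI) auto
      then show False using c by simp
    qed
    have "Matrix.vec_index (r \<zeta> *\<^sub>v w c) 0 = r \<zeta> $$ (0, 0) * Matrix.vec_index (w c) 0"
      using rc w1 by (simp add: scalar_prod_def)
    moreover have "Matrix.vec_index (r \<zeta> *\<^sub>v w c) 0 = monomial_fun c \<zeta> * Matrix.vec_index (w c) 0"
      using w1 by (simp add: eigen[OF \<zeta>(2)])
    ultimately have "r \<zeta> $$ (0, 0) = monomial_fun c \<zeta>" using w0 by simp
    then have "r \<zeta> = monomial_fun c \<zeta> \<cdot>\<^sub>m 1\<^sub>m 1"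
      using rc by (intro eq_matI) auto
    then show ?thesis using \<zeta> by (simp add: r_def rep_D)
  qed
  then show ?thesis using c(1) by blast
qed

lemma irreducible_reps_eq: "irreducible_reps G = rep ` C"
proof
  show "rep ` C \<subseteq> irreducible_reps G"
    using irreducible_rep_rep by (auto simp: irreducible_reps_def rep_def)
  show "irreducible_reps G \<subseteq> rep ` C"
  proof
    fix \<rho> assume \<rho>: "\<rho> \<in> irreducible_reps G"
    then obtain n where n: "irreducible_rep G n \<rho>" "\<rho> \<in> extensional G"
      by (auto simp: irreducible_reps_def)
    then obtain c where c: "c \<in> C" "\<And>\<sigma>. \<sigma> \<in> G \<Longrightarrow> \<rho> \<sigma> = rep c \<sigma>"
      using irreducible_rep_eq_rep by blast
    have "\<rho> = rep c"
      by (rule extensionalityI[OF n(2)]) (auto simp: rep_def c(2))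
    then show "\<rho> \<in> rep ` C" using c by blast
  qed
qed

lemma rep_inj: assumes "c \<in> C" "c' \<in> C" "\<And>\<sigma>. \<sigma> \<in> G \<Longrightarrow> rep c \<sigma> = rep c' \<sigma>" shows "c = c'"
proof (rule chi_separates[OF assms(1,2)])
  fix \<zeta> assume \<zeta>: "\<zeta> \<in> Z"
  then show "monomial_fun c \<zeta> = monomial_fun c' \<zeta>"
    using assms(3)[of "D \<zeta>"] by (simp add: G_def rep_D scalar_mat_eq del: One_nat_def)
qed

text \<open>Conjugation does not change a 1-by-1 matrix, so equivalent representations agree on
  the group, and by extensionality they are equal.\<close>

lemma equivalent_reps_rep:
  assumes "c \<in> C" "(rep c, \<rho>) \<in> equivalent_reps G"
  shows "\<rho> = rep c"
proof -
  obtain c' A B where c': "c' \<in> C" "\<rho> = rep c'"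
    and sim: "\<And>\<sigma>. \<sigma> \<in> G \<Longrightarrow> similar_mat_wit (rep c \<sigma>) (rep c' \<sigma>) A B"
    using assms(2) by (auto simp: equivalent_reps_def irreducible_reps_eq)
  have "c = c'"
  proof (rule rep_inj[OF assms(1) c'(1)])
    fix \<sigma> assume \<sigma>: "\<sigma> \<in> G"
    then obtain \<zeta> where \<zeta>: "\<sigma> = D \<zeta>" "\<zeta> \<in> Z" by (auto simp: G_def)
    have d: "dim_row (rep c \<sigma>) = 1" by (simp add: \<zeta> rep_D)
    from sim[OF \<sigma>] have AB: "A \<in> carrier_mat 1 1" "B \<in> carrier_mat 1 1" "A * B = 1\<^sub>m 1"
      and eq: "rep c \<sigma> = A * rep c' \<sigma> * B"
      unfolding similar_mat_wit_def Let_def d by auto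
    have "A * rep c' \<sigma> * B = monomial_fun c' \<zeta> \<cdot>\<^sub>m (A * B)"
    proof -
      have "A * (k \<cdot>\<^sub>m 1\<^sub>m 1) = k \<cdot>\<^sub>m A" for k
        by (subst mult_smult_distrib[OF AB(1) one_carrier_mat]) (simp only: right_mult_one_mat[OF AB(1)])
      then show ?thesis using mult_smult_assoc_mat[OF AB(1,2)] by (simp add: \<zeta> rep_D del: One_nat_def)
    qed
    then show "rep c \<sigma> = rep c' \<sigma>" using eq AB by (simp add: \<zeta> rep_D del: One_nat_def)
  qed
  then show ?thesis using c' by simp
qed

lemma equivalent_reps_refl: "c \<in> C \<Longrightarrow> (rep c, rep c) \<in> equivalent_reps G"
  unfolding equivalent_reps_def irreducible_reps_eq
proof (intro CollectI case_prodI conjI exI[of _ "1\<^sub>m 1"] ballI imageI)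
  fix \<sigma> assume "\<sigma> \<in> G"
  then obtain \<zeta> where \<zeta>: "\<sigma> = D \<zeta>" "\<zeta> \<in> Z" by (auto simp: G_def)
  show "similar_mat_wit (rep c \<sigma>) (rep c \<sigma>) (1\<^sub>m 1) (1\<^sub>m 1)"
    unfolding similar_mat_wit_def Let_def by (simp add: \<zeta> rep_D)
qed

theorem dual_diagonal: "bij_betw (\<lambda>c. {rep c}) C (dual G)"
proof -
  have "equivalent_reps G `` {rep c} = {rep c}" if "c \<in> C" for c
  proof (intro equalityI subsetI)
    fix \<rho> assume "\<rho> \<in> equivalent_reps G `` {rep c}"
    then have "(rep c, \<rho>) \<in> equivalent_reps G" by simp
    from equivalent_reps_rep[OF that this] show "\<rho> \<in> {rep c}" by simp
  next
    fix \<rho> assume "\<rho> \<in> {rep c}"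
    then show "\<rho> \<in> equivalent_reps G `` {rep c}" using equivalent_reps_refl[OF that] by simp
  qed
  then have "dual G = (\<lambda>c. {rep c}) ` C"
    unfolding dual_def irreducible_reps_eq quotient_def by auto
  moreover have "inj_on (\<lambda>c. {rep c}) C"
  proof (rule inj_onI)
    fix c c' assume c: "c \<in> C" "c' \<in> C" and eq: "{rep c} = {rep c'}"
    from eq have "rep c = rep c'" by simp
    then show "c = c'" by (intro rep_inj[OF c]) simp
  qed
  ultimately show ?thesis by (simp add: bij_betw_def)
qed

end

section \<open>Abelian reflection groups are diagonal\<close>

lemma matrix_inv_works:
  assumes "invertible A"
  shows "A ** matrix_inv A = mat 1" "matrix_inv A ** A = mat 1"
proof -
  have "\<exists>B. A ** B = mat 1 \<and> B ** A = mat 1" using assms by (simp add: invertible_def)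
  then have "A ** matrix_inv A = mat 1 \<and> matrix_inv A ** A = mat 1"
    unfolding matrix_inv_def by (rule someI_ex)
  then show "A ** matrix_inv A = mat 1" "matrix_inv A ** A = mat 1" by auto
qed

lemma act_fixes_iff:
  assumes "invertible \<sigma>"
  shows "act \<sigma> z = z \<longleftrightarrow> \<sigma> *v z = z"
proof -
  have "\<sigma> *v (matrix_inv \<sigma> *v z) = z" "matrix_inv \<sigma> *v (\<sigma> *v z) = z"
    by (simp_all add: matrix_vector_mul_assoc matrix_inv_works[OF assms])
  then show ?thesis unfolding act_def by metis
qed

lemma group_GL: "group (GL :: (complex^'d^'d) monoid)"
proof (rule groupI)
  fix A :: "complex^'d^'d" assume "A \<in> carrier GL"
  then obtain B where B: "A ** B = mat 1" "B ** A = mat 1" by (auto simp: GL_def invertible_def)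
  then have "B \<in> carrier GL" by (auto simp: GL_def invertible_def)
  then show "\<exists>B\<in>carrier GL. B \<otimes>\<^bsub>GL\<^esub> A = \<one>\<^bsub>GL\<^esub>" using B by (intro bexI) (auto simp: GL_def)
next
  have "invertible (mat 1 :: complex^'d^'d)" unfolding invertible_def by (intro exI[of _ "mat 1"]) simp
  then show "\<one>\<^bsub>GL\<^esub> \<in> carrier (GL :: (complex^'d^'d) monoid)" by (simp add: GL_def)
qed (simp_all add: GL_def invertible_mult matrix_mul_assoc)

lemma rank_zero: "rank (0 :: complex^'n^'m) = 0"
proof -
  have "rows (0 :: complex^'n^'m) = {0}" by (auto simp: rows_def row_def vec_eq_iff)
  moreover have "vec.dim {0 :: complex^'n} \<le> card ({} :: (complex^'n) set)"
    by (rule vec.dim_le_card) (auto simp: vec.span_zero)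
  ultimately show ?thesis by (simp add: row_rank_def_gen)
qed

text \<open>The vector \<open>u\<close> is an eigenvector with eigenvalue \<open>1 - cform l
  u\<close>, which leads to a geometric sum.\<close>

lemma rank_one_perturbation_powers:
  fixes A :: "complex^'d^'d"
  assumes "\<And>z. A *v z = z - cform l z *s u"
  shows "(((**) A) ^^ n) (mat 1) *v z = z - ((\<Sum>i<n. (1 - cform l u) ^ i) * cform l z) *s u"
proof (induction n)
  case (Suc n)
  let ?s = "\<Sum>i<n. (1 - cform l u) ^ i"
  have "(1 - cform l u) ^ n = 1 - cform l u * ?s"
    using power_diff_1_eq[of "1 - cform l u" n] by (simp add: algebra_simps)
  then have key: "?s * cform l z + (cform l z - ?s * cform l z * cform l u)
      = (?s + (1 - cform l u) ^ n) * cform l z"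
    by (simp only:) (simp add: algebra_simps)
  have "(((**) A) ^^ Suc n) (mat 1) *v z = A *v (z - (?s * cform l z) *s u)"
    by (simp add: matrix_vector_mul_assoc[symmetric] Suc)
  also have "\<dots> = z - (?s * cform l z + (cform l z - ?s * cform l z * cform l u)) *s u"
    by (simp add: assms cform_diff cform_scale vec_eq_iff algebra_simps)
  finally show ?case by (simp only: key sum.lessThan_Suc)
qed simp

text \<open>If the eigenvalue \<open>ev\<close> of \<open>u\<close> were 1, the powers \<open>z
  \<mapsto> z - n l(z) u\<close> would all be different. So \<open>ev \<noteq> 1\<close>, and a
  coincidence between two powers makes \<open>ev\<close> a root of unity.\<close>

lemma rank_one_perturbation_finite_order:
  fixes A :: "complex^'d^'d"
  assumes A: "\<And>z. A *v z = z - cform l z *s u" and inv: "invertible A" and l: "l \<noteq> 0" and u: "u \<noteq> 0"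
    and fin: "finite S" and S: "\<And>n. (((**) A) ^^ n) (mat 1) \<in> S"
  defines "ev \<equiv> 1 - cform l u"
  shows "ev \<noteq> 1" "\<exists>k>0. ev ^ k = 1"
proof -
  obtain i where i: "l $ i \<noteq> 0" using l by (auto simp: vec_eq_iff)
  define e :: "complex^'d" where "e = axis i (1 / l $ i)"
  have e: "cform l e = 1" using i by (simp add: e_def cform_axis)
  have l0: "ev \<noteq> 0"
  proof
    assume "ev = 0"
    then have "A *v u = 0" by (simp add: A ev_def)
    then have "u = 0" using matrix_inv_works(2)[OF inv] 
      by (metis matrix_vector_mul_assoc matrix_vector_mul_lid matrix_vector_mult_0_right)
    then show False using u by simp
  qed
  have "\<not> inj (\<lambda>n. (((**) A) ^^ n) (mat 1))"
    using fin S by (metis finite_subset image_subsetI infinite_UNIV_nat finite_imageD)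
  then obtain n n' where nn: "n < n'" "(((**) A) ^^ n) (mat 1) = (((**) A) ^^ n') (mat 1)"
    unfolding inj_def by (metis linorder_neqE_nat)
  have "(\<Sum>i<n. ev ^ i) *s u = (\<Sum>i<n'. ev ^ i) *s u"
    using arg_cong[OF nn(2), of "\<lambda>B. B *v e"] by (simp add: rank_one_perturbation_powers[OF A] e ev_def)
  moreover obtain j where j: "u $ j \<noteq> 0" using u by (auto simp: vec_eq_iff)
  ultimately have eq: "(\<Sum>i<n. ev ^ i) = (\<Sum>i<n'. ev ^ i)" by (auto simp: vec_eq_iff dest!: spec[of _ j])
  show "ev \<noteq> 1"
  proof
    assume "ev = 1"
    then have "of_nat n = (of_nat n' :: complex)" using eq by simp
    then show False using nn(1) by (simp only: of_nat_eq_iff)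
  qed
  have "ev ^ n - 1 = ev ^ n' - 1" by (simp only: power_diff_1_eq eq)
  then have "ev ^ n = ev ^ n'" by simp
  also have "ev ^ n' = ev ^ n * ev ^ (n' - n)" using nn(1) by (simp flip: power_add)
  finally have "ev ^ (n' - n) = 1" using l0 by simp
  then show "\<exists>k>0. ev ^ k = 1" using nn(1) by (intro exI[of _ "n' - n"]) simp
qed

definition mult_order :: "complex \<Rightarrow> nat" where
  "mult_order w = (LEAST k. 0 < k \<and> w ^ k = 1)"

lemma mult_order:
  assumes "\<exists>k>0. w ^ k = (1 :: complex)"
  shows "mult_order w > 0" "w ^ mult_order w = 1" "w ^ k = 1 \<longleftrightarrow> mult_order w dvd k"
    "z ^ mult_order w = 1 \<Longrightarrow> \<exists>k<mult_order w. z = w ^ k"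
proof -
  let ?m = "mult_order w"
  have 1: "0 < ?m \<and> w ^ ?m = 1" unfolding mult_order_def using assms by (rule LeastI_ex)
  then show m: "?m > 0" "w ^ ?m = 1" by auto
  have least: "?m \<le> k" if "0 < k" "w ^ k = 1" for k
    unfolding mult_order_def by (rule Least_le) (use that in simp)
  show dvd: "w ^ k = 1 \<longleftrightarrow> ?m dvd k" for k
  proof
    assume k: "w ^ k = 1"
    have "w ^ k = w ^ (?m * (k div ?m) + k mod ?m)" by simp
    also have "\<dots> = w ^ (k mod ?m)" by (simp only: power_add power_mult m) simp
    finally have "w ^ (k mod ?m) = 1" using k by simp
    then have "k mod ?m = 0" using least[of "k mod ?m"] m(1) by (metis gr0I leD mod_less_divisor)
    then show "?m dvd k" by (simp add: mod_eq_0_iff_dvd)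
  next
    assume "?m dvd k"
    then show "w ^ k = 1" using m by (auto simp: power_mult)
  qed
  have w0: "w \<noteq> 0" using m by (metis power_eq_0_iff zero_neq_one zero_power)
  have "inj_on (\<lambda>k. w ^ k) {..<?m}"
  proof (rule linorder_inj_onI')
    fix i j assume ij: "i \<in> {..<?m}" "j \<in> {..<?m}" "i < j"
    show "w ^ i \<noteq> w ^ j"
    proof
      assume "w ^ i = w ^ j"
      also have "w ^ j = w ^ i * w ^ (j - i)" using ij by (simp flip: power_add)
      finally have "w ^ (j - i) = 1" using w0 by simp
      then have "?m \<le> j - i" using least ij by simp
      then show False using ij by simp
    qed
  qed
  then have "card ((\<lambda>k. w ^ k) ` {..<?m}) = ?m" by (simp add: card_image)
  moreover have "(\<lambda>k. w ^ k) ` {..<?m} \<subseteq> {z. z ^ ?m = 1}"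
    using m by (auto simp: power_mult[symmetric] mult.commute) (metis power_mult power_one mult.commute)
  moreover have "card {z :: complex. z ^ ?m = 1} = ?m" using m by (simp add: card_roots_unity_eq)
  moreover have "finite {z :: complex. z ^ ?m = 1}" using m by (intro finite_roots_unity) simp
  ultimately have "(\<lambda>k. w ^ k) ` {..<?m} = {z. z ^ ?m = 1}" by (intro card_subset_eq) auto
  then show "z ^ ?m = 1 \<Longrightarrow> \<exists>k<?m. z = w ^ k" by blast
qed

text \<open>A biorthogonal system of forms \<open>l i\<close> and vectors \<open>v i\<close>
  extends to a basis of forms whose new members vanish on all the \<open>v i\<close>: every form
  \<open>r\<close> is the sum of \<open>\<Sum> r(v i) l i\<close> and a form in the annihilator
  \<open>W\<close> of the \<open>v i\<close>.\<close>

lemma basis_with_dual_vectors: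
  fixes l :: "'i \<Rightarrow> complex^'d" and v :: "'i \<Rightarrow> complex^'d"
  assumes fin: "finite I" and dual: "\<And>i k. i \<in> I \<Longrightarrow> k \<in> I \<Longrightarrow> cform (l i) (v k) = (if i = k then 1 else 0)"
  obtains P :: "complex^'d^'d" and \<iota> where "invertible P" "inj_on \<iota> I" "\<And>i. i \<in> I \<Longrightarrow> P $ \<iota> i = l i"
    "\<And>i j. i \<in> I \<Longrightarrow> cform (P $ j) (v i) = (if j = \<iota> i then 1 else 0)"
proof -
  define W where "W = {r. \<forall>i\<in>I. cform r (v i) = 0}"
  have l_inj: "inj_on l I"
  proof (rule inj_onI)
    fix i k assume ik: "i \<in> I" "k \<in> I" "l i = l k"
    then show "i = k" using dual[of i i] dual[of k i] by (metis zero_neq_one)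
  qed
  have sumI: "cform (\<Sum>i\<in>I. c i *s l i) (v k) = c k" if "k \<in> I" for c k
  proof -
    have "cform (\<Sum>i\<in>J. c i *s l i) (v k) = (\<Sum>i\<in>J. c i * cform (l i) (v k))" for J
      by (induction J rule: infinite_finite_induct) (simp_all add: cform_add_left cform_scale_left, simp_all add: cform_def)
    also have "(\<Sum>i\<in>I. c i * cform (l i) (v k)) = (\<Sum>i\<in>I. if i = k then c i else 0)"
      using that by (intro sum.cong) (auto simp: dual)
    finally show ?thesis using fin that by simp
  qed
  have ind: "vec.independent (l ` I)"
  proof (rule vec.independent_if_scalars_zero)
    fix c b assume c: "(\<Sum>b\<in>l ` I. c b *s b) = 0" and "b \<in> l ` I"
    then obtain k where k: "k \<in> I" "b = l k" by blast
    have "(\<Sum>i\<in>I. c (l i) *s l i) = 0" using c by (simp add: sum.reindex[OF l_inj])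
    then show "c b = 0" using sumI[OF k(1), of "\<lambda>i. c (l i)"] by (simp add: k cform_def)
  qed (use fin in simp)
  obtain B where B: "l ` I \<subseteq> B" "B \<subseteq> l ` I \<union> W" "vec.independent B" "l ` I \<union> W \<subseteq> vec.span B"
    using vec.maximal_independent_subset_extend[of "l ` I" "l ` I \<union> W"] ind by blast
  have span: "vec.span B = UNIV"
  proof -
    have "r \<in> vec.span B" for r
    proof -
      have "r - (\<Sum>i\<in>I. cform r (v i) *s l i) \<in> W"
      proof -
        have "cform (r - s) w = cform r w - cform s w" for r s w :: "complex^'d"
          by (simp add: cform_def algebra_simps sum_subtractf)
        then show ?thesis by (simp add: W_def sumI)
      qed
      then have 1: "r - (\<Sum>i\<in>I. cform r (v i) *s l i) \<in> vec.span B" using B by blast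
      have 2: "(\<Sum>i\<in>I. cform r (v i) *s l i) \<in> vec.span B"
        using B(4) by (intro vec.span_sum vec.span_scale) blast
      show ?thesis using vec.span_add[OF 1 2] by simp
    qed
    then show ?thesis by blast
  qed
  have "card B = CARD('d)"
    using vec.dim_eq_card_independent[OF B(3)] vec.dim_span[of B] span by (simp add: vec.dim_UNIV card_cart_basis)
  then obtain f :: "'d \<Rightarrow> complex^'d" where f: "bij_betw f UNIV B"
    using vec.finiteI_independent[OF B(3)] by (metis finite finite_same_card_bij)
  define P :: "complex^'d^'d" where "P = (\<chi> j. f j)"
  have "rows P = B" using f by (auto simp: rows_def row_def P_def bij_betw_def)
  then have "\<exists>Q. Q ** P = mat 1" using span by (simp add: matrix_left_invertible_span_rows_gen)
  then have inv: "invertible P" using matrix_left_right_inverse unfolding invertible_def by metis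
  define \<iota> where "\<iota> i = inv_into UNIV f (l i)" for i
  have fi: "f (\<iota> i) = l i" if "i \<in> I" for i
    using f B(1) that unfolding \<iota>_def bij_betw_def by (intro f_inv_into_f) blast
  show thesis
  proof (rule that[OF inv])
    show "inj_on \<iota> I" using fi l_inj by (metis inj_on_def)
    show "P $ \<iota> i = l i" if "i \<in> I" for i using fi[OF that] by (simp add: P_def)
    show "cform (P $ j) (v i) = (if j = \<iota> i then 1 else 0)" if i: "i \<in> I" for i j
    proof -
      have "f j \<in> l ` I \<union> W" using f B(2) bij_betwE by blast
      then show ?thesis
      proof
        assume "f j \<in> l ` I"
        then obtain k where k: "k \<in> I" "f j = l k" by blast
        then have "f j = f (\<iota> k)" using fi by simp
        then have jk: "j = \<iota> k" using f by (metis bij_betw_imp_inj_on injD)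
        have "(j = \<iota> i) \<longleftrightarrow> k = i" using jk fi k(1) i l_inj by (metis inj_on_def)
        then show ?thesis using dual[OF k(1) i] k by (simp add: P_def)
      next
        assume W: "f j \<in> W"
        then have "j \<noteq> \<iota> i" using fi[OF i] dual[OF i i] i by (auto simp: W_def)
        then show ?thesis using W i by (simp add: P_def W_def)
      qed
    qed
  qed
qed

text \<open>The generator \<open>a H\<close> is \<open>z \<mapsto> z - (1 - \<mu> H) l_H(z)
  v_H\<close> with \<open>l_H(v_H) = 1\<close>. Commutativity forces \<open>l_K(v_H) = 0\<close> for
  \<open>H \<noteq> K\<close>, so forms and vectors are biorthogonal and the forms extend to
  coordinates in which \<open>a H\<close> multiplies the coordinate number \<open>\<iota> H\<close>
  by \<open>\<mu> H\<close>. The coordinates that belong to no hyperplane get \<open>m =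
  1\<close>.\<close>

theorem abelian_reflection_group_diagonal:
  fixes G :: "(complex^'d^'d) set"
    and L :: "(complex^'d) set \<Rightarrow> complex^'d \<Rightarrow> complex"
    and a :: "(complex^'d) set \<Rightarrow> complex^'d^'d"
  assumes refl: "finite_reflection_group G" and comm: "comm_group (GL\<lparr>carrier := G\<rparr>)"
    and L: "\<And>H. H \<in> hyperplanes G \<Longrightarrow> Vector_Spaces.linear (*s) (*) (L H) \<and> {z. L H z = 0} = H"
    and a: "\<And>H. H \<in> hyperplanes G \<Longrightarrow> a H \<in> fixer G H \<and> generate GL {a H} = fixer G H"
  obtains P Q m \<iota> \<mu> where "diagonal_group P Q m" "G = diagonal_group.G P Q m"
    "inj_on \<iota> (hyperplanes G)" "\<And>H z. H \<in> hyperplanes G \<Longrightarrow> L H z = (P *v z) $ \<iota> H"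
    "\<And>j. j \<notin> \<iota> ` hyperplanes G \<Longrightarrow> m j = 1"
    "\<And>H. H \<in> hyperplanes G \<Longrightarrow> a H = diagonal_group.D P Q (\<chi> j. if j = \<iota> H then \<mu> H else 1)"
    "\<And>H k. H \<in> hyperplanes G \<Longrightarrow> \<mu> H ^ k = 1 \<longleftrightarrow> m (\<iota> H) dvd k"
proof -
  let ?H = "hyperplanes G"
  interpret GL: group "GL :: (complex^'d^'d) monoid" by (rule group_GL)
  have fin: "finite G" and sub: "subgroup G GL" and gen: "generate GL {\<sigma>\<in>G. complex_reflection \<sigma>} = G"
    using refl by (auto simp: finite_reflection_group_def)
  have finH: "finite ?H" using fin by (simp add: hyperplanes_def)
  have invG: "invertible \<sigma>" if "\<sigma> \<in> G" for \<sigma>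
    using subgroup.mem_carrier[OF sub that] by (simp add: GL_def)
  have multG: "\<sigma> ** \<tau> \<in> G" if "\<sigma> \<in> G" "\<tau> \<in> G" for \<sigma> \<tau>
    using subgroup.m_closed[OF sub that] by (simp add: GL_def)
  have oneG: "mat 1 \<in> G" using subgroup.one_closed[OF sub] by (simp add: GL_def)
  have powG: "(((**) \<sigma>) ^^ n) (mat 1) \<in> G" if "\<sigma> \<in> G" for \<sigma> n
    by (induction n) (auto intro: multG that oneG)
  define l where "l H = (SOME l. L H = cform l)" for H
  have l: "L H = cform (l H)" if "H \<in> ?H" for H
    unfolding l_def by (rule someI_ex) (use L[OF that] linear_iff_cform in blast)
  have Hl: "z \<in> H \<longleftrightarrow> cform (l H) z = 0" if "H \<in> ?H" for H z
    using L[OF that] l[OF that] by auto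
  have l0: "l H \<noteq> 0" if H: "H \<in> ?H" for H
  proof
    assume "l H = 0"
    then have U: "H = UNIV" using Hl[OF H] by (auto simp: cform_def)
    obtain \<sigma> where \<sigma>: "complex_reflection \<sigma>" "H = {z. (mat 1 - \<sigma>) *v z = 0}"
      using H by (auto simp: hyperplanes_def)
    have "(mat 1 - \<sigma>) *v z = 0 *v z" for z using \<sigma>(2) U by auto
    then have "mat 1 - \<sigma> = 0" by (subst matrix_eq) blast
    then have "rank (mat 1 - \<sigma>) = 0" by (simp only: rank_zero)
    then show False using \<sigma>(1) by (simp add: complex_reflection_def)
  qed
  have reflection_in_fixer: "\<sigma> \<in> fixer G {z. (mat 1 - \<sigma>) *v z = 0}" if "\<sigma> \<in> G" for \<sigma>
    using that by (auto simp: fixer_def act_fixes_iff[OF invG[OF that]] matrix_vector_mult_diff_rdistrib)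
  have aG: "a H \<in> G" and a_fix: "\<And>z. z \<in> H \<Longrightarrow> a H *v z = z" if H: "H \<in> ?H" for H
    using a[OF H] act_fixes_iff[OF invG] by (auto simp: fixer_def)
  have a1: "a H \<noteq> mat 1" if H: "H \<in> ?H" for H
  proof
    assume "a H = mat 1"
    then have "fixer G H = {mat 1}" using a[OF H] GL.generate_one by (simp add: GL_def)
    moreover obtain \<sigma> where \<sigma>: "\<sigma> \<in> G" "complex_reflection \<sigma>" "H = {z. (mat 1 - \<sigma>) *v z = 0}"
      using H by (auto simp: hyperplanes_def)
    ultimately have "\<sigma> = mat 1" using reflection_in_fixer by blast
    then have "rank (mat 1 - \<sigma>) = 0" by (simp add: rank_zero)
    then show False using \<sigma>(2) by (simp add: complex_reflection_def)
  qed
  have "\<exists>u. u \<noteq> 0 \<and> (\<forall>z. a H *v z = z - cform (l H) z *s u)" if H: "H \<in> ?H" for H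
  proof -
    obtain i where i: "l H $ i \<noteq> 0" using l0[OF H] by (auto simp: vec_eq_iff)
    define e :: "complex^'d" where "e = axis i (1 / l H $ i)"
    have e: "cform (l H) e = 1" using i by (simp add: e_def cform_axis)
    define u where "u = e - a H *v e"
    have form: "a H *v z = z - cform (l H) z *s u" for z
    proof -
      have "z - cform (l H) z *s e \<in> H" by (simp add: Hl[OF H] cform_diff cform_scale e)
      from a_fix[OF H this] have "a H *v z - cform (l H) z *s (a H *v e) = z - cform (l H) z *s e"
        by (simp only: matrix_vector_mult_diff_distrib vector_scalar_commute)
      then show ?thesis by (simp add: u_def vec_eq_iff algebra_simps)
    qed
    moreover have "u \<noteq> 0"
    proof
      assume "u = 0"
      then have "a H *v z = mat 1 *v z" for z using form by simp
      then show False using a1[OF H] matrix_eq by blast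
    qed
    ultimately show ?thesis by blast
  qed
  then obtain u where u0: "\<And>H. H \<in> ?H \<Longrightarrow> u H \<noteq> 0"
    and a_form: "\<And>H z. H \<in> ?H \<Longrightarrow> a H *v z = z - cform (l H) z *s u H" by metis
  define \<mu> where "\<mu> H = 1 - cform (l H) (u H)" for H
  have \<mu>1: "\<mu> H \<noteq> 1" and \<mu>_ord: "\<exists>k>0. \<mu> H ^ k = 1" if H: "H \<in> ?H" for H
    using rank_one_perturbation_finite_order[OF a_form[OF H] invG[OF aG[OF H]] l0[OF H] u0[OF H] fin powG[OF aG[OF H]]]
    by (simp_all add: \<mu>_def)
  define v where "v H = (1 / (1 - \<mu> H)) *s u H" for H
  have lv: "cform (l H) (v H) = 1" if "H \<in> ?H" for H
    using \<mu>1[OF that] by (simp add: v_def cform_scale \<mu>_def)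
  have a_v: "a H *v z = z - ((1 - \<mu> H) * cform (l H) z) *s v H" if "H \<in> ?H" for H z
    using \<mu>1[OF that] by (simp add: a_form[OF that] v_def vec_eq_iff)
  have v0: "v H \<noteq> 0" if "H \<in> ?H" for H using lv[OF that] by auto
  have orth: "cform (l K) (v H) = 0" if H: "H \<in> ?H" and K: "K \<in> ?H" and HK: "H \<noteq> K" for H K
  proof (rule ccontr)
    assume nz: "cform (l K) (v H) \<noteq> 0"
    \<comment> \<open>Two hyperplanes one of which contains the other are equal; here the
      inclusion is turned around with the help of the vector \<open>v K\<close>, which is
      transversal to \<open>K\<close>.\<close>
    have "\<exists>z. z \<in> K \<and> z \<notin> H"
    proof (rule ccontr)
      assume "\<nexists>z. z \<in> K \<and> z \<notin> H"
      then have KH: "K \<subseteq> H" by blast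
      have "z \<in> K" if "z \<in> H" for z
      proof -
        have "z - cform (l K) z *s v K \<in> K" by (simp add: Hl[OF K] cform_diff cform_scale lv[OF K])
        then have "cform (l H) (z - cform (l K) z *s v K) = 0" using KH Hl[OF H] by blast
        then have "cform (l K) z * cform (l H) (v K) = 0"
          using that Hl[OF H] by (simp add: cform_diff cform_scale)
        moreover have "cform (l H) (v K) \<noteq> 0"
        proof
          assume "cform (l H) (v K) = 0"
          then have vK: "v K \<in> H" using Hl[OF H] by blast
          have "v H - cform (l K) (v H) *s v K \<in> K" by (simp add: Hl[OF K] cform_diff cform_scale lv[OF K])
          then have "cform (l H) (v H - cform (l K) (v H) *s v K) = 0" using KH Hl[OF H] by blast
          then show False using vK Hl[OF H] lv[OF H] by (simp add: cform_diff cform_scale)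
        qed
        ultimately show ?thesis using Hl[OF K] by simp
      qed
      then show False using KH HK by blast
    qed
    then obtain z where z: "cform (l K) z = 0" "cform (l H) z \<noteq> 0" using Hl[OF H] Hl[OF K] by blast
    \<comment> \<open>At a point of \<open>K\<close> off \<open>H\<close> the two products differ
      by a multiple of \<open>v K\<close> in which \<open>l K (v H)\<close> is the only factor that
      can vanish.\<close>
    have "a H ** a K = a K ** a H"
      using comm_groupE(4)[OF comm, of "a H" "a K"] aG[OF H] aG[OF K] by (simp add: GL_def)
    then have "a H *v (a K *v z) = a K *v (a H *v z)" by (simp add: matrix_vector_mul_assoc)
    then have "((1 - \<mu> K) * ((1 - \<mu> H) * cform (l H) z * cform (l K) (v H))) *s v K = 0"
      by (simp add: a_v[OF H] a_v[OF K] z cform_diff cform_scale)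
    then show False using v0[OF K] \<mu>1[OF H] \<mu>1[OF K] z nz by simp
  qed
  have dual: "cform (l H) (v K) = (if H = K then 1 else 0)" if "H \<in> ?H" "K \<in> ?H" for H K
    using lv orth that by simp
  obtain P :: "complex^'d^'d" and \<iota> where P: "invertible P" "inj_on \<iota> ?H" "\<And>H. H \<in> ?H \<Longrightarrow> P $ \<iota> H = l H"
    "\<And>H j. H \<in> ?H \<Longrightarrow> cform (P $ j) (v H) = (if j = \<iota> H then 1 else 0)"
  proof (rule basis_with_dual_vectors[OF finH dual])
    fix P :: "complex^'d^'d" and \<iota>
    assume A: "invertible P" "inj_on \<iota> ?H" "\<And>H. H \<in> ?H \<Longrightarrow> P $ \<iota> H = l H"
      "\<And>H j. H \<in> ?H \<Longrightarrow> cform (P $ j) (v H) = (if j = \<iota> H then 1 else 0)"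
    show thesis by (rule that[OF A])
  qed
  define Q where "Q = matrix_inv P"
  define m where "m j = (if j \<in> \<iota> ` ?H then mult_order (\<mu> (inv_into ?H \<iota> j)) else 1)" for j
  have m_\<iota>: "m (\<iota> H) = mult_order (\<mu> H)" if "H \<in> ?H" for H
    using that P(2) by (simp add: m_def)
  interpret dg: diagonal_group P Q m
  proof
    show "P ** Q = mat 1" "Q ** P = mat 1" using matrix_inv_works[OF P(1)] by (simp_all add: Q_def)
    show "m j > 0" for j
    proof (cases "j \<in> \<iota> ` ?H")
      case True
      then show ?thesis using m_\<iota> mult_order(1)[OF \<mu>_ord] by auto
    qed (simp add: m_def)
  qed
  have y_nth: "dg.y z $ j = cform (P $ j) z" for z j
    by (simp add: dg.y_def matrix_vector_mult_def cform_def)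
  have a_D: "a H = dg.D (\<chi> j. if j = \<iota> H then \<mu> H else 1)" if H: "H \<in> ?H" for H
  proof (rule dg.D_eqI)
    fix z
    show "dg.y (a H *v z) = (\<chi> j. if j = \<iota> H then \<mu> H else 1) * dg.y z"
    proof (subst vec_eq_iff, rule allI)
      fix j
      show "dg.y (a H *v z) $ j = ((\<chi> j. if j = \<iota> H then \<mu> H else 1) * dg.y z) $ j"
        unfolding y_nth a_v[OF H] cform_diff cform_scale P(4)[OF H] vector_mult_component
        by (simp add: y_nth P(3)[OF H]) (simp add: algebra_simps)
    qed
  qed
  have \<mu>_Z: "(\<chi> j. if j = \<iota> H then \<mu> H else 1) \<in> dg.Z" if H: "H \<in> ?H" for H
    using mult_order(2)[OF \<mu>_ord[OF H]] m_\<iota>[OF H] by (auto simp: dg.Z_def)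
  have subD: "subgroup (dg.D ` dg.Z) GL"
  proof (rule subgroup.intro)
    show "dg.D ` dg.Z \<subseteq> carrier GL"
    proof
      fix A assume "A \<in> dg.D ` dg.Z"
      then obtain \<zeta> where \<zeta>: "\<zeta> \<in> dg.Z" "A = dg.D \<zeta>" by blast
      have "A ** dg.D (dg.conjv \<zeta>) = mat 1" "dg.D (dg.conjv \<zeta>) ** A = mat 1"
        using \<zeta> by (simp_all add: dg.D_mult dg.Z_conj dg.Z_conj' dg.D_one)
      then show "A \<in> carrier GL" by (auto simp: GL_def invertible_def)
    qed
    show "A \<otimes>\<^bsub>GL\<^esub> B \<in> dg.D ` dg.Z" if "A \<in> dg.D ` dg.Z" "B \<in> dg.D ` dg.Z" for A B
      using that by (auto simp: GL_def dg.D_mult intro: dg.Z_mult)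
    have "\<one>\<^bsub>GL\<^esub> = dg.D 1" by (simp add: GL_def dg.D_one)
    then show "\<one>\<^bsub>GL\<^esub> \<in> dg.D ` dg.Z" using dg.Z_one by blast
    fix A assume "A \<in> dg.D ` dg.Z"
    then obtain \<zeta> where \<zeta>: "\<zeta> \<in> dg.Z" "A = dg.D \<zeta>" by blast
    have AB: "A ** dg.D (dg.conjv \<zeta>) = mat 1" "dg.D (dg.conjv \<zeta>) ** A = mat 1"
      using \<zeta> by (simp_all add: dg.D_mult dg.Z_conj dg.Z_conj' dg.D_one)
    then have "inv\<^bsub>GL\<^esub> A = dg.D (dg.conjv \<zeta>)"
      by (intro GL.inv_equality) (auto simp: GL_def invertible_def)
    then show "inv\<^bsub>GL\<^esub> A \<in> dg.D ` dg.Z" using \<zeta> dg.conjv_Z by blast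
  qed
  have "G \<subseteq> dg.D ` dg.Z"
  proof -
    have "{\<sigma>\<in>G. complex_reflection \<sigma>} \<subseteq> dg.D ` dg.Z"
    proof
      fix \<sigma> assume \<sigma>: "\<sigma> \<in> {\<sigma>\<in>G. complex_reflection \<sigma>}"
      define H where "H = {z. (mat 1 - \<sigma>) *v z = 0}"
      have H: "H \<in> ?H" using \<sigma> by (auto simp: hyperplanes_def H_def)
      have "\<sigma> \<in> generate GL {a H}" using a[OF H] reflection_in_fixer \<sigma> by (auto simp: H_def)
      moreover have "generate GL {a H} \<subseteq> dg.D ` dg.Z"
        by (rule GL.generate_subgroup_incl[OF _ subD]) (use a_D[OF H] \<mu>_Z[OF H] in blast)
      ultimately show "\<sigma> \<in> dg.D ` dg.Z" by blast
    qed
    from GL.generate_subgroup_incl[OF this subD] show ?thesis by (simp add: gen)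
  qed
  moreover have "dg.D ` dg.Z \<subseteq> G"
  proof
    fix A assume "A \<in> dg.D ` dg.Z"
    then obtain \<zeta> where \<zeta>: "\<zeta> \<in> dg.Z" "A = dg.D \<zeta>" by blast
    \<comment> \<open>The element is built up one hyperplane at a time: \<open>\<zeta> $ \<iota>
      H\<close> is a power of the primitive root \<open>\<mu> H\<close>.\<close>
    have "dg.D (\<chi> j. if j \<in> \<iota> ` K then \<zeta> $ j else 1) \<in> G" if "K \<subseteq> ?H" for K
      using finite_subset[OF that finH] that
    proof (induction K rule: finite_induct)
      case empty
      have "(\<chi> j. if j \<in> \<iota> ` {} then \<zeta> $ j else 1) = 1" by (simp add: vec_eq_iff)
      then show ?case using oneG by (simp only: dg.D_one)
    next
      case (insert H K)
      have H: "H \<in> ?H" using insert by simp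
      have "\<zeta> $ \<iota> H ^ mult_order (\<mu> H) = 1" using \<zeta>(1) m_\<iota>[OF H] by (auto simp: dg.Z_def dest: spec[of _ "\<iota> H"])
      then obtain k where k: "\<zeta> $ \<iota> H = \<mu> H ^ k" using mult_order(4)[OF \<mu>_ord[OF H]] by blast
      have pw: "(((**) (a H)) ^^ n) (mat 1) = dg.D (\<chi> j. if j = \<iota> H then \<mu> H ^ n else 1)" for n
      proof (induction n)
        case 0
        have "(\<chi> j. if j = \<iota> H then \<mu> H ^ 0 else 1) = 1" by (simp add: vec_eq_iff)
        then show ?case by (simp add: dg.D_one)
      next
        case (Suc n)
        then show ?case
          by (simp add: a_D[OF H] dg.D_mult) (rule arg_cong[where f = dg.D], simp add: vec_eq_iff)
      qed
      have "\<iota> H \<notin> \<iota> ` K" using insert P(2) by (auto simp: inj_on_def)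
      then have "(\<chi> j. if j \<in> \<iota> ` insert H K then \<zeta> $ j else 1)
         = (\<chi> j. if j = \<iota> H then \<mu> H ^ k else 1) * (\<chi> j. if j \<in> \<iota> ` K then \<zeta> $ j else 1)"
        by (auto simp: vec_eq_iff k)
      then have eq: "dg.D (\<chi> j. if j \<in> \<iota> ` insert H K then \<zeta> $ j else 1)
         = (((**) (a H)) ^^ k) (mat 1) ** dg.D (\<chi> j. if j \<in> \<iota> ` K then \<zeta> $ j else 1)"
        by (simp only: pw dg.D_mult)
      have mem: "dg.D (\<chi> j. if j \<in> \<iota> ` K then \<zeta> $ j else 1) \<in> G" using insert by simp
      show ?case unfolding eq by (rule multG[OF powG[OF aG[OF H]] mem])
    qed
    from this[OF subset_refl] have "dg.D (\<chi> j. if j \<in> \<iota> ` ?H then \<zeta> $ j else 1) \<in> G" .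
    moreover have "(\<chi> j. if j \<in> \<iota> ` ?H then \<zeta> $ j else 1) = \<zeta>"
    proof -
      have "\<zeta> $ j = 1" if "j \<notin> \<iota> ` ?H" for j
      proof -
        have "\<zeta> $ j ^ m j = 1" using \<zeta>(1) by (simp add: dg.Z_def)
        moreover have "m j = 1" using that by (simp only: m_def if_False)
        ultimately show ?thesis by simp
      qed
      then show ?thesis by (simp add: vec_eq_iff)
    qed
    ultimately show "A \<in> G" using \<zeta>(2) by simp
  qed
  ultimately have "G = dg.G" by (auto simp: dg.G_def)
  with dg.diagonal_group_axioms show thesis
  proof (rule that[where P = P and Q = Q and m = m and \<iota> = \<iota> and \<mu> = \<mu>])
    show "inj_on \<iota> ?H" by (rule P(2))
    show "L H z = (P *v z) $ \<iota> H" if "H \<in> ?H" for H z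
      using y_nth[of z "\<iota> H"] by (simp add: dg.y_def l[OF that] P(3)[OF that])
    show "m j = 1" if "j \<notin> \<iota> ` ?H" for j using that by (simp only: m_def if_False)
    show "\<mu> H ^ k = 1 \<longleftrightarrow> m (\<iota> H) dvd k" if "H \<in> ?H" for H k
      using mult_order(3)[OF \<mu>_ord[OF that]] m_\<iota>[OF that] by simp
  qed (rule a_D)
qed

section \<open>Polynomial functions\<close>

lemma polynomials_monomial: "monomial_fun \<alpha> \<in> polynomials"
  unfolding polynomials_def by (intro CollectI exI[of _ "{\<alpha>}"] exI[of _ "\<lambda>_. 1"]) auto

lemma polynomialsI:
  assumes "finite S" "\<And>z. p z = (\<Sum>\<alpha>\<in>S. c \<alpha> * monomial_fun \<alpha> z)"
  shows "p \<in> polynomials"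
  unfolding polynomials_def using assms by (intro CollectI exI[of _ S] exI[of _ c]) auto

lemma polynomials_scale:
  assumes "p \<in> polynomials" shows "(\<lambda>z. k * p z) \<in> polynomials"
proof -
  obtain S c where p: "p = (\<lambda>z. \<Sum>\<alpha>\<in>S. c \<alpha> * monomial_fun \<alpha> z)" "finite S"
    using assms unfolding polynomials_def by blast
  show ?thesis
    by (rule polynomialsI[OF p(2), of _ "\<lambda>\<alpha>. k * c \<alpha>"]) (simp add: p(1) sum_distrib_left mult.assoc)
qed

lemma polynomials_add:
  assumes "p \<in> polynomials" "q \<in> polynomials" shows "(\<lambda>z. p z + q z) \<in> polynomials"
proof -
  obtain S c where p: "p = (\<lambda>z. \<Sum>\<alpha>\<in>S. c \<alpha> * monomial_fun \<alpha> z)" "finite S"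
    using assms unfolding polynomials_def by blast
  obtain T d where q: "q = (\<lambda>z. \<Sum>\<alpha>\<in>T. d \<alpha> * monomial_fun \<alpha> z)" "finite T"
    using assms unfolding polynomials_def by blast
  define e where "e \<alpha> = (if \<alpha> \<in> S then c \<alpha> else 0) + (if \<alpha> \<in> T then d \<alpha> else 0)" for \<alpha>
  have "p z + q z = (\<Sum>\<alpha>\<in>S \<union> T. e \<alpha> * monomial_fun \<alpha> z)" for z
  proof -
    have "p z = (\<Sum>\<alpha>\<in>S \<union> T. (if \<alpha> \<in> S then c \<alpha> else 0) * monomial_fun \<alpha> z)"
      unfolding p(1) using p(2) q(2) by (intro sum.mono_neutral_cong_left) auto
    moreover have "q z = (\<Sum>\<alpha>\<in>S \<union> T. (if \<alpha> \<in> T then d \<alpha> else 0) * monomial_fun \<alpha> z)"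
      unfolding q(1) using p(2) q(2) by (intro sum.mono_neutral_cong_left) auto
    ultimately show ?thesis by (simp add: e_def distrib_right sum.distrib)
  qed
  then show ?thesis using p(2) q(2) by (intro polynomialsI[of "S \<union> T"]) auto
qed

lemma polynomials_const: "(\<lambda>z. k) \<in> polynomials"
  by (rule polynomialsI[of "{\<lambda>_. 0}" _ "\<lambda>_. k"]) (simp_all add: monomial_fun_def)

lemma polynomials_coord: "(\<lambda>z :: complex^'d. z $ i) \<in> polynomials"
proof -
  have "(\<lambda>z :: complex^'d. z $ i) = monomial_fun (\<lambda>j. if j = i then 1 else 0)"
  proof
    fix z :: "complex^'d"
    have "monomial_fun (\<lambda>j. if j = i then 1 else 0) z = (\<Prod>j\<in>UNIV. if j = i then z $ j else 1)"
      unfolding monomial_fun_def by (rule prod.cong) auto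
    then show "z $ i = monomial_fun (\<lambda>j. if j = i then 1 else 0) z" by simp
  qed
  then show ?thesis by (rule ssubst) (rule polynomials_monomial)
qed

lemma polynomials_sum: "(\<And>i. i \<in> I \<Longrightarrow> f i \<in> polynomials) \<Longrightarrow> (\<lambda>z. \<Sum>i\<in>I. f i z) \<in> polynomials"
  by (induction I rule: infinite_finite_induct) (simp_all add: polynomials_const polynomials_add)

lemma polynomials_mult:
  assumes "p \<in> polynomials" "q \<in> polynomials" shows "(\<lambda>z. p z * q z) \<in> polynomials"
proof -
  obtain S c where p: "p = (\<lambda>z. \<Sum>\<alpha>\<in>S. c \<alpha> * monomial_fun \<alpha> z)" "finite S"
    using assms unfolding polynomials_def by blast
  obtain T d where q: "q = (\<lambda>z. \<Sum>\<alpha>\<in>T. d \<alpha> * monomial_fun \<alpha> z)" "finite T"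
    using assms unfolding polynomials_def by blast
  have mm: "monomial_fun \<alpha> z * monomial_fun \<beta> z = monomial_fun (\<lambda>i. \<alpha> i + \<beta> i) z" for \<alpha> \<beta> and z :: "complex^'a"
    by (simp add: monomial_fun_def power_add prod.distrib)
  have "(\<lambda>z. p z * q z) = (\<lambda>z. \<Sum>\<alpha>\<in>S. \<Sum>\<beta>\<in>T. (c \<alpha> * d \<beta>) * monomial_fun (\<lambda>i. \<alpha> i + \<beta> i) z)"
    by (simp add: p q sum_product mm[symmetric] mult_ac)
  then show ?thesis
    by (simp only:) (intro polynomials_sum polynomials_scale polynomials_monomial)
qed

lemma polynomials_power: "p \<in> polynomials \<Longrightarrow> (\<lambda>z. p z ^ n) \<in> polynomials"
  by (induction n) (simp_all add: polynomials_const polynomials_mult)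

lemma polynomials_prod: "(\<And>i. i \<in> I \<Longrightarrow> f i \<in> polynomials) \<Longrightarrow> (\<lambda>z. \<Prod>i\<in>I. f i z) \<in> polynomials"
  by (induction I rule: infinite_finite_induct) (simp_all add: polynomials_const polynomials_mult)

lemma polynomials_compose:
  fixes F :: "complex^'d \<Rightarrow> complex^'e"
  assumes "p \<in> polynomials" "\<And>i. (\<lambda>z. F z $ i) \<in> polynomials"
  shows "(\<lambda>z. p (F z)) \<in> polynomials"
proof -
  obtain S c where p: "p = (\<lambda>z. \<Sum>\<alpha>\<in>S. c \<alpha> * monomial_fun \<alpha> z)" "finite S"
    using assms unfolding polynomials_def by blast
  show ?thesis
    unfolding p monomial_fun_def
    by (intro polynomials_sum polynomials_scale polynomials_prod polynomials_power assms(2))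
qed

lemma polynomials_linear: "(\<lambda>z. (A *v z) $ i) \<in> polynomials"
  unfolding matrix_vector_mult_def by (simp add: polynomials_sum polynomials_scale polynomials_coord)

lemma polynomials_holomorphic:
  assumes "p \<in> polynomials" shows "holomorphic_several p D"
proof -
  obtain S c where p: "p = (\<lambda>z. \<Sum>\<alpha>\<in>S. c \<alpha> * monomial_fun \<alpha> z)"
    using assms unfolding polynomials_def by blast
  have "holomorphic_several (\<lambda>z :: complex^'a. z $ i) D" for i
  proof -
    have "(\<lambda>z :: complex^'a. z $ i) = cform (axis i 1)"
      by (simp add: fun_eq_iff cform_def axis_def if_distrib[of "\<lambda>c. c * _"] cong: if_cong)
    then show ?thesis by (simp add: holomorphic_several_cform)
  qed
  then show ?thesis
    unfolding p monomial_fun_def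
    by (intro holomorphic_several_sum holomorphic_several_mult holomorphic_several_const
        holomorphic_several_prod holomorphic_several_power)
qed

lemma polynomial_map_derivative:
  fixes F :: "complex^'d \<Rightarrow> complex^'e"
  assumes "\<And>i. (\<lambda>z. F z $ i) \<in> polynomials"
  shows "\<exists>A. (F has_derivative (*v) A) (at z)"
proof -
  have "\<forall>i. \<exists>a. ((\<lambda>z. F z $ i) has_derivative cform a) (at z)"
    using polynomials_holomorphic[OF assms, of _ UNIV] unfolding holomorphic_several_iff by simp
  then obtain A where A: "\<And>i. ((\<lambda>z. F z $ i) has_derivative cform (A i)) (at z)"
    using choice[of "\<lambda>i a. ((\<lambda>z. F z $ i) has_derivative cform a) (at z)"] by blast
  have "(F has_derivative (*v) (\<chi> i. A i)) (at z)"
    by (rule has_derivative_matrix_of_components) (simp add: A)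
  then show ?thesis ..
qed

lemma polynomial_map_continuous:
  fixes F :: "complex^'d \<Rightarrow> complex^'e"
  assumes "\<And>i. (\<lambda>z. F z $ i) \<in> polynomials"
  shows "continuous_on S F"
proof (rule continuous_at_imp_continuous_on, rule ballI)
  fix z
  obtain A where "(F has_derivative (*v) A) (at z)" using polynomial_map_derivative[OF assms] by blast
  then show "isCont F z" by (rule has_derivative_continuous)
qed

section \<open>The quotient map\<close>

lemma ex_root:
  assumes "n > 0" shows "\<exists>w :: complex. w ^ n = u"
proof (cases "u = 0")
  case True
  then show ?thesis using assms by (intro exI[of _ 0]) simp
next
  case False
  have "exp (Ln u / of_nat n) ^ n = u"
    using False assms by (simp flip: exp_of_nat_mult)
  then show ?thesis ..
qed

text \<open>The open mapping theorem in one variable, stated so that it can be applied to all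
  coordinates at once.\<close>

lemma power_map_open:
  assumes "n > 0" "\<epsilon> > 0"
  shows "\<exists>\<delta>>0. \<forall>u. cmod (u - w0 ^ n) < \<delta> \<longrightarrow> (\<exists>w. w ^ n = u \<and> cmod (w - w0) < \<epsilon>)"
proof -
  have "open ((\<lambda>w :: complex. w ^ n) ` ball w0 \<epsilon>)"
  proof (rule open_mapping_thm[where S = UNIV])
    show "\<not> (\<lambda>w :: complex. w ^ n) constant_on UNIV"
    proof
      assume "(\<lambda>w :: complex. w ^ n) constant_on UNIV"
      then obtain c where c: "\<And>w :: complex. w ^ n = c" unfolding constant_on_def by auto
      show False using c[of 0] c[of 1] assms(1) by (simp add: zero_power)
    qed
  qed (auto intro!: holomorphic_intros)
  moreover have "w0 ^ n \<in> (\<lambda>w. w ^ n) ` ball w0 \<epsilon>" using assms(2) by simp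
  ultimately obtain \<delta> where "\<delta> > 0" "ball (w0 ^ n) \<delta> \<subseteq> (\<lambda>w. w ^ n) ` ball w0 \<epsilon>"
    using open_contains_ball by blast
  then show ?thesis
    by (intro exI[of _ \<delta>]) (force simp: subset_iff dist_norm norm_minus_commute image_iff)
qed

context diagonal_group
begin

definition \<pi> :: "complex^'d \<Rightarrow> complex^'d" where "\<pi> z = (\<chi> j. y z $ j ^ m j)"

lemma y_nth: "y z $ j = cform (P $ j) z"
  by (simp add: y_def matrix_vector_mult_def cform_def)

lemma row_P_nonzero: "P $ j \<noteq> 0"
proof
  assume "P $ j = 0"
  then have "y (Q *v 1) $ j = 0" by (simp add: y_nth cform_def)
  then show False by (simp add: yQ)
qed

lemma pi_polynomial: "(\<lambda>z. \<pi> z $ j) \<in> polynomials"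
  by (simp add: \<pi>_def y_def polynomials_power polynomials_linear)

lemma pi_D: "\<zeta> \<in> Z \<Longrightarrow> \<pi> (D \<zeta> *v z) = \<pi> z"
  by (simp add: \<pi>_def y_D power_mult_distrib Z_def)

lemma pi_eq_iff: "\<pi> z = \<pi> w \<longleftrightarrow> (\<exists>\<zeta>\<in>Z. w = D \<zeta> *v z)"
proof
  assume eq: "\<pi> z = \<pi> w"
  define \<zeta> :: "complex^'d" where "\<zeta> = (\<chi> j. if y z $ j = 0 then 1 else y w $ j / y z $ j)"
  have eqj: "y z $ j ^ m j = y w $ j ^ m j" for j
    using eq by (simp add: \<pi>_def vec_eq_iff)
  have "\<zeta> $ j ^ m j = 1" for j
  proof (cases "y z $ j = 0")
    case False
    then have "y z $ j ^ m j \<noteq> 0" by simp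
    then show ?thesis using False by (simp add: \<zeta>_def power_divide eqj)
  qed (simp add: \<zeta>_def)
  then have "\<zeta> \<in> Z" by (simp add: Z_def)
  moreover have "y w = \<zeta> * y z"
  proof -
    have "y w $ j = \<zeta> $ j * y z $ j" for j
      using eqj[of j] m_pos[of j] by (cases "y z $ j = 0") (simp_all add: \<zeta>_def power_0_left)
    then show ?thesis by (simp add: vec_eq_iff)
  qed
  ultimately show "\<exists>\<zeta>\<in>Z. w = D \<zeta> *v z" using y_inj y_D by metis
qed (use pi_D in auto)

lemma pi_surj: "\<exists>z. \<pi> z = t"
proof -
  have "\<forall>j. \<exists>w. w ^ m j = t $ j" using ex_root m_pos by blast
  then obtain w where "\<And>j. w j ^ m j = t $ j" using choice by metis
  then have "\<pi> (Q *v (\<chi> j. w j)) = t" by (simp add: \<pi>_def yQ vec_eq_iff)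
  then show ?thesis ..
qed

lemma continuous_linear_map: "continuous_on S ((*v) (A :: complex^'d^'d))"
  by (rule polynomial_map_continuous) (rule polynomials_linear)

lemma pi_open:
  assumes U: "open U" shows "open (\<pi> ` U)"
proof (rule openI)
  fix t assume "t \<in> \<pi> ` U"
  then obtain z where z: "z \<in> U" "t = \<pi> z" by blast
  have "open ((*v) Q -` U)"
    using continuous_linear_map[of UNIV Q] U by (simp add: open_vimage)
  moreover have "y z \<in> (*v) Q -` U" using z by (simp add: Qy)
  ultimately obtain r where r: "r > 0" "ball (y z) r \<subseteq> (*v) Q -` U"
    using open_contains_ball by blast
  define \<epsilon> where "\<epsilon> = r / (2 * real CARD('d))"
  have \<epsilon>: "\<epsilon> > 0" using r by (simp add: \<epsilon>_def)
  have "\<forall>j. \<exists>\<delta>>0. \<forall>u. cmod (u - y z $ j ^ m j) < \<delta> \<longrightarrow> (\<exists>w. w ^ m j = u \<and> cmod (w - y z $ j) < \<epsilon>)"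
    using power_map_open[OF m_pos \<epsilon>] by blast
  then obtain \<delta> where \<delta>: "\<And>j. \<delta> j > 0"
    "\<And>j u. cmod (u - y z $ j ^ m j) < \<delta> j \<Longrightarrow> \<exists>w. w ^ m j = u \<and> cmod (w - y z $ j) < \<epsilon>"
    by metis
  define d where "d = Min (range \<delta>)"
  have d: "d > 0" "\<And>j. d \<le> \<delta> j" using \<delta>(1) by (auto simp: d_def)
  have "ball t d \<subseteq> \<pi> ` U"
  proof
    fix s assume s: "s \<in> ball t d"
    have "cmod (s $ j - y z $ j ^ m j) < \<delta> j" for j
    proof -
      have "cmod ((s - t) $ j) \<le> norm (s - t)" by (rule Finite_Cartesian_Product.norm_nth_le)
      then show ?thesis using s d(2)[of j] by (simp add: z(2) \<pi>_def dist_norm norm_minus_commute)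
    qed
    then have "\<forall>j. \<exists>w. w ^ m j = s $ j \<and> cmod (w - y z $ j) < \<epsilon>" using \<delta>(2) by blast
    then obtain w where w: "\<And>j. w j ^ m j = s $ j" "\<And>j. cmod (w j - y z $ j) < \<epsilon>" by metis
    have "norm ((\<chi> j. w j) - y z) \<le> (\<Sum>j\<in>UNIV. cmod (w j - y z $ j))"
      unfolding norm_vec_def by (rule order_trans[OF L2_set_le_sum]) auto
    also have "\<dots> \<le> (\<Sum>j\<in>(UNIV :: 'd set). \<epsilon>)" using w(2) by (intro sum_mono) (simp add: less_imp_le)
    also have "\<dots> < r" using r by (simp add: \<epsilon>_def)
    finally have "(\<chi> j. w j) \<in> ball (y z) r" by (simp add: dist_norm norm_minus_commute)
    then have "Q *v (\<chi> j. w j) \<in> U" using r by blast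
    moreover have "\<pi> (Q *v (\<chi> j. w j)) = s" by (simp add: \<pi>_def yQ vec_eq_iff w(1))
    ultimately show "s \<in> \<pi> ` U" by blast
  qed
  then show "\<exists>e>0. ball t e \<subseteq> \<pi> ` U" using d(1) by blast
qed

text \<open>Averaging an invariant polynomial over the group leaves it unchanged and kills every
  monomial in \<open>y\<close> on which some group element acts nontrivially; the others have all
  exponents divisible by the \<open>m j\<close>.\<close>

lemma invariant_polynomial_factors:
  assumes p: "p \<in> polynomials" and inv: "\<And>\<zeta> z. \<zeta> \<in> Z \<Longrightarrow> p (D \<zeta> *v z) = p z"
  obtains \<phi> where "\<phi> \<in> polynomials" "\<And>z. p z = \<phi> (\<pi> z)"
proof -
  have "(\<lambda>u. p (Q *v u)) \<in> polynomials"
    by (rule polynomials_compose[OF p polynomials_linear])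
  then obtain S c where S: "finite S" "\<And>u. p (Q *v u) = (\<Sum>\<alpha>\<in>S. c \<alpha> * monomial_fun \<alpha> u)"
    unfolding polynomials_def by (auto simp: fun_eq_iff)
  define \<kappa> where "\<kappa> \<alpha> = (\<Sum>\<zeta>\<in>Z. monomial_fun \<alpha> \<zeta>) / of_nat (card Z)" for \<alpha>
  define \<phi> where "\<phi> t = (\<Sum>\<alpha>\<in>S. (c \<alpha> * \<kappa> \<alpha>) * monomial_fun (\<lambda>j. \<alpha> j div m j) t)" for t
  have dvd: "m j dvd \<alpha> j" if "\<kappa> \<alpha> \<noteq> 0" for \<alpha> j
  proof -
    have one: "monomial_fun \<alpha> \<eta> = 1" if \<eta>: "\<eta> \<in> Z" for \<eta>
    proof -
      have "(\<Sum>\<zeta>\<in>Z. monomial_fun \<alpha> \<zeta>) = (\<Sum>\<zeta>\<in>Z. monomial_fun \<alpha> (\<eta> * \<zeta>))"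
        using sum.reindex_bij_betw[OF bij_mult_Z[OF \<eta>], of "monomial_fun \<alpha>"] by simp
      also have "\<dots> = monomial_fun \<alpha> \<eta> * (\<Sum>\<zeta>\<in>Z. monomial_fun \<alpha> \<zeta>)" by (simp add: chi_mult sum_distrib_left)
      finally show ?thesis using \<open>\<kappa> \<alpha> \<noteq> 0\<close> by (simp add: \<kappa>_def)
    qed
    obtain w :: complex where w: "\<And>k. w ^ k = 1 \<longleftrightarrow> m j dvd k"
      using primitive_root_of_unity[OF m_pos] by blast
    define \<eta> :: "complex^'d" where "\<eta> = (\<chi> i. if i = j then w else 1)"
    have "\<eta> \<in> Z" using w[of "m j"] by (simp add: Z_def \<eta>_def)
    moreover have "monomial_fun \<alpha> \<eta> = w ^ \<alpha> j"
    proof -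
      have "monomial_fun \<alpha> \<eta> = (\<Prod>i\<in>UNIV. if i = j then w ^ \<alpha> i else 1)"
        unfolding monomial_fun_def \<eta>_def by (rule prod.cong) auto
      then show ?thesis by simp
    qed
    ultimately show ?thesis using one w by metis
  qed
  have mono: "monomial_fun \<alpha> (\<zeta> * u) = monomial_fun \<alpha> \<zeta> * monomial_fun \<alpha> u" for \<alpha> \<zeta> u
    by (simp add: monomial_fun_def monomial_fun_def power_mult_distrib prod.distrib)
  have cZ: "(of_nat (card Z) :: complex) \<noteq> 0" using card_Z_pos by simp
  have "p z = \<phi> (\<pi> z)" for z
  proof -
    have "of_nat (card Z) * p z = (\<Sum>\<zeta>\<in>Z. p (D \<zeta> *v z))" using inv by simp
    also have "\<dots> = (\<Sum>\<zeta>\<in>Z. p (Q *v (\<zeta> * y z)))" by (simp add: y_D[symmetric] Qy)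
    also have "\<dots> = (\<Sum>\<alpha>\<in>S. c \<alpha> * ((\<Sum>\<zeta>\<in>Z. monomial_fun \<alpha> \<zeta>) * monomial_fun \<alpha> (y z)))"
      unfolding S(2) by (subst sum.swap) (simp add: mono sum_distrib_left sum_distrib_right mult_ac)
    also have "\<dots> = (\<Sum>\<alpha>\<in>S. of_nat (card Z) * (c \<alpha> * \<kappa> \<alpha> * monomial_fun \<alpha> (y z)))"
      using cZ by (simp add: \<kappa>_def mult_ac)
    also have "\<dots> = of_nat (card Z) * (\<Sum>\<alpha>\<in>S. c \<alpha> * \<kappa> \<alpha> * monomial_fun \<alpha> (y z))"
      by (simp add: sum_distrib_left)
    finally have "p z = (\<Sum>\<alpha>\<in>S. c \<alpha> * \<kappa> \<alpha> * monomial_fun \<alpha> (y z))" using cZ by simp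
    also have "\<dots> = \<phi> (\<pi> z)"
      unfolding \<phi>_def
    proof (rule sum.cong[OF refl])
      fix \<alpha>
      show "c \<alpha> * \<kappa> \<alpha> * monomial_fun \<alpha> (y z) = c \<alpha> * \<kappa> \<alpha> * monomial_fun (\<lambda>j. \<alpha> j div m j) (\<pi> z)"
      proof (cases "\<kappa> \<alpha> = 0")
        case False
        have "monomial_fun (\<lambda>j. \<alpha> j div m j) (\<pi> z) = monomial_fun \<alpha> (y z)"
          using dvd[OF False] by (simp add: monomial_fun_def \<pi>_def power_mult[symmetric])
        then show ?thesis by simp
      qed simp
    qed
    finally show ?thesis .
  qed
  moreover have "\<phi> \<in> polynomials"
    unfolding \<phi>_def[abs_def] by (intro polynomials_sum polynomials_scale polynomials_monomial)
  ultimately show thesis using that by blast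
qed

end

locale basic_map = diagonal_group P Q m for P Q :: "complex^'d^'d" and m +
  fixes \<theta> :: "complex^'d \<Rightarrow> complex^'d"
  assumes basic: "basic_polynomial_map G \<theta>"
begin

lemma invariants: "{p\<in>polynomials. \<forall>\<zeta>\<in>Z. \<forall>z. p (D \<zeta> *v z) = p z} = {p \<circ> \<theta> | p. p \<in> polynomials}"
proof -
  have "(\<forall>\<sigma>\<in>G. \<forall>z. p (act \<sigma> z) = p z) \<longleftrightarrow> (\<forall>\<zeta>\<in>Z. \<forall>z. p (D \<zeta> *v z) = p z)" for p :: "complex^'d \<Rightarrow> complex"
  proof -
    have "(\<forall>\<sigma>\<in>G. \<forall>z. p (act \<sigma> z) = p z) \<longleftrightarrow> (\<forall>\<zeta>\<in>Z. \<forall>z. p (D (conjv \<zeta>) *v z) = p z)"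
      by (simp add: G_def act_D)
    also have "\<dots> \<longleftrightarrow> (\<forall>\<zeta>\<in>Z. \<forall>z. p (D \<zeta> *v z) = p z)" using conjv_Z conjv_conjv by metis
    finally show ?thesis .
  qed
  then show ?thesis using basic unfolding basic_polynomial_map_def by simp
qed

lemma theta_invariant_polynomial: "(\<lambda>z. \<theta> z $ i) \<in> polynomials"
    "\<zeta> \<in> Z \<Longrightarrow> \<theta> (D \<zeta> *v z) = \<theta> z"
proof -
  have *: "(\<lambda>z. \<theta> z $ i) \<in> {p\<in>polynomials. \<forall>\<zeta>\<in>Z. \<forall>z. p (D \<zeta> *v z) = p z}" for i
    unfolding invariants using polynomials_coord[of i] by (auto simp: o_def)
  then show "(\<lambda>z. \<theta> z $ i) \<in> polynomials" by simp
  show "\<theta> (D \<zeta> *v z) = \<theta> z" if "\<zeta> \<in> Z" using * that by (simp add: vec_eq_iff)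
qed

definition \<Phi> :: "complex^'d \<Rightarrow> complex^'d" where "\<Phi> t = \<theta> (SOME z. \<pi> z = t)"
definition \<Psi> :: "complex^'d \<Rightarrow> complex^'d" where "\<Psi> u = \<pi> (SOME z. \<theta> z = u)"

text \<open>The components of \<open>\<theta>\<close> are invariant, hence polynomials in
  \<open>\<pi>\<close>; those of \<open>\<pi>\<close> are invariant, hence polynomials in
  \<open>\<theta>\<close>. One composite of the two polynomial maps is the identity because
  \<open>\<pi>\<close> is surjective, the other one because \<open>\<theta>\<close> is algebraically
  independent.\<close>

lemma Phi_polynomial: "(\<lambda>t. \<Phi> t $ i) \<in> polynomials"
  and Psi_polynomial: "(\<lambda>u. \<Psi> u $ i) \<in> polynomials"
  and theta_eq_Phi: "\<theta> z = \<Phi> (\<pi> z)" and pi_eq_Psi: "\<pi> z = \<Psi> (\<theta> z)"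
  and Psi_Phi: "\<Psi> (\<Phi> t) = t" and Phi_Psi: "\<Phi> (\<Psi> u) = u"
proof -
  have "\<forall>i. \<exists>\<phi>. \<phi> \<in> polynomials \<and> (\<forall>z. \<theta> z $ i = \<phi> (\<pi> z))"
  proof
    fix i
    obtain \<phi> where "\<phi> \<in> polynomials" "\<And>z. \<theta> z $ i = \<phi> (\<pi> z)"
      using invariant_polynomial_factors[OF theta_invariant_polynomial(1)[of i]]
        theta_invariant_polynomial(2) by metis
    then show "\<exists>\<phi>. \<phi> \<in> polynomials \<and> (\<forall>z. \<theta> z $ i = \<phi> (\<pi> z))" by blast
  qed
  then obtain \<phi> where \<phi>: "\<And>i. \<phi> i \<in> polynomials" "\<And>i z. \<theta> z $ i = \<phi> i (\<pi> z)" by metis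
  have "\<forall>i. \<exists>\<psi>. \<psi> \<in> polynomials \<and> (\<forall>z. \<pi> z $ i = \<psi> (\<theta> z))"
  proof
    fix i
    have "(\<lambda>z. \<pi> z $ i) \<in> {p \<circ> \<theta> | p. p \<in> polynomials}"
      unfolding invariants[symmetric] using pi_polynomial pi_D by simp
    then show "\<exists>\<psi>. \<psi> \<in> polynomials \<and> (\<forall>z. \<pi> z $ i = \<psi> (\<theta> z))" by (auto simp: fun_eq_iff)
  qed
  then obtain \<psi> where \<psi>: "\<And>i. \<psi> i \<in> polynomials" "\<And>i z. \<pi> z $ i = \<psi> i (\<theta> z)" by metis
  define F where "F t = (\<chi> i. \<phi> i t)" for t
  define H where "H u = (\<chi> i. \<psi> i u)" for u
  have 1: "\<theta> z = F (\<pi> z)" "\<pi> z = H (\<theta> z)" for z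
    by (simp_all add: F_def H_def vec_eq_iff \<phi>(2)[symmetric] \<psi>(2)[symmetric])
  have polys: "(\<lambda>t. F t $ i) \<in> polynomials" "(\<lambda>u. H u $ i) \<in> polynomials" for i
    using \<phi>(1) \<psi>(1) by (simp_all add: F_def H_def)
  have 2: "H (F t) = t" for t using pi_surj[of t] 1 by metis
  have 3: "F (H u) = u" for u
  proof -
    have "F (H u) $ i = u $ i" for i
    proof -
      have poly: "(\<lambda>u. F (H u) $ i + (-1) * u $ i) \<in> polynomials"
        by (intro polynomials_add polynomials_scale polynomials_coord polynomials_compose[OF polys(1)] polys(2))
      have zero: "\<forall>z. F (H (\<theta> z)) $ i + (-1) * \<theta> z $ i = 0"
        by (simp add: 1(2)[symmetric] 1(1)[symmetric])
      have "algebraically_independent \<theta>"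
        by (rule conjunct1[OF conjunct2[OF basic[unfolded basic_polynomial_map_def]]])
      from mp[OF bspec[OF this[unfolded algebraically_independent_def] poly] zero]
      have "(\<lambda>u. F (H u) $ i + (-1) * u $ i) = (\<lambda>_. 0)" .
      from fun_cong[OF this, of u] show ?thesis by simp
    qed
    then show ?thesis by (simp add: vec_eq_iff)
  qed
  have theta_surj: "\<exists>z. \<theta> z = u" for u
  proof -
    obtain z where "\<pi> z = H u" using pi_surj by blast
    then have "\<theta> z = u" using 1(1)[of z] 3[of u] by simp
    then show ?thesis ..
  qed
  have F: "\<Phi> = F"
  proof
    fix t
    have "\<pi> (SOME z. \<pi> z = t) = t" using pi_surj by (rule someI_ex)
    then show "\<Phi> t = F t" unfolding \<Phi>_def 1(1) by simp
  qed
  have H: "\<Psi> = H"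
  proof
    fix u
    have "\<theta> (SOME z. \<theta> z = u) = u" using theta_surj by (rule someI_ex)
    then show "\<Psi> u = H u" unfolding \<Psi>_def 1(2) by simp
  qed
  show "(\<lambda>t. \<Phi> t $ i) \<in> polynomials" "(\<lambda>u. \<Psi> u $ i) \<in> polynomials"
    unfolding F H by (rule polys)+
  show "\<theta> z = \<Phi> (\<pi> z)" "\<pi> z = \<Psi> (\<theta> z)" unfolding F H by (rule 1)+
  show "\<Psi> (\<Phi> t) = t" "\<Phi> (\<Psi> u) = u" unfolding F H by (rule 2 3)+
qed

lemma theta_eq_iff: "\<theta> z = \<theta> w \<longleftrightarrow> (\<exists>\<zeta>\<in>Z. w = D \<zeta> *v z)"
proof -
  have "\<theta> z = \<theta> w \<longleftrightarrow> \<pi> z = \<pi> w"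
  proof
    assume "\<theta> z = \<theta> w" then show "\<pi> z = \<pi> w" by (simp only: pi_eq_Psi)
  next
    assume "\<pi> z = \<pi> w" then show "\<theta> z = \<theta> w" by (simp only: theta_eq_Phi)
  qed
  then show ?thesis by (simp only: pi_eq_iff)
qed

lemma theta_continuous: "continuous_on S \<theta>"
  by (rule polynomial_map_continuous) (rule theta_invariant_polynomial)

lemma theta_open:
  assumes U: "open U" shows "open (\<theta> ` U)"
proof -
  have "\<theta> ` U = \<Psi> -` (\<pi> ` U)"
  proof (intro equalityI subsetI)
    fix u assume "u \<in> \<theta> ` U" then show "u \<in> \<Psi> -` (\<pi> ` U)" by (auto simp: pi_eq_Psi[symmetric])
  next
    fix u assume "u \<in> \<Psi> -` (\<pi> ` U)"
    then obtain z where z: "z \<in> U" "\<Psi> u = \<pi> z" by auto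
    then have "\<theta> z = u" using theta_eq_Phi[of z] Phi_Psi[of u] by simp
    then show "u \<in> \<theta> ` U" using z by blast
  qed
  moreover have "open (\<Psi> -` (\<pi> ` U))"
    by (rule open_vimage[OF pi_open[OF U] polynomial_map_continuous[OF Psi_polynomial]])
  ultimately show ?thesis by simp
qed

text \<open>Being continuous and open, \<open>\<theta>\<close> is a topological quotient map onto
  the image of \<open>U\<close>.\<close>

lemma continuous_on_descend:
  fixes g :: "complex^'d \<Rightarrow> 'b :: topological_space"
  assumes U: "open U" and g: "continuous_on U (\<lambda>z. g (\<theta> z))"
  shows "continuous_on (\<theta> ` U) g"
proof (subst continuous_on_open_vimage[OF theta_open[OF U]], intro allI impI)
  fix B :: "'b set" assume B: "open B"
  have "open ((\<lambda>z. g (\<theta> z)) -` B \<inter> U)"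
    using g B continuous_on_open_vimage[OF U] by blast
  moreover have "g -` B \<inter> \<theta> ` U = \<theta> ` ((\<lambda>z. g (\<theta> z)) -` B \<inter> U)" by auto
  ultimately show "open (g -` B \<inter> \<theta> ` U)" using theta_open by simp
qed

end

section \<open>Division and descent of semi-invariant functions\<close>

lemma continuous_on_det:
  fixes A :: "'a :: topological_space \<Rightarrow> complex^'n^'n"
  assumes "\<And>i j. continuous_on S (\<lambda>x. A x $ i $ j)"
  shows "continuous_on S (\<lambda>x. det (A x))"
  unfolding det_def by (intro continuous_on_sum continuous_on_mult continuous_on_prod continuous_on_const assms)

lemma open_cform_nonzero: "open {z. cform l z \<noteq> 0}"
  by (intro open_Collect_neq linear_continuous_on bounded_linear_cform continuous_on_const)

lemma eq_if_eq_off_hyperplane: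
  fixes f g :: "complex^'d \<Rightarrow> complex"
  assumes U: "open U" and f: "continuous_on U f" and g: "continuous_on U g" and l: "l \<noteq> 0"
    and eq: "\<And>z. z \<in> U \<Longrightarrow> cform l z \<noteq> 0 \<Longrightarrow> f z = g z" and z: "z \<in> U"
  shows "f z = g z"
proof (cases "cform l z = 0")
  case False
  then show ?thesis using eq z by blast
next
  case True
  obtain i where i: "l $ i \<noteq> 0" using l by (auto simp: vec_eq_iff)
  define e :: "complex^'d" where "e = axis i (1 / l $ i)"
  have e: "cform l e = 1" using i by (simp add: e_def cform_axis)
  define X where "X n = z + inverse (real (Suc n)) *\<^sub>R e" for n
  have "X \<longlonglongrightarrow> z + 0 *\<^sub>R e" unfolding X_def by (intro tendsto_intros LIMSEQ_inverse_real_of_nat)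
  then have X: "X \<longlonglongrightarrow> z" by simp
  have "cform l (X n) \<noteq> 0" for n
    by (simp add: X_def scaleR_eq_vector_scale cform_add cform_scale True e del: of_nat_Suc)
  moreover have ev: "\<forall>\<^sub>F n in sequentially. X n \<in> U" using X U z topological_tendstoD by blast
  ultimately have "\<forall>\<^sub>F n in sequentially. f (X n) = g (X n)" using eq by (auto elim: eventually_mono)
  moreover have "(\<lambda>n. f (X n)) \<longlonglongrightarrow> f z" "(\<lambda>n. g (X n)) \<longlonglongrightarrow> g z"
    using continuous_on_tendsto_compose[OF f X z ev] continuous_on_tendsto_compose[OF g X z ev] by auto
  ultimately show ?thesis by (metis LIMSEQ_unique Lim_transform_eventually)
qed

context diagonal_group
begin

lemma holomorphic_compose_D:
  assumes f: "holomorphic_several f U" and inv: "\<And>z. z \<in> U \<Longrightarrow> D \<zeta> *v z \<in> U"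
  shows "holomorphic_several (\<lambda>z. f (D \<zeta> *v z)) U"
  by (rule holomorphic_several_compose[OF f])
     (use inv in \<open>auto intro: polynomials_holomorphic polynomials_linear\<close>)

text \<open>Induction on the degree of the monomial. If \<open>c j > 0\<close>, the element that
  multiplies \<open>y j\<close> by a primitive \<open>m j\<close>-th root of unity and fixes the
  hyperplane \<open>y j = 0\<close> pointwise multiplies \<open>f\<close> by a number different from
  1, because \<open>c j < m j\<close>. So \<open>f\<close> vanishes on this hyperplane and is
  divisible by \<open>y j\<close>; the quotient is semi-invariant with \<open>c j\<close> lowered by
  one, at first off the hyperplane and then by continuity everywhere.\<close>

lemma semi_invariant_divide:
  assumes U: "open U" "\<And>\<zeta> z. \<zeta> \<in> Z \<Longrightarrow> z \<in> U \<Longrightarrow> D \<zeta> *v z \<in> U"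
    and f: "holomorphic_several f U" and c: "c \<in> C"
    and semi: "\<And>\<zeta> z. \<zeta> \<in> Z \<Longrightarrow> z \<in> U \<Longrightarrow> f (D \<zeta> *v z) = monomial_fun c \<zeta> * f z"
  shows "\<exists>q. holomorphic_several q U \<and> (\<forall>z\<in>U. f z = monomial_fun c (y z) * q z)
    \<and> (\<forall>\<zeta>\<in>Z. \<forall>z\<in>U. q (D \<zeta> *v z) = q z)"
  using f c semi
proof (induction "\<Sum>j\<in>UNIV. c j" arbitrary: c f)
  case 0
  then have "c = (\<lambda>_. 0)" by auto
  then show ?case using 0 by (intro exI[of _ f]) (simp add: monomial_fun_def)
next
  case (Suc n)
  have "\<exists>j. c j > 0"
  proof (rule ccontr)
    assume "\<nexists>j. c j > 0"
    then have "(\<Sum>j\<in>UNIV. c j) = 0" by simp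
    then show False using Suc.hyps(2) by simp
  qed
  then obtain j where j: "c j > 0" ..
  obtain w :: complex where w: "\<And>k. w ^ k = 1 \<longleftrightarrow> m j dvd k"
    using primitive_root_of_unity[OF m_pos] by blast
  define \<eta> :: "complex^'d" where "\<eta> = (\<chi> i. if i = j then w else 1)"
  have \<eta>: "\<eta> \<in> Z" using w[of "m j"] by (simp add: Z_def \<eta>_def)
  have chi\<eta>: "monomial_fun c \<eta> = w ^ c j"
  proof -
    have "monomial_fun c \<eta> = (\<Prod>i\<in>UNIV. if i = j then w ^ c i else 1)"
      unfolding monomial_fun_def \<eta>_def by (rule prod.cong) auto
    then show ?thesis by simp
  qed
  have cj: "c j < m j" using Suc.prems(2) by (simp add: C_def)
  have wc: "w ^ c j \<noteq> 1" using w cj j by (auto dest: dvd_imp_le)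
  have zero: "f z = 0" if z: "z \<in> U" "cform (P $ j) z = 0" for z
  proof -
    have "D \<eta> *v z = z"
    proof (rule y_inj)
      have "y z $ j = 0" using z by (simp add: y_nth)
      then show "y (D \<eta> *v z) = y z" by (simp add: y_D vec_eq_iff \<eta>_def)
    qed
    then have "f z = w ^ c j * f z" using Suc.prems(3)[OF \<eta> z(1)] chi\<eta> by simp
    then show ?thesis using wc by simp
  qed
  obtain q where q: "holomorphic_several q U" "\<And>z. z \<in> U \<Longrightarrow> f z = cform (P $ j) z * q z"
    using holomorphic_several_divide_form[OF U(1) Suc.prems(1) row_P_nonzero zero] by blast
  define c' where "c' = c(j := c j - 1)"
  have c'C: "c' \<in> C" using Suc.prems(2) by (auto simp: C_def c'_def intro: le_less_trans[of _ "c j"])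
  have split: "monomial_fun c v = v $ j * monomial_fun c' v" for v
  proof -
    have "monomial_fun c v = v $ j ^ c j * (\<Prod>i\<in>UNIV - {j}. v $ i ^ c i)"
      unfolding monomial_fun_def by (subst prod.remove[of _ j]) auto
    moreover have "monomial_fun c' v = v $ j ^ (c j - 1) * (\<Prod>i\<in>UNIV - {j}. v $ i ^ c i)"
      unfolding monomial_fun_def by (subst prod.remove[of _ j]) (auto simp: c'_def)
    moreover have "v $ j ^ c j = v $ j * v $ j ^ (c j - 1)"
      using j by (metis Suc_diff_1 power_Suc)
    ultimately show ?thesis by simp
  qed
  have "(\<Sum>i\<in>UNIV. c i) = c j + (\<Sum>i\<in>UNIV - {j}. c i)" by (subst sum.remove[of _ j]) auto
  moreover have "(\<Sum>i\<in>UNIV. c' i) = (c j - 1) + (\<Sum>i\<in>UNIV - {j}. c i)"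
    by (subst sum.remove[of _ j]) (auto simp: c'_def)
  ultimately have n: "n = (\<Sum>i\<in>UNIV. c' i)" using Suc.hyps(2) j by simp
  have semi': "q (D \<zeta> *v z) = monomial_fun c' \<zeta> * q z" if \<zeta>: "\<zeta> \<in> Z" and z: "z \<in> U" for \<zeta> z
  proof (rule eq_if_eq_off_hyperplane[OF U(1) _ _ row_P_nonzero _ z, of _ _ j])
    show "continuous_on U (\<lambda>z. q (D \<zeta> *v z))"
      by (intro holomorphic_several_imp_continuous_on holomorphic_compose_D q(1) U(2) \<zeta>)
    show "continuous_on U (\<lambda>z. monomial_fun c' \<zeta> * q z)"
      by (intro continuous_intros holomorphic_several_imp_continuous_on q(1))
    fix z assume z: "z \<in> U" "cform (P $ j) z \<noteq> 0"
    have \<zeta>0: "\<zeta> $ j \<noteq> 0" using Z_cmod[OF \<zeta>, of j] by auto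
    have yD: "cform (P $ j) (D \<zeta> *v z) = \<zeta> $ j * cform (P $ j) z"
      using y_D[of \<zeta> z] by (simp add: y_nth[symmetric])
    have "cform (P $ j) (D \<zeta> *v z) * q (D \<zeta> *v z) = monomial_fun c \<zeta> * (cform (P $ j) z * q z)"
      using Suc.prems(3)[OF \<zeta> z(1)] q(2)[OF z(1)] q(2)[OF U(2)[OF \<zeta> z(1)]] by simp
    then show "q (D \<zeta> *v z) = monomial_fun c' \<zeta> * q z"
      using z(2) \<zeta>0 by (simp add: yD split)
  qed
  obtain r where r: "holomorphic_several r U" "\<forall>z\<in>U. q z = monomial_fun c' (y z) * r z"
    "\<forall>\<zeta>\<in>Z. \<forall>z\<in>U. r (D \<zeta> *v z) = r z"
    using Suc.hyps(1)[OF n q(1) c'C semi'] by blast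
  show ?case
    using r q(2) by (intro exI[of _ r]) (simp add: split y_nth[symmetric] mult.assoc)
qed

definition isotypic_part :: "('d \<Rightarrow> nat) \<Rightarrow> (complex^'d \<Rightarrow> complex) \<Rightarrow> complex^'d \<Rightarrow> complex" where
  "isotypic_part c f z = (\<Sum>\<zeta>\<in>Z. cnj (monomial_fun c \<zeta>) * f (D \<zeta> *v z)) / of_nat (card Z)"

lemma isotypic_part_semi_invariant: "\<eta> \<in> Z \<Longrightarrow> isotypic_part c f (D \<eta> *v z) = monomial_fun c \<eta> * isotypic_part c f z"
proof -
  assume \<eta>: "\<eta> \<in> Z"
  have "(\<Sum>\<zeta>\<in>Z. cnj (monomial_fun c \<zeta>) * f (D \<zeta> *v (D \<eta> *v z)))
      = (\<Sum>\<zeta>\<in>Z. monomial_fun c \<eta> * (cnj (monomial_fun c (\<eta> * \<zeta>)) * f (D (\<eta> * \<zeta>) *v z)))"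
  proof (rule sum.cong[OF refl])
    fix \<zeta>
    have "monomial_fun c \<eta> * cnj (monomial_fun c (\<eta> * \<zeta>)) = cnj (monomial_fun c \<zeta>)"
      using chi_cnj[OF \<eta>] by (simp add: chi_mult mult.assoc[symmetric])
    then show "cnj (monomial_fun c \<zeta>) * f (D \<zeta> *v (D \<eta> *v z))
        = monomial_fun c \<eta> * (cnj (monomial_fun c (\<eta> * \<zeta>)) * f (D (\<eta> * \<zeta>) *v z))"
      by (simp add: matrix_vector_mul_assoc D_mult mult.assoc[symmetric]) (simp add: mult.commute)
  qed
  also have "\<dots> = monomial_fun c \<eta> * (\<Sum>\<zeta>\<in>Z. cnj (monomial_fun c \<zeta>) * f (D \<zeta> *v z))"
    using sum.reindex_bij_betw[OF bij_mult_Z[OF \<eta>], of "\<lambda>\<zeta>. monomial_fun c \<eta> * (cnj (monomial_fun c \<zeta>) * f (D \<zeta> *v z))"]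
    by (simp add: sum_distrib_left)
  finally show ?thesis by (simp add: isotypic_part_def)
qed

lemma sum_isotypic_part: "(\<Sum>c\<in>C. isotypic_part c f z) = f z"
proof -
  have "(\<Sum>c\<in>C. isotypic_part c f z) = (\<Sum>\<zeta>\<in>Z. (\<Sum>c\<in>C. monomial_fun c (conjv \<zeta>)) * f (D \<zeta> *v z)) / of_nat (card Z)"
    unfolding isotypic_part_def sum_divide_distrib[symmetric]
    by (subst sum.swap) (simp add: chi_conjv sum_distrib_right)
  also have "(\<Sum>\<zeta>\<in>Z. (\<Sum>c\<in>C. monomial_fun c (conjv \<zeta>)) * f (D \<zeta> *v z))
      = (\<Sum>\<zeta>\<in>Z. if \<zeta> = 1 then of_nat (card Z) * f (D \<zeta> *v z) else 0)"
  proof (rule sum.cong[OF refl])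
    fix \<zeta> assume \<zeta>: "\<zeta> \<in> Z"
    have "conjv \<zeta> = 1 \<longleftrightarrow> \<zeta> = 1" using Z_conj[OF \<zeta>] by (auto simp: conjv_def vec_eq_iff)
    then show "(\<Sum>c\<in>C. monomial_fun c (conjv \<zeta>)) * f (D \<zeta> *v z)
        = (if \<zeta> = 1 then of_nat (card Z) * f (D \<zeta> *v z) else 0)"
      by (simp add: sum_chi_C[OF conjv_Z[OF \<zeta>]])
  qed
  also have "\<dots> = of_nat (card Z) * f z" using finite_Z Z_one by (simp add: D_one)
  finally show ?thesis using card_Z_pos by simp
qed

lemma isotypic_part_holomorphic:
  assumes f: "holomorphic_several f U" and inv: "\<And>\<zeta> z. \<zeta> \<in> Z \<Longrightarrow> z \<in> U \<Longrightarrow> D \<zeta> *v z \<in> U"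
  shows "holomorphic_several (isotypic_part c f) U"
proof -
  have "isotypic_part c f = (\<lambda>z. \<Sum>\<zeta>\<in>Z. (cnj (monomial_fun c \<zeta>) / of_nat (card Z)) * f (D \<zeta> *v z))"
    by (simp add: fun_eq_iff isotypic_part_def sum_divide_distrib)
  then show ?thesis
    by (simp only:) (intro holomorphic_several_sum holomorphic_several_mult holomorphic_several_const
        holomorphic_compose_D f inv)
qed

text \<open>In each coordinate, \<open>r j\<close> is the branch of the \<open>m j\<close>-th root
  near \<open>t0 $ j\<close> that takes the value \<open>y z0 $ j\<close> there.\<close>

lemma pi_local_inverse:
  assumes U: "open U" and z0: "z0 \<in> U" "\<And>j. y z0 $ j \<noteq> 0"
  obtains T s where "open T" "\<pi> z0 \<in> T" "\<And>t. t \<in> T \<Longrightarrow> s t \<in> U" "\<And>t. t \<in> T \<Longrightarrow> \<pi> (s t) = t"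
    "\<And>i. holomorphic_several (\<lambda>t. s t $ i) T"
proof -
  define t0 where "t0 = \<pi> z0"
  have t0: "t0 $ j = y z0 $ j ^ m j" "t0 $ j \<noteq> 0" for j using z0(2) by (simp_all add: t0_def \<pi>_def)
  define r where "r j x = y z0 $ j * exp (Ln (x / t0 $ j) / of_nat (m j))" for j x
  define s where "s t = Q *v (\<chi> j. r j (t $ j))" for t
  define T0 where "T0 = {t. \<forall>j. 0 < Re (t $ j / t0 $ j)}"
  have "open {t :: complex^'d. 0 < Re (t $ j / t0 $ j)}" for j
    by (intro open_Collect_less continuous_intros) (use t0 in auto)
  then have "open (\<Inter>j. {t :: complex^'d. 0 < Re (t $ j / t0 $ j)})" by (intro open_INT) auto
  moreover have "T0 = (\<Inter>j. {t. 0 < Re (t $ j / t0 $ j)})" by (auto simp: T0_def)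
  ultimately have T0: "open T0" by simp
  have rj: "holomorphic_several (\<lambda>t. r j (t $ j)) T0" for j
  proof (rule holomorphic_several_field_compose[OF _ polynomials_holomorphic[OF polynomials_coord]])
    fix t assume "t \<in> T0"
    then have "0 < Re (t $ j / t0 $ j)" by (simp add: T0_def)
    then have "t $ j / t0 $ j \<notin> \<real>\<^sub>\<le>\<^sub>0" by (auto simp: complex_nonpos_Reals_iff)
    note Ln' = DERIV_chain2[OF has_field_derivative_Ln[OF this] DERIV_cdivide[OF DERIV_ident]]
    note exp' = DERIV_chain2[OF DERIV_exp DERIV_cdivide[OF Ln', of "of_nat (m j)"]]
    show "\<exists>r'. (r j has_field_derivative r') (at (t $ j))"
      unfolding r_def[abs_def] by (rule exI) (rule DERIV_cmult[OF exp'])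
  qed
  have sh: "holomorphic_several (\<lambda>t. s t $ i) T0" for i
    unfolding s_def matrix_vector_mult_def
    by (simp, intro holomorphic_several_sum holomorphic_several_mult holomorphic_several_const rj)
  have sc: "continuous_on T0 s"
  proof -
    have "continuous_on T0 (\<lambda>t. \<chi> i. s t $ i)"
      by (intro continuous_on_vec_lambda holomorphic_several_imp_continuous_on sh)
    then show ?thesis by simp
  qed
  have pis: "\<pi> (s t) = t" if "t \<in> T0" for t
  proof -
    have "r j (t $ j) ^ m j = t $ j" for j
    proof -
      have "t $ j / t0 $ j \<noteq> 0" using that by (auto simp: T0_def dest: spec[of _ j])
      then have "exp (Ln (t $ j / t0 $ j) / of_nat (m j)) ^ m j = t $ j / t0 $ j"
        using m_pos[of j] by (simp flip: exp_of_nat_mult)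
      then show ?thesis using t0[of j] by (simp add: r_def power_mult_distrib)
    qed
    then show ?thesis by (simp add: \<pi>_def s_def yQ vec_eq_iff)
  qed
  have s0: "s t0 = z0"
  proof -
    have "(\<chi> j. r j (t0 $ j)) = y z0" by (simp add: vec_eq_iff r_def t0)
    then show ?thesis by (simp add: s_def Qy)
  qed
  show thesis
  proof (rule that[of "s -` U \<inter> T0" s])
    show "open (s -` U \<inter> T0)" using sc U continuous_on_open_vimage[OF T0] by blast
    show "\<pi> z0 \<in> s -` U \<inter> T0" using s0 z0(1) t0(2) by (simp add: t0_def[symmetric] T0_def)
    show "holomorphic_several (\<lambda>t. s t $ i) (s -` U \<inter> T0)" for i
      using sh holomorphic_several_subset by blast
  qed (use pis in auto)
qed

end

context basic_map
begin

text \<open>The function \<open>h\<close> with \<open>h \<circ> \<theta> = q\<close> is well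
  defined and continuous. The function \<open>k = h \<circ> \<Phi>\<close> satisfies \<open>k
  \<circ> \<pi> = q\<close>, so it is holomorphic where no coordinate vanishes, since
  \<open>\<pi>\<close> has local holomorphic inverses there; the coordinate hyperplanes are
  removable singularities because \<open>k\<close> is continuous. Finally \<open>h = k \<circ>
  \<Psi>\<close>.\<close>

theorem invariant_descends:
  assumes U: "open U"
    and q: "holomorphic_several q U" and inv: "\<And>\<zeta> z. \<zeta> \<in> Z \<Longrightarrow> z \<in> U \<Longrightarrow> q (D \<zeta> *v z) = q z"
  obtains h where "holomorphic_several h (\<theta> ` U)" "\<And>z. z \<in> U \<Longrightarrow> h (\<theta> z) = q z"
    "\<And>u. u \<notin> \<theta> ` U \<Longrightarrow> h u = 0"
proof -
  define h where "h u = (if u \<in> \<theta> ` U then q (SOME z. z \<in> U \<and> \<theta> z = u) else 0)" for u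
  have hq: "h (\<theta> z) = q z" if z: "z \<in> U" for z
  proof -
    define w where "w = (SOME w. w \<in> U \<and> \<theta> w = \<theta> z)"
    have w: "w \<in> U \<and> \<theta> w = \<theta> z" unfolding w_def by (rule someI[of _ z]) (use z in simp)
    then obtain \<zeta> where "\<zeta> \<in> Z" "w = D \<zeta> *v z" using theta_eq_iff by metis
    then have "q w = q z" using inv z by simp
    then show ?thesis using z by (simp add: h_def w_def)
  qed
  have "continuous_on U (\<lambda>z. h (\<theta> z))"
    by (rule continuous_on_eq[OF holomorphic_several_imp_continuous_on[OF q]]) (simp add: hq)
  then have hc: "continuous_on (\<theta> ` U) h" by (rule continuous_on_descend[OF U])
  define V where "V = \<pi> ` U"
  define k where "k t = h (\<Phi> t)" for t
  have V: "open V" unfolding V_def by (rule pi_open[OF U])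
  have kq: "k (\<pi> z) = q z" if "z \<in> U" for z
    using hq[OF that] by (simp add: k_def theta_eq_Phi[symmetric])
  have kc: "continuous_on V k"
    unfolding k_def
  proof (rule continuous_on_compose2[OF hc polynomial_map_continuous[OF Phi_polynomial]])
    show "\<Phi> ` V \<subseteq> \<theta> ` U" by (auto simp: V_def theta_eq_Phi)
  qed
  have regular: "holomorphic_several k {t\<in>V. \<forall>j\<in>UNIV. t $ j \<noteq> 0}"
    unfolding holomorphic_several_iff
  proof
    fix t assume "t \<in> {t\<in>V. \<forall>j\<in>UNIV. t $ j \<noteq> 0}"
    then obtain z where z: "z \<in> U" "t = \<pi> z" "\<And>j. t $ j \<noteq> 0" by (auto simp: V_def)
    have yz: "y z $ j \<noteq> 0" for j using z(3)[of j] m_pos[of j] by (auto simp: z(2) \<pi>_def zero_power)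
    obtain T s where T: "open T" "\<pi> z \<in> T" "\<And>t. t \<in> T \<Longrightarrow> s t \<in> U" "\<And>t. t \<in> T \<Longrightarrow> \<pi> (s t) = t"
      "\<And>i. holomorphic_several (\<lambda>t. s t $ i) T"
      by (rule pi_local_inverse[OF U z(1) yz]) blast
    have "holomorphic_several (\<lambda>t. q (s t)) T"
      by (rule holomorphic_several_compose[OF q T(5)]) (use T(3) in blast)
    moreover have "q (s t) = k t" if "t \<in> T" for t
      using kq[OF T(3)[OF that]] T(4)[OF that] by simp
    ultimately have "holomorphic_several k T" using holomorphic_several_cong[OF T(1)] by metis
    then show "\<exists>a. (k has_derivative cform a) (at t)"
      using T(2) unfolding holomorphic_several_iff z(2) by blast
  qed
  \<comment> \<open>The hyperplanes \<open>t $ j = 0\<close>, \<open>j \<in> J\<close>, are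
    removed one at a time.\<close>
  have remove: "holomorphic_several k {t\<in>V. \<forall>j\<in>J. t $ j \<noteq> 0} \<Longrightarrow> holomorphic_several k V" for J
    using finite[of J]
  proof (induction J rule: finite_induct)
    case (insert i J)
    let ?W = "{t\<in>V. \<forall>j\<in>J. t $ j \<noteq> 0}"
    have cf: "cform (axis i 1) t = t $ i" for t :: "complex^'d"
      by (simp add: cform_def axis_def if_distrib[of "\<lambda>c. c * _"] cong: if_cong)
    have W: "open ?W"
    proof -
      have "open (\<Inter>j\<in>J. {t :: complex^'d. t $ j \<noteq> 0})"
        using insert.hyps(1) by (intro open_INT ballI open_Collect_neq continuous_intros) auto
      moreover have "?W = V \<inter> (\<Inter>j\<in>J. {t. t $ j \<noteq> 0})" by auto
      ultimately show ?thesis using V by auto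
    qed
    have "holomorphic_several k ?W"
    proof (rule holomorphic_several_removable[OF W, of _ "axis i 1"])
      show "continuous_on ?W k" using kc by (rule continuous_on_subset) auto
      show "(axis i 1 :: complex^'d) \<noteq> 0" by (simp add: axis_eq_0_iff)
      have "{t \<in> ?W. cform (axis i 1) t \<noteq> 0} = {t\<in>V. \<forall>j\<in>insert i J. t $ j \<noteq> 0}"
        by (auto simp: cf)
      then show "holomorphic_several k {t \<in> ?W. cform (axis i 1) t \<noteq> 0}" using insert.prems by simp
    qed
    then show ?case by (rule insert.IH)
  qed simp
  have kh: "holomorphic_several k V" using remove[OF regular] .
  have "holomorphic_several h (\<theta> ` U)"
  proof (rule holomorphic_several_cong[OF theta_open[OF U]])
    show "holomorphic_several (\<lambda>u. k (\<Psi> u)) (\<theta> ` U)"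
      by (rule holomorphic_several_compose[OF kh polynomials_holomorphic[OF Psi_polynomial]])
         (auto simp: V_def pi_eq_Psi[symmetric])
  qed (simp add: k_def Phi_Psi)
  then show thesis using that hq by (simp add: h_def)
qed

section \<open>The Jacobian determinant\<close>

definition dPhi :: "complex^'d \<Rightarrow> complex^'d^'d" where
  "dPhi t = (SOME B. (\<Phi> has_derivative (*v) B) (at t))"

text \<open>The chain rule for \<open>\<theta> = \<Phi> \<circ> \<pi>\<close>.\<close>

definition dtheta :: "complex^'d \<Rightarrow> complex^'d^'d" where
  "dtheta z = dPhi (\<pi> z) ** (\<chi> i. (of_nat (m i) * y z $ i ^ (m i - 1)) *s P $ i)"

lemma dPhi: "(\<Phi> has_derivative (*v) (dPhi t)) (at t)"
  unfolding dPhi_def by (rule someI_ex) (rule polynomial_map_derivative[OF Phi_polynomial])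

text \<open>\<open>\<Phi>\<close> has the differentiable inverse \<open>\<Psi>\<close>.\<close>

lemma det_dPhi_nonzero: "det (dPhi t) \<noteq> 0"
proof -
  obtain A where A: "(\<Psi> has_derivative (*v) A) (at (\<Phi> t))"
    using polynomial_map_derivative[OF Psi_polynomial] by blast
  have "((\<lambda>t. t) has_derivative (*v) (A ** dPhi t)) (at t)"
    using has_derivative_matrix_mult[OF A dPhi] by (simp add: Psi_Phi)
  moreover have "((\<lambda>t. t) has_derivative (\<lambda>v. v)) (at t)" by (rule has_derivative_ident)
  ultimately have "(*v) (A ** dPhi t) = (\<lambda>v. v)" by (rule has_derivative_unique)
  then have "A ** dPhi t = mat 1" by (subst matrix_eq) (simp add: fun_eq_iff)
  then have "det A * det (dPhi t) = 1" by (metis det_I det_mul)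
  then show ?thesis by auto
qed

lemma continuous_det_dPhi: "continuous_on S (\<lambda>t. det (dPhi t))"
proof (rule continuous_on_det)
  fix i j
  show "continuous_on S (\<lambda>t. dPhi t $ i $ j)"
  proof (rule continuous_at_imp_continuous_on, rule ballI)
    fix t
    have "((\<lambda>t. cform (dPhi t $ i) (axis j 1)) \<longlongrightarrow> cform (dPhi t $ i) (axis j 1)) (at t)"
      by (rule tendsto_directional_derivative[OF open_UNIV UNIV_I has_derivative_matrix_component[OF dPhi]])
    then show "isCont (\<lambda>t. dPhi t $ i $ j) t" by (simp add: isCont_def cform_axis)
  qed
qed

lemma dtheta: "(\<theta> has_derivative (*v) (dtheta z)) (at z)"
proof -
  have "(\<pi> has_derivative (*v) (\<chi> i. (of_nat (m i) * y z $ i ^ (m i - 1)) *s P $ i)) (at z)"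
  proof (rule has_derivative_matrix_of_components)
    fix i
    have "(cform (P $ i) has_derivative cform (P $ i)) (at z)"
      by (rule bounded_linear_imp_has_derivative[OF bounded_linear_cform])
    from has_derivative_power[OF this, of "m i"]
    have "((\<lambda>z. cform (P $ i) z ^ m i) has_derivative
        (\<lambda>v. of_nat (m i) * cform (P $ i) v * cform (P $ i) z ^ (m i - 1))) (at z)" .
    then show "((\<lambda>z. \<pi> z $ i) has_derivative
        cform ((\<chi> i. (of_nat (m i) * y z $ i ^ (m i - 1)) *s P $ i) $ i)) (at z)"
      by (simp add: \<pi>_def y_nth cform_scale_left[abs_def] mult_ac)
  qed
  from has_derivative_matrix_mult[OF dPhi this]
  have "((\<lambda>z. \<Phi> (\<pi> z)) has_derivative (*v) (dtheta z)) (at z)" by (simp add: dtheta_def)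
  then show ?thesis by (simp add: theta_eq_Phi[symmetric])
qed

lemma jacobian_eq_det: "jacobian_det \<theta> z = det (dtheta z)"
proof -
  have "deriv (\<lambda>t. \<theta> (z + t *s axis j 1) $ i) 0 = dtheta z $ i $ j" for i j
  proof -
    have "((\<lambda>z. \<theta> z $ i) has_derivative cform (dtheta z $ i)) (at (z + 0 *s axis j 1))"
      using has_derivative_matrix_component[OF dtheta, of i z] by simp
    from DERIV_imp_deriv[OF has_derivative_line[OF this]] show ?thesis by (simp add: cform_axis)
  qed
  then show ?thesis by (simp add: jacobian_det_def vec_eq_iff)
qed

lemma jacobian_formula:
  "jacobian_det \<theta> z = det (dPhi (\<pi> z)) * (\<Prod>i\<in>UNIV. of_nat (m i) * y z $ i ^ (m i - 1)) * det P"
proof -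
  have "det (\<chi> i. (of_nat (m i) * y z $ i ^ (m i - 1)) *s P $ i)
     = (\<Prod>i\<in>UNIV. of_nat (m i) * y z $ i ^ (m i - 1)) * det (\<chi> i. P $ i)"
    by (rule det_rows_mul)
  then show ?thesis by (simp add: jacobian_eq_det dtheta_def det_mul)
qed

lemma det_P: "det P \<noteq> 0"
  using PQ by (metis det_I det_mul mult_zero_left zero_neq_one)

lemma jacobian_nonzero: "(\<And>j. y z $ j \<noteq> 0) \<Longrightarrow> jacobian_det \<theta> z \<noteq> 0"
  using det_dPhi_nonzero det_P m_pos by (simp add: jacobian_formula)

lemma norm_jacobian_D: "\<zeta> \<in> Z \<Longrightarrow> cmod (jacobian_det \<theta> (D \<zeta> *v z)) = cmod (jacobian_det \<theta> z)"
  by (simp add: jacobian_formula pi_D y_D norm_mult prod_norm[symmetric] norm_power Z_cmod)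

lemma norm_chi_D: "\<zeta> \<in> Z \<Longrightarrow> cmod (monomial_fun c (y (D \<zeta> *v z))) = cmod (monomial_fun c (y z))"
  by (simp add: y_D chi_mult norm_mult chi_cmod)

lemma continuous_jacobian: "continuous_on S (jacobian_det \<theta>)"
  unfolding jacobian_formula[abs_def] y_def
  by (intro continuous_intros continuous_on_compose2[OF continuous_det_dPhi[of UNIV]]
      polynomial_map_continuous pi_polynomial continuous_linear_map) auto

end

section \<open>The change of variables under the quotient map\<close>

text \<open>The complex hyperplane is contained in the real hyperplane on which the real part
  vanishes.\<close>

lemma AE_cform_nonzero:
  fixes l :: "complex^'d"
  assumes "l \<noteq> 0" shows "AE z in lborel. cform l z \<noteq> 0"
proof -
  define a :: "complex^'d" where "a = (\<chi> i. cnj (l $ i))"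
  have a: "Re (cform l z) = a \<bullet> z" for z
    by (simp add: cform_def inner_vec_def a_def inner_complex_def)
  have "a \<noteq> 0" using assms by (auto simp: a_def vec_eq_iff)
  then have "negligible {z. a \<bullet> z = 0}" by (intro negligible_hyperplane) simp
  then have "negligible {z. cform l z = 0}"
    by (rule negligible_subset) (use a in \<open>auto simp flip: a\<close>)
  then have "AE z in lebesgue. z \<notin> {z. cform l z = 0}"
    by (intro AE_not_in) (simp add: negligible_iff_null_sets)
  then show ?thesis by (simp add: AE_completion_iff)
qed

lemma Arg2pi_power:
  assumes w: "w \<noteq> 0" "n > 0" "Arg2pi w < 2 * pi / n"
  shows "Arg2pi (w ^ n) = n * Arg2pi w"
proof (rule Arg2pi_unique)
  have "w ^ n = (of_real (cmod w) * exp (\<i> * of_real (Arg2pi w))) ^ n"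
    by (subst Arg2pi_eq[of w]) simp
  then show "of_real (cmod w ^ n) * exp (\<i> * of_real (real n * Arg2pi w)) = w ^ n"
    by (simp add: power_mult_distrib exp_of_nat_mult[symmetric] mult_ac)
  show "real n * Arg2pi w < 2 * pi" using w by (simp add: pos_less_divide_eq mult.commute)
qed (use w Arg2pi_ge_0 in auto)

lemma sector_unique:
  assumes "w \<noteq> 0" "w' \<noteq> 0" "n > 0" "w ^ n = w' ^ n" "Arg2pi w < 2 * pi / n" "Arg2pi w' < 2 * pi / n"
  shows "w = w'"
proof -
  have "Arg2pi w = Arg2pi w'"
    using Arg2pi_power[OF assms(1,3,5)] Arg2pi_power[OF assms(2,3,6)] assms(3,4) by simp
  moreover have "cmod w = cmod w'"
    using assms(3,4) by (metis norm_ge_zero norm_power power_eq_imp_eq_base)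
  ultimately show ?thesis by (metis Arg2pi_eq)
qed

text \<open>Together with \<open>sector_unique\<close>: the sector \<open>0 \<le> arg w <
  2\<pi>/n\<close> contains exactly one of the products \<open>\<zeta> w\<close> with \<open>\<zeta>
  ^ n = 1\<close>. The representative is found from its \<open>n\<close>-th power.\<close>

lemma sector_exists:
  assumes "w \<noteq> 0" "n > 0"
  shows "\<exists>\<zeta> :: complex. \<zeta> ^ n = 1 \<and> Arg2pi (\<zeta> * w) < 2 * pi / n"
proof -
  define a where "a = Arg2pi (w ^ n) / n"
  define w0 where "w0 = of_real (cmod w) * exp (\<i> * of_real a)"
  have a: "0 \<le> a" "a < 2 * pi / n" using assms Arg2pi_ge_0 Arg2pi_lt_2pi by (simp_all add: a_def divide_strict_right_mono)
  have "2 * pi / n \<le> 2 * pi" using assms(2) by (simp add: divide_le_eq)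
  then have Arg: "Arg2pi w0 = a" using a assms by (intro Arg2pi_unique[of "cmod w"]) (auto simp: w0_def)
  have "w0 ^ n = of_real (cmod (w ^ n)) * exp (\<i> * of_real (Arg2pi (w ^ n)))"
    using assms(2) by (simp add: w0_def power_mult_distrib exp_of_nat_mult[symmetric] a_def norm_power)
  then have "w0 ^ n = w ^ n" using Arg2pi_eq[of "w ^ n"] by simp
  then show ?thesis using assms a Arg by (intro exI[of _ "w0 / w"]) (simp add: power_divide)
qed

lemma borel_measurable_Arg2pi [measurable]: "Arg2pi \<in> borel_measurable borel"
proof -
  have "(\<lambda>z. if z \<in> \<real>\<^sub>\<ge>\<^sub>0 then 0 else Arg2pi z) \<in> borel_measurable borel"
  proof (rule borel_measurable_continuous_on_if)
    show "(\<real>\<^sub>\<ge>\<^sub>0 :: complex set) \<in> sets borel" using closed_nonneg_Reals_complex by (rule borel_closed)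
    show "continuous_on (- \<real>\<^sub>\<ge>\<^sub>0) Arg2pi"
      by (intro continuous_at_imp_continuous_on ballI continuous_at_Arg2pi) simp
  qed simp
  moreover have "(\<lambda>z. if z \<in> \<real>\<^sub>\<ge>\<^sub>0 then 0 else Arg2pi z) = Arg2pi"
    by (auto simp: fun_eq_iff Arg2pi_eq_0 complex_nonneg_Reals_iff complex_is_Real_iff)
  ultimately show ?thesis by simp
qed

locale bergman_quotient = basic_map P Q m \<theta> for P Q :: "complex^'d^'d" and m \<theta> +
  fixes \<Omega> :: "(complex^'d) set" and wt :: "complex^'d \<Rightarrow> real"
  assumes open_\<Omega>: "open \<Omega>" and bounded_\<Omega>: "bounded \<Omega>" and nonempty_\<Omega>: "\<Omega> \<noteq> {}"
    and inv_\<Omega>: "\<And>\<zeta> z. \<zeta> \<in> Z \<Longrightarrow> z \<in> \<Omega> \<Longrightarrow> D \<zeta> *v z \<in> \<Omega>"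
    and wt_cont: "continuous_on (\<theta> ` \<Omega>) wt" and wt_pos: "\<And>u. u \<in> \<theta> ` \<Omega> \<Longrightarrow> wt u > 0"
begin

abbreviation "J \<equiv> jacobian_det \<theta>"
text \<open>Where \<open>m j = 1\<close> the hyperplane \<open>y j = 0\<close> is not a reflecting
  one; removing it nevertheless costs only a null set and allows all coordinates to be treated
  alike.\<close>

definition reg :: "(complex^'d) set" where "reg = {z. \<forall>j. y z $ j \<noteq> 0}"

lemma reg_D: "\<zeta> \<in> Z \<Longrightarrow> D \<zeta> *v z \<in> reg \<longleftrightarrow> z \<in> reg"
proof -
  assume \<zeta>: "\<zeta> \<in> Z"
  have "\<zeta> $ j \<noteq> 0" for j using Z_cmod[OF \<zeta>, of j] by auto
  then show ?thesis by (simp add: reg_def y_D)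
qed

lemma open_reg: "open reg"
proof -
  have "reg = (\<Inter>j. {z. cform (P $ j) z \<noteq> 0})" by (auto simp: reg_def y_nth)
  then show ?thesis by (simp only:) (rule open_INT, auto intro: open_cform_nonzero)
qed

lemma AE_reg: "AE z in lborel. z \<in> reg"
  unfolding reg_def y_nth by (simp add: AE_all_countable AE_cform_nonzero row_P_nonzero)

lemma theta_mem_iff: "\<theta> z \<in> \<theta> ` \<Omega> \<longleftrightarrow> z \<in> \<Omega>"
proof
  assume "\<theta> z \<in> \<theta> ` \<Omega>"
  then obtain w where w: "w \<in> \<Omega>" "\<theta> w = \<theta> z" by force
  then obtain \<zeta> where "\<zeta> \<in> Z" "z = D \<zeta> *v w" using theta_eq_iff by blast
  then show "z \<in> \<Omega>" using inv_\<Omega> w by simp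
qed simp

lemma theta_mem_reg: "\<theta> z \<in> \<theta> ` reg \<longleftrightarrow> z \<in> reg"
proof
  assume "\<theta> z \<in> \<theta> ` reg"
  then obtain w where w: "w \<in> reg" "\<theta> w = \<theta> z" by force
  then obtain \<zeta> where "\<zeta> \<in> Z" "z = D \<zeta> *v w" using theta_eq_iff by blast
  then show "z \<in> reg" using reg_D w by simp
qed simp

lemma theta_surj: "\<exists>z. \<theta> z = u"
  using pi_surj[of "\<Psi> u"] theta_eq_Phi Phi_Psi by metis

text \<open>A differentiable map sends null sets of \<open>complex^'d\<close> to null
  sets.\<close>

lemma AE_theta_reg: "AE u in lborel. u \<in> \<theta> ` reg"
proof -
  have "AE z in lebesgue. z \<in> reg" using AE_reg by (rule AE_completion)
  then have "negligible (- reg)"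
    using open_reg by (simp add: negligible_iff_null_sets AE_iff_null_sets[of "- reg"] borel_open)
  moreover have "\<theta> differentiable_on (- reg)"
    unfolding differentiable_on_def differentiable_def using dtheta has_derivative_at_withinI by blast
  ultimately have "negligible (\<theta> ` (- reg))"
    by (intro negligible_differentiable_image_negligible) auto
  then have "AE u in lebesgue. u \<notin> \<theta> ` (- reg)"
    by (intro AE_not_in) (simp add: negligible_iff_null_sets)
  moreover have "u \<notin> \<theta> ` (- reg) \<longleftrightarrow> u \<in> \<theta> ` reg" for u
  proof -
    obtain z where "\<theta> z = u" using theta_surj by blast
    moreover have "\<theta> z \<in> \<theta> ` (- reg) \<longleftrightarrow> z \<notin> reg"
    proof
      assume "\<theta> z \<in> \<theta> ` (- reg)"
      then obtain w where w: "w \<notin> reg" "\<theta> w = \<theta> z" by force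
      then obtain \<zeta> where "\<zeta> \<in> Z" "z = D \<zeta> *v w" using theta_eq_iff by blast
      then show "z \<notin> reg" using reg_D w by simp
    qed auto
    ultimately show ?thesis using theta_mem_reg by blast
  qed
  ultimately show ?thesis by (simp add: AE_completion_iff)
qed

lemma theta_borel [measurable]: "\<theta> \<in> borel_measurable borel"
  by (rule borel_measurable_continuous_onI) (rule theta_continuous)

lemma y_borel [measurable]: "y \<in> borel_measurable borel"
  unfolding y_def[abs_def] by (rule borel_measurable_continuous_onI) (rule continuous_linear_map)

lemma D_borel: "(*v) (D \<zeta>) \<in> borel_measurable borel"
  by (rule borel_measurable_continuous_onI) (rule continuous_linear_map)

lemma J_borel [measurable]: "J \<in> borel_measurable borel"
  by (rule borel_measurable_continuous_onI) (rule continuous_jacobian)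

lemma chi_borel [measurable]: "(\<lambda>z. monomial_fun c (y z)) \<in> borel_measurable borel"
  unfolding monomial_fun_def y_def
  by (intro borel_measurable_continuous_onI continuous_intros continuous_linear_map)

lemma sets_domains [measurable]: "\<Omega> \<in> sets borel" "reg \<in> sets borel" "\<theta> ` \<Omega> \<in> sets borel" "\<theta> ` reg \<in> sets borel"
  using open_\<Omega> open_reg theta_open by (auto intro: borel_open)

text \<open>On \<open>reg\<close> this is a fundamental domain of the group.\<close>

definition sector :: "(complex^'d) set" where
  "sector = {z. \<forall>j. Arg2pi (y z $ j) < 2 * pi / m j}"

text \<open>The part of the regular points of \<open>\<Omega>\<close> which \<open>D
  \<zeta>\<close> moves into the fundamental domain. These parts form a partition, and
  \<open>\<theta>\<close> maps each one bijectively to the same set.\<close>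

definition piece :: "complex^'d \<Rightarrow> (complex^'d) set" where
  "piece \<zeta> = {z \<in> \<Omega> \<inter> reg. D \<zeta> *v z \<in> sector}"

lemma sets_piece: "piece \<zeta> \<in> sets borel"
proof -
  have nth: "(\<lambda>v :: complex^'d. v $ j) \<in> borel_measurable borel" for j
    by (intro borel_measurable_continuous_onI continuous_intros)
  have "(\<lambda>z. Arg2pi (y z $ j)) \<in> borel_measurable borel" for j
    using nth y_borel by measurable
  then have "{z. Arg2pi (y z $ j) < 2 * pi / m j} \<in> sets borel" for j
    by measurable
  then have "(\<Inter>j. {z. Arg2pi (y z $ j) < 2 * pi / m j}) \<in> sets borel"
    by (intro sets.finite_INT) auto
  moreover have "sector = (\<Inter>j. {z. Arg2pi (y z $ j) < 2 * pi / m j})" by (auto simp: sector_def)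
  ultimately have "sector \<in> sets borel" by simp
  then have "(*v) (D \<zeta>) -` sector \<in> sets borel"
    using measurable_sets[OF D_borel] by simp
  moreover have "piece \<zeta> = (\<Omega> \<inter> reg) \<inter> ((*v) (D \<zeta>) -` sector)" by (auto simp: piece_def)
  ultimately show ?thesis by simp
qed

lemma sector_rotate:
  assumes "z \<in> reg" shows "\<exists>\<zeta>\<in>Z. D \<zeta> *v z \<in> sector"
proof -
  have "\<forall>j. \<exists>w. w ^ m j = 1 \<and> Arg2pi (w * y z $ j) < 2 * pi / m j"
    using assms sector_exists[OF _ m_pos] by (auto simp: reg_def)
  then obtain w where w: "\<And>j. w j ^ m j = 1" "\<And>j. Arg2pi (w j * y z $ j) < 2 * pi / m j" by metis
  then have "(\<chi> j. w j) \<in> Z" "D (\<chi> j. w j) *v z \<in> sector" by (simp_all add: Z_def sector_def y_D)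
  then show ?thesis by blast
qed

lemma sector_rotate_unique:
  assumes z: "z \<in> reg" and \<zeta>: "\<zeta> \<in> Z" "\<eta> \<in> Z" "D \<zeta> *v z \<in> sector" "D \<eta> *v z \<in> sector"
  shows "\<zeta> = \<eta>"
proof -
  have "\<zeta> $ j = \<eta> $ j" for j
  proof -
    have nz: "y z $ j \<noteq> 0" "\<zeta> $ j \<noteq> 0" "\<eta> $ j \<noteq> 0"
      using z Z_cmod[OF \<zeta>(1), of j] Z_cmod[OF \<zeta>(2), of j] by (auto simp: reg_def)
    have "\<zeta> $ j * y z $ j = \<eta> $ j * y z $ j"
    proof (rule sector_unique[of _ _ "m j"])
      show "(\<zeta> $ j * y z $ j) ^ m j = (\<eta> $ j * y z $ j) ^ m j"
        using \<zeta>(1,2) by (simp add: Z_def power_mult_distrib)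
    qed (use nz \<zeta> m_pos in \<open>auto simp: sector_def y_D\<close>)
    then show ?thesis using nz by simp
  qed
  then show ?thesis by (simp add: vec_eq_iff)
qed

lemma theta_image_piece:
  assumes "\<zeta> \<in> Z" shows "\<theta> ` (piece \<zeta> \<inter> \<theta> -` B) = B \<inter> \<theta> ` (\<Omega> \<inter> reg)"
proof (intro equalityI subsetI)
  fix u assume "u \<in> B \<inter> \<theta> ` (\<Omega> \<inter> reg)"
  then obtain z where z: "z \<in> \<Omega>" "z \<in> reg" "u = \<theta> z" "u \<in> B" by blast
  obtain \<eta> where \<eta>: "\<eta> \<in> Z" "D \<eta> *v z \<in> sector" using sector_rotate z by blast
  define \<xi> where "\<xi> = conjv \<zeta> * \<eta>"
  have \<xi>: "\<xi> \<in> Z" using assms \<eta> by (simp add: \<xi>_def Z_mult conjv_Z)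
  have "D \<zeta> *v (D \<xi> *v z) = D \<eta> *v z"
    using Z_conj[OF assms] by (simp add: matrix_vector_mul_assoc D_mult \<xi>_def mult.assoc[symmetric])
  then have "D \<xi> *v z \<in> piece \<zeta>" using z \<eta> \<xi> inv_\<Omega> reg_D by (simp add: piece_def)
  moreover have "\<theta> (D \<xi> *v z) = u" using theta_invariant_polynomial(2)[OF \<xi>] z by simp
  ultimately show "u \<in> \<theta> ` (piece \<zeta> \<inter> \<theta> -` B)" using z(4) by blast
qed (auto simp: piece_def)

lemma theta_inj_piece:
  assumes \<zeta>: "\<zeta> \<in> Z" shows "inj_on \<theta> (piece \<zeta>)"
proof (rule inj_onI)
  fix z w assume z: "z \<in> piece \<zeta>" and w: "w \<in> piece \<zeta>" and "\<theta> z = \<theta> w"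
  then obtain \<eta> where \<eta>: "\<eta> \<in> Z" "w = D \<eta> *v z" using theta_eq_iff by blast
  have "\<zeta> * \<eta> = \<zeta>"
  proof (rule sector_rotate_unique)
    show "z \<in> reg" "D \<zeta> *v z \<in> sector" using z by (simp_all add: piece_def)
    show "D (\<zeta> * \<eta>) *v z \<in> sector" using w by (simp add: piece_def \<eta> matrix_vector_mul_assoc D_mult)
  qed (use \<zeta> \<eta> Z_mult in auto)
  then have "conjv \<zeta> * (\<zeta> * \<eta>) = conjv \<zeta> * \<zeta>" by simp
  then have "\<eta> = 1" by (simp add: mult.assoc[symmetric] Z_conj'[OF \<zeta>])
  then show "z = w" using \<eta> by (simp add: D_one)
qed

lemma bounded_theta_image: "bounded (\<theta> ` \<Omega>)"
proof -
  have "compact (\<theta> ` closure \<Omega>)"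
    using bounded_\<Omega> by (intro compact_continuous_image theta_continuous) simp
  then show ?thesis
    by (rule bounded_subset[OF compact_imp_bounded]) (simp add: image_mono closure_subset)
qed

text \<open>Each of the \<open>card Z\<close> pieces contributes the same volume, by the injective
  change of variables formula; the points over the critical values form null sets on both
  sides.\<close>

theorem theta_change_of_variables:
  assumes B: "B \<in> sets borel"
  shows "(\<integral>\<^sup>+z. ennreal (indicator \<Omega> z * (cmod (J z))\<^sup>2) * indicator B (\<theta> z) \<partial>lborel)
    = of_nat (card Z) * emeasure lborel (B \<inter> \<theta> ` \<Omega>)"
proof -
  have pre: "\<theta> -` B \<in> sets borel" using measurable_sets[OF theta_borel B] by simp
  have each: "(\<integral>\<^sup>+z. ennreal (indicator (piece \<zeta> \<inter> \<theta> -` B) z * (cmod (J z))\<^sup>2) \<partial>lborel)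
      = emeasure lborel (B \<inter> \<theta> ` (\<Omega> \<inter> reg))" if \<zeta>: "\<zeta> \<in> Z" for \<zeta>
    unfolding theta_image_piece[OF \<zeta>, of B, symmetric] jacobian_eq_det
  proof (rule emeasure_image_holomorphic[symmetric])
    show "piece \<zeta> \<inter> \<theta> -` B \<in> sets borel" using sets_piece pre by simp
    have "open (\<theta> ` (\<Omega> \<inter> reg))" by (intro theta_open open_Int open_\<Omega> open_reg)
    then show "\<theta> ` (piece \<zeta> \<inter> \<theta> -` B) \<in> sets borel"
      unfolding theta_image_piece[OF \<zeta>] using B borel_open by blast
    show "bounded (\<theta> ` (piece \<zeta> \<inter> \<theta> -` B))"
      by (rule bounded_subset[OF bounded_theta_image]) (auto simp: piece_def)
    show "inj_on \<theta> (piece \<zeta> \<inter> \<theta> -` B)" using theta_inj_piece[OF \<zeta>] by (rule inj_on_subset) auto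
    show "det (dtheta z) \<noteq> 0" if "z \<in> piece \<zeta> \<inter> \<theta> -` B" for z
      using that jacobian_nonzero[of z] by (simp add: jacobian_eq_det[symmetric] piece_def reg_def)
    have [measurable]: "piece \<zeta> \<inter> \<theta> -` B \<in> sets borel" using sets_piece pre by simp
    have "(\<lambda>z. indicator (piece \<zeta> \<inter> \<theta> -` B) z * (cmod (J z))\<^sup>2) \<in> borel_measurable borel" by measurable
    then show "(\<lambda>z. indicator (piece \<zeta> \<inter> \<theta> -` B) z * (cmod (det (dtheta z)))\<^sup>2) \<in> borel_measurable borel"
      by (simp add: jacobian_eq_det)
  qed (rule dtheta)
  have ind: "indicator \<Omega> z * indicator B (\<theta> z) = (\<Sum>\<zeta>\<in>Z. indicator (piece \<zeta> \<inter> \<theta> -` B) z :: real)"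
    if z: "z \<in> reg" for z
  proof (cases "z \<in> \<Omega> \<and> \<theta> z \<in> B")
    case True
    obtain \<eta> where \<eta>: "\<eta> \<in> Z" "D \<eta> *v z \<in> sector" using sector_rotate z by blast
    have "indicator (piece \<zeta> \<inter> \<theta> -` B) z = (if \<zeta> = \<eta> then 1 else 0 :: real)" if "\<zeta> \<in> Z" for \<zeta>
    proof (cases "\<zeta> = \<eta>")
      case True
      then show ?thesis using \<eta> z \<open>z \<in> \<Omega> \<and> \<theta> z \<in> B\<close> by (simp add: piece_def)
    next
      case False
      then have "D \<zeta> *v z \<notin> sector" using sector_rotate_unique[OF z that \<eta>(1) _ \<eta>(2)] by (rule contrapos_nn)
      then show ?thesis using False by (simp add: piece_def)
    qed
    then have "(\<Sum>\<zeta>\<in>Z. indicator (piece \<zeta> \<inter> \<theta> -` B) z :: real) = (\<Sum>\<zeta>\<in>Z. if \<zeta> = \<eta> then 1 else 0)"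
      by (rule sum.cong[OF refl])
    then show ?thesis using True \<eta>(1) finite_Z by simp
  next
    case False
    then show ?thesis by (auto simp: indicator_def piece_def)
  qed
  have "(\<integral>\<^sup>+z. ennreal (indicator \<Omega> z * (cmod (J z))\<^sup>2) * indicator B (\<theta> z) \<partial>lborel)
      = (\<integral>\<^sup>+z. (\<Sum>\<zeta>\<in>Z. ennreal (indicator (piece \<zeta> \<inter> \<theta> -` B) z * (cmod (J z))\<^sup>2)) \<partial>lborel)"
  proof (rule nn_integral_cong_AE)
    show "AE z in lborel. ennreal (indicator \<Omega> z * (cmod (J z))\<^sup>2) * indicator B (\<theta> z)
       = (\<Sum>\<zeta>\<in>Z. ennreal (indicator (piece \<zeta> \<inter> \<theta> -` B) z * (cmod (J z))\<^sup>2))"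
      using AE_reg
    proof eventually_elim
      case (elim z)
      have "ennreal (indicator \<Omega> z * (cmod (J z))\<^sup>2) * indicator B (\<theta> z)
         = ennreal ((indicator \<Omega> z * indicator B (\<theta> z)) * (cmod (J z))\<^sup>2)"
        by (auto simp: indicator_def)
      also have "\<dots> = ennreal (\<Sum>\<zeta>\<in>Z. indicator (piece \<zeta> \<inter> \<theta> -` B) z * (cmod (J z))\<^sup>2)"
        by (simp only: ind[OF elim] sum_distrib_right)
      also have "\<dots> = (\<Sum>\<zeta>\<in>Z. ennreal (indicator (piece \<zeta> \<inter> \<theta> -` B) z * (cmod (J z))\<^sup>2))"
        by (rule sum_ennreal[symmetric]) simp
      finally show ?case .
    qed
  qed
  also have "\<dots> = (\<Sum>\<zeta>\<in>Z. \<integral>\<^sup>+z. ennreal (indicator (piece \<zeta> \<inter> \<theta> -` B) z * (cmod (J z))\<^sup>2) \<partial>lborel)"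
  proof (rule nn_integral_sum)
    fix \<zeta>
    have [measurable]: "piece \<zeta> \<inter> \<theta> -` B \<in> sets borel" using sets_piece pre by simp
    show "(\<lambda>z. ennreal (indicator (piece \<zeta> \<inter> \<theta> -` B) z * (cmod (J z))\<^sup>2)) \<in> borel_measurable lborel"
      by measurable
  qed
  also have "\<dots> = of_nat (card Z) * emeasure lborel (B \<inter> \<theta> ` (\<Omega> \<inter> reg))" by (simp add: each)
  also have "emeasure lborel (B \<inter> \<theta> ` (\<Omega> \<inter> reg)) = emeasure lborel (B \<inter> \<theta> ` \<Omega>)"
  proof (rule emeasure_eq_AE)
    have "open (\<theta> ` (\<Omega> \<inter> reg))" by (intro theta_open open_Int open_\<Omega> open_reg)
    then show "B \<inter> \<theta> ` (\<Omega> \<inter> reg) \<in> sets lborel" using B borel_open by simp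
    show "B \<inter> \<theta> ` \<Omega> \<in> sets lborel" using B by simp
    show "AE u in lborel. u \<in> B \<inter> \<theta> ` (\<Omega> \<inter> reg) \<longleftrightarrow> u \<in> B \<inter> \<theta> ` \<Omega>"
      using AE_theta_reg
    proof eventually_elim
      case (elim u)
      then obtain z where z: "z \<in> reg" "u = \<theta> z" by blast
      show ?case
      proof
        assume "u \<in> B \<inter> \<theta> ` \<Omega>"
        then have u: "u \<in> B" "z \<in> \<Omega>" by (simp_all add: z(2) theta_mem_iff)
        have "u \<in> \<theta> ` (\<Omega> \<inter> reg)" unfolding z(2) by (rule imageI) (simp add: u z(1))
        then show "u \<in> B \<inter> \<theta> ` (\<Omega> \<inter> reg)" using u by simp
      next
        assume "u \<in> B \<inter> \<theta> ` (\<Omega> \<inter> reg)"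
        then show "u \<in> B \<inter> \<theta> ` \<Omega>" by auto
      qed
    qed
  qed
  finally show ?thesis .
qed

lemma theta_distr:
  "distr (density lborel (\<lambda>z. ennreal (indicator \<Omega> z * (cmod (J z))\<^sup>2))) borel \<theta>
    = density lborel (\<lambda>u. of_nat (card Z) * indicator (\<theta> ` \<Omega>) u)"
proof (rule measure_eqI)
  fix B assume "B \<in> sets (distr (density lborel (\<lambda>z. ennreal (indicator \<Omega> z * (cmod (J z))\<^sup>2))) borel \<theta>)"
  then have B [measurable]: "B \<in> sets borel" by simp
  have pre: "\<theta> -` B \<in> sets borel" using measurable_sets[OF theta_borel B] by simp
  have "emeasure (distr (density lborel (\<lambda>z. ennreal (indicator \<Omega> z * (cmod (J z))\<^sup>2))) borel \<theta>) B
     = (\<integral>\<^sup>+z. ennreal (indicator \<Omega> z * (cmod (J z))\<^sup>2) * indicator (\<theta> -` B) z \<partial>lborel)"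
    using pre by (subst emeasure_distr) (auto simp: emeasure_density)
  also have "\<dots> = of_nat (card Z) * emeasure lborel (B \<inter> \<theta> ` \<Omega>)"
    using theta_change_of_variables[OF B] by (simp add: indicator_vimage)
  also have "\<dots> = (\<integral>\<^sup>+u. of_nat (card Z) * indicator (B \<inter> \<theta> ` \<Omega>) u \<partial>lborel)"
    by (subst nn_integral_cmult_indicator) auto
  also have "\<dots> = emeasure (density lborel (\<lambda>u. of_nat (card Z) * indicator (\<theta> ` \<Omega>) u)) B"
    by (subst emeasure_density) (auto intro!: nn_integral_cong simp: indicator_def)
  finally show "emeasure (distr (density lborel (\<lambda>z. ennreal (indicator \<Omega> z * (cmod (J z))\<^sup>2))) borel \<theta>) B
    = emeasure (density lborel (\<lambda>u. of_nat (card Z) * indicator (\<theta> ` \<Omega>) u)) B" .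
qed simp

lemma nn_integral_theta:
  assumes g: "g \<in> borel_measurable borel"
  shows "(\<integral>\<^sup>+z. ennreal (indicator \<Omega> z * (cmod (J z))\<^sup>2) * g (\<theta> z) \<partial>lborel)
    = of_nat (card Z) * (\<integral>\<^sup>+u. indicator (\<theta> ` \<Omega>) u * g u \<partial>lborel)"
proof -
  have "(\<integral>\<^sup>+z. ennreal (indicator \<Omega> z * (cmod (J z))\<^sup>2) * g (\<theta> z) \<partial>lborel)
     = (\<integral>\<^sup>+z. g (\<theta> z) \<partial>density lborel (\<lambda>z. ennreal (indicator \<Omega> z * (cmod (J z))\<^sup>2)))"
    using g by (subst nn_integral_density) auto
  also have "\<dots> = (\<integral>\<^sup>+u. g u \<partial>distr (density lborel (\<lambda>z. ennreal (indicator \<Omega> z * (cmod (J z))\<^sup>2))) borel \<theta>)"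
    using g by (subst nn_integral_distr) auto
  also have "\<dots> = (\<integral>\<^sup>+u. of_nat (card Z) * indicator (\<theta> ` \<Omega>) u * g u \<partial>lborel)"
    unfolding theta_distr using g by (subst nn_integral_density) auto
  also have "\<dots> = of_nat (card Z) * (\<integral>\<^sup>+u. indicator (\<theta> ` \<Omega>) u * g u \<partial>lborel)"
    using g by (subst nn_integral_cmult[symmetric]) (auto simp: mult.assoc)
  finally show ?thesis .
qed

section \<open>The two weighted measures\<close>

text \<open>The weight that belongs to the character with exponents \<open>c\<close>. In the
  measures \<open>\<mu>\<close> and \<open>\<nu>\<close> below, \<open>\<kappa>\<close> stands for
  the normalization of the volume.\<close>

definition W :: "('d \<Rightarrow> nat) \<Rightarrow> complex^'d \<Rightarrow> real" where
  "W c = omega \<Omega> \<theta> (\<lambda>z. monomial_fun c (y z)) wt"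

definition \<mu> :: "real \<Rightarrow> (complex^'d) measure" where
  "\<mu> \<kappa> = density lborel (\<lambda>z. ennreal (\<kappa> * (indicator \<Omega> z * wt (\<theta> z))))"

definition \<nu> :: "real \<Rightarrow> ('d \<Rightarrow> nat) \<Rightarrow> (complex^'d) measure" where
  "\<nu> \<kappa> c = density lborel (\<lambda>u. ennreal (\<kappa> * (indicator (\<theta> ` \<Omega>) u * W c u)))"

text \<open>Two preimages of the same point differ by a group element, which changes neither
  \<open>|ell_c|\<close> nor \<open>|J|\<close>; so the preimage chosen in the definition of the
  weight does not matter.\<close>

lemma W_theta:
  assumes z: "z \<in> \<Omega>"
  shows "W c (\<theta> z) = (cmod (monomial_fun c (y z)))\<^sup>2 / (cmod (J z))\<^sup>2 * wt (\<theta> z)"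
proof -
  define w where "w = (SOME w. w \<in> \<Omega> \<and> \<theta> w = \<theta> z)"
  have w: "w \<in> \<Omega> \<and> \<theta> w = \<theta> z" unfolding w_def by (rule someI[of _ z]) (use z in simp)
  then obtain \<zeta> where "\<zeta> \<in> Z" "w = D \<zeta> *v z" using theta_eq_iff by metis
  then show ?thesis by (simp add: W_def omega_def Let_def w_def[symmetric] norm_chi_D norm_jacobian_D)
qed

lemma wt_theta_cont: "continuous_on \<Omega> (\<lambda>z. wt (\<theta> z))"
  by (rule continuous_on_compose2[OF wt_cont theta_continuous]) simp

lemma weight_borel [measurable]:
  "(\<lambda>z. indicator \<Omega> z * wt (\<theta> z)) \<in> borel_measurable borel"
  "(\<lambda>u. indicator (\<theta> ` \<Omega>) u * W c u) \<in> borel_measurable borel"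
proof -
  show "(\<lambda>z. indicator \<Omega> z * wt (\<theta> z)) \<in> borel_measurable borel"
    using borel_measurable_continuous_on_indicator[OF _ wt_theta_cont] by simp
  define \<Omega>1 where "\<Omega>1 = {z \<in> \<Omega>. J z \<noteq> 0}"
  have O1: "open \<Omega>1"
  proof -
    have "open {z. J z \<noteq> 0}" by (intro open_Collect_neq continuous_jacobian continuous_on_const)
    moreover have "\<Omega>1 = \<Omega> \<inter> {z. J z \<noteq> 0}" by (auto simp: \<Omega>1_def)
    ultimately show ?thesis using open_\<Omega> by (simp only:) (rule open_Int)
  qed
  have "continuous_on \<Omega>1 (\<lambda>z. (cmod (monomial_fun c (y z)))\<^sup>2 / (cmod (J z))\<^sup>2 * wt (\<theta> z))"
    unfolding monomial_fun_def y_def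
    by (intro continuous_intros continuous_linear_map continuous_jacobian continuous_on_subset[OF wt_theta_cont])
       (auto simp: \<Omega>1_def)
  then have "continuous_on \<Omega>1 (\<lambda>z. W c (\<theta> z))"
    by (rule continuous_on_eq) (simp add: \<Omega>1_def W_theta)
  then have "continuous_on (\<theta> ` \<Omega>1) (W c)" by (rule continuous_on_descend[OF O1])
  then have "(\<lambda>u. indicator (\<theta> ` \<Omega>1) u *\<^sub>R W c u) \<in> borel_measurable borel"
    by (intro borel_measurable_continuous_on_indicator borel_open theta_open O1)
  moreover have "indicator (\<theta> ` \<Omega>1) u *\<^sub>R W c u = indicator (\<theta> ` \<Omega>) u * W c u" for u
  proof (cases "u \<in> \<theta> ` \<Omega> - \<theta> ` \<Omega>1")
    \<comment> \<open>Where \<open>J\<close> vanishes, the weight is 0 because of \<open>x / 0 =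
      0\<close>.\<close>
    case True
    then obtain z where "z \<in> \<Omega>" "u = \<theta> z" "J z = 0" by (auto simp: \<Omega>1_def)
    then show ?thesis by (simp add: W_theta)
  next
    case False
    then show ?thesis by (auto simp: indicator_def \<Omega>1_def)
  qed
  ultimately show "(\<lambda>u. indicator (\<theta> ` \<Omega>) u * W c u) \<in> borel_measurable borel" by (simp only:)
qed

lemma W_nonneg: "indicator (\<theta> ` \<Omega>) u * W c u \<ge> 0"
proof (cases "u \<in> \<theta> ` \<Omega>")
  case True
  then obtain z where "z \<in> \<Omega>" "u = \<theta> z" by blast
  then show ?thesis using wt_pos[OF True] by (simp add: W_theta)
qed simp

lemma wt_nonneg: "indicator \<Omega> z * wt (\<theta> z) \<ge> 0"
  using wt_pos by (auto simp: indicator_def intro: less_imp_le)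

text \<open>By definition of the weight, \<open>|ell_c|\<^sup>2 \<omega> = (W c \<circ> \<theta>)
  |J|\<^sup>2\<close> at regular points, and \<open>\<theta>\<close> is \<open>card
  Z\<close>-to-one.\<close>

theorem distr_mu_theta:
  assumes \<kappa>: "\<kappa> > 0"
  shows "distr (density (\<mu> \<kappa>) (\<lambda>z. ennreal ((cmod (monomial_fun c (y z)))\<^sup>2))) borel \<theta>
    = density (\<nu> \<kappa> c) (\<lambda>_. ennreal (real (card Z)))"
proof (rule measure_eqI)
  let ?L = "distr (density (\<mu> \<kappa>) (\<lambda>z. ennreal ((cmod (monomial_fun c (y z)))\<^sup>2))) borel \<theta>"
  fix B assume "B \<in> sets ?L"
  then have B [measurable]: "B \<in> sets borel" by simp
  have pre [measurable]: "\<theta> -` B \<in> sets borel" using measurable_sets[OF theta_borel B] by simp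
  define g where "g u = ennreal (\<kappa> * (indicator (\<theta> ` \<Omega>) u * W c u)) * indicator B u" for u
  have g: "g \<in> borel_measurable borel" unfolding g_def[abs_def] by measurable
  have chi2 [measurable]: "(\<lambda>z. ennreal ((cmod (monomial_fun c (y z)))\<^sup>2)) \<in> borel_measurable borel" by measurable
  have "emeasure ?L B = (\<integral>\<^sup>+z. ennreal ((cmod (monomial_fun c (y z)))\<^sup>2) * indicator (\<theta> -` B) z \<partial>\<mu> \<kappa>)"
    by (subst emeasure_distr) (auto simp: emeasure_density \<mu>_def)
  also have "\<dots> = (\<integral>\<^sup>+z. ennreal (\<kappa> * (indicator \<Omega> z * wt (\<theta> z))) *
      (ennreal ((cmod (monomial_fun c (y z)))\<^sup>2) * indicator (\<theta> -` B) z) \<partial>lborel)"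
    unfolding \<mu>_def by (subst nn_integral_density) auto
  also have "\<dots> = (\<integral>\<^sup>+z. ennreal (indicator \<Omega> z * (cmod (J z))\<^sup>2) * g (\<theta> z) \<partial>lborel)"
  proof (rule nn_integral_cong_AE)
    show "AE z in lborel. ennreal (\<kappa> * (indicator \<Omega> z * wt (\<theta> z))) *
        (ennreal ((cmod (monomial_fun c (y z)))\<^sup>2) * indicator (\<theta> -` B) z)
      = ennreal (indicator \<Omega> z * (cmod (J z))\<^sup>2) * g (\<theta> z)"
      using AE_reg
    proof eventually_elim
      case (elim z)
      show ?case
      proof (cases "z \<in> \<Omega> \<and> \<theta> z \<in> B")
        case True
        have J0: "J z \<noteq> 0" using elim by (intro jacobian_nonzero) (simp add: reg_def)
        have w: "wt (\<theta> z) > 0" using True wt_pos by blast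
        have "ennreal (\<kappa> * wt (\<theta> z)) * ennreal ((cmod (monomial_fun c (y z)))\<^sup>2)
           = ennreal ((cmod (J z))\<^sup>2 * (\<kappa> * ((cmod (monomial_fun c (y z)))\<^sup>2 / (cmod (J z))\<^sup>2 * wt (\<theta> z))))"
          using J0 w \<kappa> by (subst ennreal_mult[symmetric]) (auto simp: field_simps)
        also have "\<dots> = ennreal ((cmod (J z))\<^sup>2) * ennreal (\<kappa> * ((cmod (monomial_fun c (y z)))\<^sup>2 / (cmod (J z))\<^sup>2 * wt (\<theta> z)))"
          using w \<kappa> by (intro ennreal_mult) auto
        finally show ?thesis using True by (simp add: g_def W_theta)
      next
        case False
        then show ?thesis by (auto simp: g_def)
      qed
    qed
  qed
  also have "\<dots> = of_nat (card Z) * (\<integral>\<^sup>+u. indicator (\<theta> ` \<Omega>) u * g u \<partial>lborel)"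
    by (rule nn_integral_theta[OF g])
  also have "(\<integral>\<^sup>+u. indicator (\<theta> ` \<Omega>) u * g u \<partial>lborel) = (\<integral>\<^sup>+u. g u \<partial>lborel)"
    by (intro nn_integral_cong) (auto simp: g_def indicator_def)
  also have "\<dots> = (\<integral>\<^sup>+u. indicator B u \<partial>\<nu> \<kappa> c)"
    unfolding \<nu>_def g_def by (subst nn_integral_density) auto
  also have "of_nat (card Z) * \<dots> = emeasure (density (\<nu> \<kappa> c) (\<lambda>_. ennreal (real (card Z)))) B"
    by (simp add: emeasure_density nn_integral_cmult \<nu>_def ennreal_of_nat_eq_real_of_nat)
  finally show "emeasure ?L B = emeasure (density (\<nu> \<kappa> c) (\<lambda>_. ennreal (real (card Z)))) B" .
qed (simp add: \<nu>_def)

lemma integral_theta: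
  fixes F :: "complex^'d \<Rightarrow> 'b :: {banach, second_countable_topology}"
  assumes \<kappa>: "\<kappa> > 0" and F: "F \<in> borel_measurable borel"
  shows "integrable (\<mu> \<kappa>) (\<lambda>z. (cmod (monomial_fun c (y z)))\<^sup>2 *\<^sub>R F (\<theta> z)) \<longleftrightarrow> integrable (\<nu> \<kappa> c) F" (is ?A)
    and "(LINT z|\<mu> \<kappa>. (cmod (monomial_fun c (y z)))\<^sup>2 *\<^sub>R F (\<theta> z)) = real (card Z) *\<^sub>R (LINT u|\<nu> \<kappa> c. F u)" (is ?B)
proof -
  have m: "(\<lambda>z. F (\<theta> z)) \<in> borel_measurable (\<mu> \<kappa>)" "F \<in> borel_measurable (\<nu> \<kappa> c)"
    "(\<lambda>z. (cmod (monomial_fun c (y z)))\<^sup>2) \<in> borel_measurable (\<mu> \<kappa>)"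
    "\<theta> \<in> measurable (density (\<mu> \<kappa>) (\<lambda>z. ennreal ((cmod (monomial_fun c (y z)))\<^sup>2))) borel"
    using F by (auto simp: \<mu>_def \<nu>_def)
  have c0: "real (card Z) \<noteq> 0" using card_Z_pos by simp
  have "integrable (\<mu> \<kappa>) (\<lambda>z. (cmod (monomial_fun c (y z)))\<^sup>2 *\<^sub>R F (\<theta> z))
    \<longleftrightarrow> integrable (density (\<mu> \<kappa>) (\<lambda>z. ennreal ((cmod (monomial_fun c (y z)))\<^sup>2))) (\<lambda>z. F (\<theta> z))"
    using m by (subst integrable_density) auto
  also have "\<dots> \<longleftrightarrow> integrable (density (\<nu> \<kappa> c) (\<lambda>_. ennreal (real (card Z)))) F"
    unfolding distr_mu_theta[OF \<kappa>, symmetric] using m F by (subst integrable_distr_eq) auto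
  also have "\<dots> \<longleftrightarrow> integrable (\<nu> \<kappa> c) (\<lambda>u. real (card Z) *\<^sub>R F u)"
    using m by (subst integrable_density) auto
  also have "\<dots> \<longleftrightarrow> integrable (\<nu> \<kappa> c) F"
  proof
    assume "integrable (\<nu> \<kappa> c) (\<lambda>u. real (card Z) *\<^sub>R F u)"
    then have "integrable (\<nu> \<kappa> c) (\<lambda>u. (1 / real (card Z)) *\<^sub>R (real (card Z) *\<^sub>R F u))"
      by (rule Bochner_Integration.integrable_scaleR_right)
    then show "integrable (\<nu> \<kappa> c) F" using c0 by simp
  next
    assume "integrable (\<nu> \<kappa> c) F"
    then show "integrable (\<nu> \<kappa> c) (\<lambda>u. real (card Z) *\<^sub>R F u)"
      by (rule Bochner_Integration.integrable_scaleR_right)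
  qed
  finally show ?A .
  have "(LINT z|\<mu> \<kappa>. (cmod (monomial_fun c (y z)))\<^sup>2 *\<^sub>R F (\<theta> z))
    = (LINT z|density (\<mu> \<kappa>) (\<lambda>z. ennreal ((cmod (monomial_fun c (y z)))\<^sup>2)). F (\<theta> z))"
    using m by (subst integral_density) auto
  also have "\<dots> = (LINT u|density (\<nu> \<kappa> c) (\<lambda>_. ennreal (real (card Z))). F u)"
    unfolding distr_mu_theta[OF \<kappa>, symmetric] using m F by (subst integral_distr) auto
  also have "\<dots> = (LINT u|\<nu> \<kappa> c. real (card Z) *\<^sub>R F u)"
    using m by (subst integral_density) auto
  finally show ?B by simp
qed

lemma distr_mu_D:
  assumes \<zeta>: "\<zeta> \<in> Z"
  shows "distr (\<mu> \<kappa>) borel ((*v) (D \<zeta>)) = \<mu> \<kappa>"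
proof (rule measure_eqI)
  fix B assume "B \<in> sets (distr (\<mu> \<kappa>) borel ((*v) (D \<zeta>)))"
  then have B [measurable]: "B \<in> sets borel" by simp
  note D_borel[measurable]
  have pre [measurable]: "(*v) (D \<zeta>) -` B \<in> sets borel" using measurable_sets[OF D_borel B] by simp
  define g where "g z = ennreal (\<kappa> * (indicator \<Omega> z * wt (\<theta> z))) * indicator B z" for z
  have g [measurable]: "g \<in> borel_measurable borel" unfolding g_def[abs_def] by measurable
  have det: "cmod (det (D \<zeta>)) = 1" by (simp add: det_D prod_norm[symmetric] Z_cmod[OF \<zeta>])
  have inv: "D \<zeta> *v z \<in> \<Omega> \<longleftrightarrow> z \<in> \<Omega>" for z
    using theta_mem_iff[of "D \<zeta> *v z"] theta_mem_iff[of z] theta_invariant_polynomial(2)[OF \<zeta>, of z] by simp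
  have "emeasure (distr (\<mu> \<kappa>) borel ((*v) (D \<zeta>))) B
      = (\<integral>\<^sup>+z. ennreal (\<kappa> * (indicator \<Omega> z * wt (\<theta> z))) * indicator ((*v) (D \<zeta>) -` B) z \<partial>lborel)"
    by (subst emeasure_distr) (auto simp: emeasure_density \<mu>_def)
  also have "\<dots> = (\<integral>\<^sup>+z. g (D \<zeta> *v z) \<partial>lborel)"
    by (intro nn_integral_cong)
       (simp add: g_def indicator_def inv theta_invariant_polynomial(2)[OF \<zeta>])
  also have "\<dots> = (\<integral>\<^sup>+z. g z \<partial>distr lborel borel ((*v) (D \<zeta>)))"
    by (subst nn_integral_distr) auto
  also have "\<dots> = emeasure (\<mu> \<kappa>) B"
    by (simp add: distr_lborel_unimodular[OF det] \<mu>_def emeasure_density g_def)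
  finally show "emeasure (distr (\<mu> \<kappa>) borel ((*v) (D \<zeta>))) B = emeasure (\<mu> \<kappa>) B" .
qed (simp add: \<mu>_def)

lemma density_lower_bound:
  fixes w :: "complex^'d \<Rightarrow> real"
  assumes w: "w \<in> borel_measurable borel" and \<delta>: "AE z in lborel. z \<in> S \<longrightarrow> \<delta> \<le> w z"
    and g: "g \<in> borel_measurable borel" and S: "S \<in> sets borel"
  shows "ennreal \<delta> * (\<integral>\<^sup>+z. g z * indicator S z \<partial>lborel) \<le> (\<integral>\<^sup>+z. g z \<partial>density lborel (\<lambda>z. ennreal (w z)))"
proof -
  have "ennreal \<delta> * (\<integral>\<^sup>+z. g z * indicator S z \<partial>lborel) = (\<integral>\<^sup>+z. ennreal \<delta> * (g z * indicator S z) \<partial>lborel)"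
    using g S by (subst nn_integral_cmult) auto
  also have "\<dots> \<le> (\<integral>\<^sup>+z. ennreal (w z) * g z \<partial>lborel)"
  proof (rule nn_integral_mono_AE)
    show "AE z in lborel. ennreal \<delta> * (g z * indicator S z) \<le> ennreal (w z) * g z"
      using \<delta>
    proof eventually_elim
      case (elim z)
      then show ?case by (cases "z \<in> S") (auto intro: mult_right_mono ennreal_leI)
    qed
  qed
  also have "\<dots> = (\<integral>\<^sup>+z. g z \<partial>density lborel (\<lambda>z. ennreal (w z)))"
    using w g by (subst nn_integral_density) auto
  finally show ?thesis .
qed

lemma continuous_pos_locally_bounded_below:
  fixes f :: "complex^'d \<Rightarrow> real"
  assumes "open U" "continuous_on U f" "z \<in> U" "f z > 0"
  obtains r where "r > 0" "ball z r \<subseteq> U" "\<And>w. w \<in> ball z r \<Longrightarrow> f z / 2 \<le> f w"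
proof -
  have "open (f -` {f z / 2 <..} \<inter> U)"
    using assms(1,2) continuous_on_open_vimage[OF assms(1)] open_greaterThan by blast
  moreover have "z \<in> f -` {f z / 2 <..} \<inter> U" using assms by simp
  ultimately obtain r where r: "r > 0" "ball z r \<subseteq> f -` {f z / 2 <..} \<inter> U"
    using open_contains_ball by blast
  show thesis
  proof (rule that[OF r(1)])
    show "ball z r \<subseteq> U" using r by blast
    show "f z / 2 \<le> f w" if "w \<in> ball z r" for w using r(2) that by (auto simp: subset_iff less_imp_le)
  qed
qed

lemma bergman_measure_mu:
  assumes \<kappa>: "\<kappa> > 0" shows "bergman_measure (\<mu> \<kappa>) \<Omega>"
proof
  show "open \<Omega>" by (rule open_\<Omega>)
  show "sets (\<mu> \<kappa>) = sets borel" by (simp add: \<mu>_def)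
  fix z assume z: "z \<in> \<Omega>"
  then have pos: "wt (\<theta> z) > 0" using wt_pos by blast
  obtain r where r: "r > 0" "ball z r \<subseteq> \<Omega>" "\<And>w. w \<in> ball z r \<Longrightarrow> wt (\<theta> z) / 2 \<le> wt (\<theta> w)"
    using continuous_pos_locally_bounded_below[OF open_\<Omega> wt_theta_cont z pos] by blast
  show "\<exists>r>0. \<exists>\<delta>>0. ball z r \<subseteq> \<Omega> \<and> (\<forall>g\<in>borel_measurable borel.
      ennreal \<delta> * (\<integral>\<^sup>+w. g w * indicator (ball z r) w \<partial>lborel) \<le> (\<integral>\<^sup>+w. g w \<partial>\<mu> \<kappa>))"
  proof (intro exI conjI ballI)
    show "r > 0" "ball z r \<subseteq> \<Omega>" by (rule r)+
    show "\<kappa> * (wt (\<theta> z) / 2) > 0" using \<kappa> pos by simp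
    fix g :: "complex^'d \<Rightarrow> ennreal" assume g: "g \<in> borel_measurable borel"
    show "ennreal (\<kappa> * (wt (\<theta> z) / 2)) * (\<integral>\<^sup>+w. g w * indicator (ball z r) w \<partial>lborel) \<le> (\<integral>\<^sup>+w. g w \<partial>\<mu> \<kappa>)"
      unfolding \<mu>_def
    proof (rule density_lower_bound[OF _ _ g])
      show "AE w in lborel. w \<in> ball z r \<longrightarrow> \<kappa> * (wt (\<theta> z) / 2) \<le> \<kappa> * (indicator \<Omega> w * wt (\<theta> w))"
      proof (rule AE_I2, rule impI)
        fix w assume w: "w \<in> ball z r"
        then have "w \<in> \<Omega>" using r by blast
        then show "\<kappa> * (wt (\<theta> z) / 2) \<le> \<kappa> * (indicator \<Omega> w * wt (\<theta> w))"
          using \<kappa> r(3)[OF w] by simp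
      qed
    qed auto
  qed
qed

text \<open>On the bounded set \<open>\<Omega>\<close> the quotient \<open>|J| / |ell_c|\<close>
  is bounded, uniformly up to the factor \<open>|det dPhi|\<close>: every coordinate enters
  \<open>J\<close> with exponent \<open>m j - 1 \<ge> c j\<close>. So the weight is at least the
  continuous positive function \<open>f\<close>, even near the critical values.\<close>

lemma bergman_measure_nu:
  assumes \<kappa>: "\<kappa> > 0" and c: "c \<in> C" shows "bergman_measure (\<nu> \<kappa> c) (\<theta> ` \<Omega>)"
proof
  show "open (\<theta> ` \<Omega>)" by (rule theta_open[OF open_\<Omega>])
  show "sets (\<nu> \<kappa> c) = sets borel" by (simp add: \<nu>_def)
  have "bounded (y ` \<Omega>)"
  proof -
    have "compact (y ` closure \<Omega>)"
      unfolding y_def[abs_def] using bounded_\<Omega> by (intro compact_continuous_image continuous_linear_map) simp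
    then show ?thesis
      by (rule bounded_subset[OF compact_imp_bounded]) (simp add: image_mono closure_subset)
  qed
  then obtain R0 where R0: "\<And>z. z \<in> \<Omega> \<Longrightarrow> norm (y z) \<le> R0" by (auto simp: bounded_iff)
  define R where "R = max 1 R0"
  have R: "R \<ge> 1" "\<And>z j. z \<in> \<Omega> \<Longrightarrow> cmod (y z $ j) \<le> R"
  proof -
    show "R \<ge> 1" by (simp add: R_def)
    fix z j assume "z \<in> \<Omega>"
    then have "cmod (y z $ j) \<le> R0"
      using order_trans[OF Finite_Cartesian_Product.norm_nth_le R0] by blast
    then show "cmod (y z $ j) \<le> R" by (simp add: R_def)
  qed
  define E where "E = (\<Prod>i\<in>UNIV. real (m i) * R ^ (m i - 1)) * cmod (det P)"
  have E: "E > 0" using R(1) m_pos det_P by (auto simp: E_def intro!: mult_pos_pos prod_pos)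
  define f where "f u = wt u / (cmod (det (dPhi (\<Psi> u))) * E)\<^sup>2" for u
  have fc: "continuous_on (\<theta> ` \<Omega>) f"
    unfolding f_def
    by (intro continuous_intros wt_cont continuous_on_compose2[OF continuous_det_dPhi[of UNIV]]
        polynomial_map_continuous Psi_polynomial) (use det_dPhi_nonzero E in auto)
  have W_ge: "f u \<le> W c u" if u: "u \<in> \<theta> ` \<Omega>" "u \<in> \<theta> ` reg" for u
  proof -
    obtain z where z: "z \<in> \<Omega>" "u = \<theta> z" using u(1) by blast
    have zr: "z \<in> reg" using u(2) by (simp only: z(2) theta_mem_reg)
    have J0: "J z \<noteq> 0" using zr by (intro jacobian_nonzero) (simp add: reg_def)
    have "cmod (J z) \<le> cmod (monomial_fun c (y z)) * (cmod (det (dPhi (\<Psi> u))) * E)"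
    proof -
      have "(\<Prod>i\<in>UNIV. real (m i) * cmod (y z $ i) ^ (m i - 1))
          \<le> (\<Prod>i\<in>UNIV. cmod (y z $ i) ^ c i * (real (m i) * R ^ (m i - 1)))"
      proof (rule prod_mono, rule conjI)
        fix i
        have ci: "c i \<le> m i - 1" using c by (auto simp: C_def dest!: spec[of _ i])
        have "cmod (y z $ i) ^ (m i - 1) = cmod (y z $ i) ^ c i * cmod (y z $ i) ^ (m i - 1 - c i)"
        proof -
          have e: "m i - 1 = c i + (m i - 1 - c i)" using ci by simp
          show ?thesis unfolding power_add[symmetric] by (rule arg_cong[OF e])
        qed
        also have "\<dots> \<le> cmod (y z $ i) ^ c i * R ^ (m i - 1)"
          using R ci z(1) by (intro mult_left_mono order_trans[OF power_mono[OF R(2)] power_increasing]) auto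
        finally show "real (m i) * cmod (y z $ i) ^ (m i - 1) \<le> cmod (y z $ i) ^ c i * (real (m i) * R ^ (m i - 1))"
          by (simp add: mult.left_commute mult_left_mono)
      qed simp
      also have "\<dots> = cmod (monomial_fun c (y z)) * (\<Prod>i\<in>UNIV. real (m i) * R ^ (m i - 1))"
        by (simp add: prod.distrib monomial_fun_def prod_norm[symmetric] norm_power)
      finally have *: "(\<Prod>i\<in>UNIV. real (m i) * cmod (y z $ i) ^ (m i - 1))
          \<le> cmod (monomial_fun c (y z)) * (\<Prod>i\<in>UNIV. real (m i) * R ^ (m i - 1))" .
      have "cmod (J z) = (cmod (det (dPhi (\<Psi> u))) * cmod (det P)) * (\<Prod>i\<in>UNIV. real (m i) * cmod (y z $ i) ^ (m i - 1))"
        by (simp add: jacobian_formula norm_mult prod_norm[symmetric] norm_power z(2) pi_eq_Psi)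
      also have "\<dots> \<le> (cmod (det (dPhi (\<Psi> u))) * cmod (det P)) * (cmod (monomial_fun c (y z)) * (\<Prod>i\<in>UNIV. real (m i) * R ^ (m i - 1)))"
        by (intro mult_left_mono *) simp
      finally show ?thesis by (simp add: E_def mult_ac)
    qed
    then have "(cmod (J z))\<^sup>2 \<le> (cmod (monomial_fun c (y z)))\<^sup>2 * (cmod (det (dPhi (\<Psi> u))) * E)\<^sup>2"
      by (metis norm_ge_zero power_mono power_mult_distrib)
    moreover have "(cmod (det (dPhi (\<Psi> u))) * E)\<^sup>2 > 0" using det_dPhi_nonzero E by simp
    moreover have "(cmod (J z))\<^sup>2 > 0" using J0 by simp
    ultimately have "1 / (cmod (det (dPhi (\<Psi> u))) * E)\<^sup>2 \<le> (cmod (monomial_fun c (y z)))\<^sup>2 / (cmod (J z))\<^sup>2"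
      by (simp add: divide_simps mult.commute)
    then have "1 / (cmod (det (dPhi (\<Psi> u))) * E)\<^sup>2 * wt u \<le> (cmod (monomial_fun c (y z)))\<^sup>2 / (cmod (J z))\<^sup>2 * wt u"
      using wt_pos[OF u(1)] by (intro mult_right_mono) auto
    then show ?thesis using W_theta[OF z(1), of c] by (simp add: f_def z(2))
  qed
  fix u assume u: "u \<in> \<theta> ` \<Omega>"
  have pos: "f u > 0" using wt_pos[OF u] det_dPhi_nonzero E by (simp add: f_def)
  obtain r where r: "r > 0" "ball u r \<subseteq> \<theta> ` \<Omega>" "\<And>w. w \<in> ball u r \<Longrightarrow> f u / 2 \<le> f w"
    using continuous_pos_locally_bounded_below[OF theta_open[OF open_\<Omega>] fc u pos] by blast
  show "\<exists>r>0. \<exists>\<delta>>0. ball u r \<subseteq> \<theta> ` \<Omega> \<and> (\<forall>g\<in>borel_measurable borel.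
      ennreal \<delta> * (\<integral>\<^sup>+w. g w * indicator (ball u r) w \<partial>lborel) \<le> (\<integral>\<^sup>+w. g w \<partial>\<nu> \<kappa> c))"
  proof (intro exI conjI ballI)
    show "r > 0" "ball u r \<subseteq> \<theta> ` \<Omega>" by (rule r)+
    show "\<kappa> * (f u / 2) > 0" using \<kappa> pos by simp
    fix g :: "complex^'d \<Rightarrow> ennreal" assume g: "g \<in> borel_measurable borel"
    show "ennreal (\<kappa> * (f u / 2)) * (\<integral>\<^sup>+w. g w * indicator (ball u r) w \<partial>lborel) \<le> (\<integral>\<^sup>+w. g w \<partial>\<nu> \<kappa> c)"
      unfolding \<nu>_def
    proof (rule density_lower_bound[OF _ _ g])
      show "AE w in lborel. w \<in> ball u r \<longrightarrow> \<kappa> * (f u / 2) \<le> \<kappa> * (indicator (\<theta> ` \<Omega>) w * W c w)"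
        using AE_theta_reg
      proof eventually_elim
        case (elim w)
        show ?case
        proof
          assume w: "w \<in> ball u r"
          then have wO: "w \<in> \<theta> ` \<Omega>" using r by blast
          then show "\<kappa> * (f u / 2) \<le> \<kappa> * (indicator (\<theta> ` \<Omega>) w * W c w)"
            using \<kappa> r(3)[OF w] W_ge[OF wO elim] by simp
        qed
      qed
    qed auto
  qed
qed

end

section \<open>Bergman spaces as spaces of square-integrable holomorphic functions\<close>

lemma scale_measure_eq_density: "scale_measure r M = density M (\<lambda>_. r)"
  by (rule measure_eqI) (auto simp: emeasure_density_const)

lemma normalized_volume_density:
  assumes "open \<Omega>" "bounded \<Omega>" "\<Omega> \<noteq> {}"
  shows "\<exists>\<kappa>>0. normalized_volume \<Omega> = density lebesgue (\<lambda>_. ennreal \<kappa>)"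
proof -
  have fin: "emeasure lborel \<Omega> < \<infinity>" using emeasure_bounded_finite assms(2) by blast
  then have eq: "emeasure lborel \<Omega> = ennreal (measure lborel \<Omega>)"
    by (intro emeasure_eq_ennreal_measure) (auto simp: less_top)
  obtain z r where r: "r > 0" "ball z r \<subseteq> \<Omega>" using assms(1,3) open_contains_ball by blast
  have "0 < measure lborel (ball z r)" using r by (simp add: content_ball_pos)
  then have "0 < emeasure lborel (ball z r)" by (simp add: measure_def enn2real_positive_iff)
  also have "\<dots> \<le> emeasure lborel \<Omega>" using assms(1) r by (intro emeasure_mono) auto
  finally have pos: "0 < measure lborel \<Omega>" using eq by simp
  have "emeasure lebesgue \<Omega> = emeasure lborel \<Omega>" using assms(1) by simp
  then have "1 / emeasure lebesgue \<Omega> = ennreal (1 / measure lborel \<Omega>)"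
    using pos by (simp add: eq divide_ennreal[symmetric])
  then show ?thesis using pos
    by (intro exI[of _ "1 / measure lborel \<Omega>"]) (simp add: normalized_volume_def scale_measure_eq_density)
qed

lemma weighted_integral:
  fixes F :: "complex^'d \<Rightarrow> 'b :: {banach, second_countable_topology}"
  assumes \<kappa>: "\<kappa> > 0" and w: "w \<in> borel_measurable borel" "\<And>z. w z \<ge> 0" and F: "F \<in> borel_measurable borel"
  shows "integrable (density lebesgue (\<lambda>_. ennreal \<kappa>)) (\<lambda>z. w z *\<^sub>R F z)
      \<longleftrightarrow> integrable (density lborel (\<lambda>z. ennreal (\<kappa> * w z))) F" (is ?A)
    and "(LINT z|density lebesgue (\<lambda>_. ennreal \<kappa>). w z *\<^sub>R F z)
      = (LINT z|density lborel (\<lambda>z. ennreal (\<kappa> * w z)). F z)" (is ?B)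
proof -
  have wF: "(\<lambda>z. w z *\<^sub>R F z) \<in> borel_measurable lborel" using w F by simp
  have wFl: "(\<lambda>z. w z *\<^sub>R F z) \<in> borel_measurable lebesgue" using wF by (rule measurable_completion)
  have k: "(\<lambda>z. \<kappa> *\<^sub>R (w z *\<^sub>R F z)) \<in> borel_measurable lborel" using w F by simp
  have kw: "(\<lambda>z. \<kappa> * w z) \<in> borel_measurable lborel" "AE z in lborel. 0 \<le> \<kappa> * w z" using w \<kappa> by auto
  have Fl: "F \<in> borel_measurable lborel" using F by simp
  have "integrable (density lebesgue (\<lambda>_. ennreal \<kappa>)) (\<lambda>z. w z *\<^sub>R F z)
     \<longleftrightarrow> integrable lebesgue (\<lambda>z. \<kappa> *\<^sub>R (w z *\<^sub>R F z))"
    using \<kappa> wFl by (subst integrable_density) auto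
  also have "\<dots> \<longleftrightarrow> integrable lborel (\<lambda>z. \<kappa> *\<^sub>R (w z *\<^sub>R F z))" by (rule integrable_completion[OF k])
  also have "\<dots> \<longleftrightarrow> integrable (density lborel (\<lambda>z. ennreal (\<kappa> * w z))) F"
    by (subst integrable_density[OF Fl kw]) simp
  finally show ?A .
  have "(LINT z|density lebesgue (\<lambda>_. ennreal \<kappa>). w z *\<^sub>R F z) = (LINT z|lebesgue. \<kappa> *\<^sub>R (w z *\<^sub>R F z))"
    using \<kappa> wFl by (subst integral_density) auto
  also have "\<dots> = (LINT z|lborel. \<kappa> *\<^sub>R (w z *\<^sub>R F z))" by (rule integral_completion[OF k])
  also have "\<dots> = (LINT z|density lborel (\<lambda>z. ennreal (\<kappa> * w z)). F z)"
    by (subst integral_density[OF Fl kw]) simp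
  finally show ?B .
qed

text \<open>Members of the Bergman space are Borel functions, so the set integral against the
  completed measure is an ordinary integral against a Borel measure with density.\<close>

lemma bergman_space_L2:
  fixes D :: "(complex^'d) set"
  assumes \<kappa>: "\<kappa> > 0" and D: "open D" and w: "(\<lambda>z. indicator D z * v z) \<in> borel_measurable borel"
    and nn: "\<And>z. indicator D z * v z \<ge> 0"
  defines "X \<equiv> bergman_space (density lebesgue (\<lambda>_. ennreal \<kappa>)) D v"
    and "M \<equiv> density lborel (\<lambda>z. ennreal (\<kappa> * (indicator D z * v z)))"
  shows "vectors X = L2_holo M D"
    and "f \<in> L2_holo M D \<Longrightarrow> g \<in> L2_holo M D \<Longrightarrow> ip X f g = L2_ip M f g"
proof -
  have "set_integrable (density lebesgue (\<lambda>_. ennreal \<kappa>)) D (\<lambda>z. (cmod (f z))\<^sup>2 * v z)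
      \<longleftrightarrow> integrable M (\<lambda>z. (cmod (f z))\<^sup>2)"
    if "holomorphic_several f D" "\<And>z. z \<notin> D \<Longrightarrow> f z = 0" for f
  proof -
    have f: "f \<in> borel_measurable borel" by (rule extended_holomorphic_borel[OF D that])
    have "(\<lambda>z. indicator D z *\<^sub>R ((cmod (f z))\<^sup>2 * v z)) = (\<lambda>z. (indicator D z * v z) *\<^sub>R (cmod (f z))\<^sup>2)"
      by (simp add: fun_eq_iff mult_ac)
    then show ?thesis
      unfolding set_integrable_def M_def using weighted_integral(1)[OF \<kappa> w nn, of "\<lambda>z. (cmod (f z))\<^sup>2"] f by simp
  qed
  then show "vectors X = L2_holo M D"
    by (auto simp: X_def bergman_space_def L2_holo_def)
  assume fg: "f \<in> L2_holo M D" "g \<in> L2_holo M D"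
  have "f \<in> borel_measurable borel" "g \<in> borel_measurable borel"
    using fg extended_holomorphic_borel[OF D] by (auto simp: L2_holo_def)
  moreover have "cnj \<in> borel_measurable borel"
    by (intro borel_measurable_continuous_onI continuous_intros)
  ultimately have fg_m: "(\<lambda>z. f z * cnj (g z)) \<in> borel_measurable borel" by measurable
  have "(\<lambda>z. indicator D z *\<^sub>R (f z * cnj (g z) * of_real (v z)))
     = (\<lambda>z. (indicator D z * v z) *\<^sub>R (f z * cnj (g z)))"
    by (simp add: fun_eq_iff scaleR_conv_of_real mult_ac)
  then show "ip X f g = L2_ip M f g"
    unfolding X_def M_def bergman_space_def L2_ip_def
    using weighted_integral(2)[OF \<kappa> w nn fg_m] by (simp add: set_lebesgue_integral_def)
qed

context bergman_measure
begin

lemma reproducing_kernel_eqI: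
  assumes X: "vectors X = H" "\<And>f g. f \<in> H \<Longrightarrow> g \<in> H \<Longrightarrow> ip X f g = inp f g"
    and k: "k \<in> H" "\<And>f. f \<in> H \<Longrightarrow> f w = inp f k"
  shows "reproducing_kernel X z w = k z"
proof -
  have "(THE k. k \<in> vectors X \<and> (\<forall>f\<in>vectors X. f w = ip X f k)) = k"
  proof (rule the_equality)
    show "k \<in> vectors X \<and> (\<forall>f\<in>vectors X. f w = ip X f k)" using k X by simp
    fix k' assume k': "k' \<in> vectors X \<and> (\<forall>f\<in>vectors X. f w = ip X f k')"
    then have k'H: "k' \<in> H" using X by simp
    show "k' = k"
    proof (rule kernel_unique[OF k'H k(1)])
      fix f assume f: "f \<in> H"
      then have "f w = ip X f k'" using k' X by blast
      then show "inp f k' = inp f k" using X(2)[OF f k'H] k(2)[OF f] by simp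
    qed
  qed
  then show ?thesis by (simp add: reproducing_kernel_def)
qed

lemma reproducing_kernel:
  assumes X: "vectors X = H" "\<And>f g. f \<in> H \<Longrightarrow> g \<in> H \<Longrightarrow> ip X f g = inp f g" and w: "w \<in> D"
  shows "(\<lambda>z. reproducing_kernel X z w) \<in> H" "f \<in> H \<Longrightarrow> f w = inp f (\<lambda>z. reproducing_kernel X z w)"
proof -
  obtain k where k: "k \<in> H" "\<And>f. f \<in> H \<Longrightarrow> f w = inp f k" using kernel_exists[OF w] by blast
  have eq: "(\<lambda>z. reproducing_kernel X z w) = k" using reproducing_kernel_eqI[OF X k] by blast
  show "(\<lambda>z. reproducing_kernel X z w) \<in> H" "f \<in> H \<Longrightarrow> f w = inp f (\<lambda>z. reproducing_kernel X z w)"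
    unfolding eq using k by blast+
qed

lemma is_reproducing_kernel:
  assumes X: "vectors X = H" "\<And>f g. f \<in> H \<Longrightarrow> g \<in> H \<Longrightarrow> ip X f g = inp f g"
  shows "is_reproducing_kernel X D (reproducing_kernel X)"
  unfolding is_reproducing_kernel_def
proof (intro ballI conjI)
  fix w assume w: "w \<in> D"
  show "(\<lambda>z. reproducing_kernel X z w) \<in> vectors X" using reproducing_kernel(1)[OF X w] X(1) by simp
  fix f assume "f \<in> vectors X"
  then have f: "f \<in> H" using X by simp
  show "f w = ip X f (\<lambda>z. reproducing_kernel X z w)"
    using reproducing_kernel(2)[OF X w f] X(2)[OF f reproducing_kernel(1)[OF X w]] by simp
qed

end

text \<open>The natural isometry runs from the direct sum to the function space, opposite to the
  direction in which isomorphy is expressed.\<close>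

lemma isometrically_isomorphic_inverse:
  assumes bij: "bij_betw T (vectors Y) (vectors X)"
    and add: "\<And>f g. f \<in> vectors Y \<Longrightarrow> g \<in> vectors Y \<Longrightarrow> vadd Y f g \<in> vectors Y \<and> T (vadd Y f g) = vadd X (T f) (T g)"
    and scale: "\<And>c f. f \<in> vectors Y \<Longrightarrow> vscale Y c f \<in> vectors Y \<and> T (vscale Y c f) = vscale X c (T f)"
    and iso: "\<And>f g. f \<in> vectors Y \<Longrightarrow> g \<in> vectors Y \<Longrightarrow> ip X (T f) (T g) = ip Y f g"
  shows "isometrically_isomorphic X Y"
proof -
  define U where "U = inv_into (vectors Y) T"
  have U: "bij_betw U (vectors X) (vectors Y)" unfolding U_def by (rule bij_betw_inv_into[OF bij])
  have UY: "U f \<in> vectors Y" if "f \<in> vectors X" for f using U that by (rule bij_betw_apply)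
  have TU: "T (U f) = f" if "f \<in> vectors X" for f
    unfolding U_def by (rule bij_betw_inv_into_right[OF bij that])
  have UT: "U (T f) = f" if "f \<in> vectors Y" for f
    unfolding U_def by (rule bij_betw_inv_into_left[OF bij that])
  show ?thesis
    unfolding isometrically_isomorphic_def
  proof (intro exI[of _ U] conjI ballI allI)
    show "bij_betw U (vectors X) (vectors Y)" by (rule U)
    fix f assume f: "f \<in> vectors X"
    show "U (vscale X c f) = vscale Y c (U f)" for c
      using scale[OF UY[OF f], of c] UT[of "vscale Y c (U f)"] by (simp add: TU[OF f])
    fix g assume g: "g \<in> vectors X"
    show "U (vadd X f g) = vadd Y (U f) (U g)"
      using add[OF UY[OF f] UY[OF g]] UT[of "vadd Y (U f) (U g)"] by (simp add: TU[OF f] TU[OF g])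
    show "ip Y (U f) (U g) = ip X f g"
      using iso[OF UY[OF f] UY[OF g]] by (simp add: TU[OF f] TU[OF g])
  qed
qed

section \<open>The orthogonal decomposition\<close>

context bergman_quotient
begin

text \<open>Inverse to division by \<open>ell_c\<close> followed by descent along
  \<open>\<theta>\<close>, where \<open>ell_c\<close> is the polynomial \<open>monomial_fun c
  \<circ> y\<close>.\<close>

definition lift :: "('d \<Rightarrow> nat) \<Rightarrow> (complex^'d \<Rightarrow> complex) \<Rightarrow> complex^'d \<Rightarrow> complex" where
  "lift c h z = monomial_fun c (y z) * h (\<theta> z)"

abbreviation "HM \<kappa> \<equiv> L2_holo (\<mu> \<kappa>) \<Omega>"
abbreviation "HN \<kappa> c \<equiv> L2_holo (\<nu> \<kappa> c) (\<theta> ` \<Omega>)"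

lemma HN_borel: "h \<in> HN \<kappa> c \<Longrightarrow> h \<in> borel_measurable borel"
  using extended_holomorphic_borel[OF theta_open[OF open_\<Omega>]] by (auto simp: L2_holo_def)

lemma HM_borel: "f \<in> HM \<kappa> \<Longrightarrow> f \<in> borel_measurable borel"
  using extended_holomorphic_borel[OF open_\<Omega>] by (auto simp: L2_holo_def)

lemma chi_y_holomorphic: "holomorphic_several (\<lambda>z. monomial_fun c (y z)) U"
  unfolding monomial_fun_def y_def
  by (intro polynomials_holomorphic polynomials_prod polynomials_power polynomials_linear)

lemma lift_integrable_iff:
  assumes "\<kappa> > 0" "h \<in> borel_measurable borel"
  shows "integrable (\<mu> \<kappa>) (\<lambda>z. (cmod (lift c h z))\<^sup>2) \<longleftrightarrow> integrable (\<nu> \<kappa> c) (\<lambda>u. (cmod (h u))\<^sup>2)"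
  using integral_theta(1)[OF assms(1), of "\<lambda>u. (cmod (h u))\<^sup>2" c] assms(2)
  by (simp add: lift_def norm_mult power_mult_distrib)

lemma lift_mem:
  assumes \<kappa>: "\<kappa> > 0" and h: "h \<in> HN \<kappa> c" shows "lift c h \<in> HM \<kappa>"
proof -
  have "holomorphic_several (\<lambda>z. h (\<theta> z)) \<Omega>"
    by (rule holomorphic_several_compose[of h "\<theta> ` \<Omega>"])
       (use h in \<open>auto simp: L2_holo_def intro: polynomials_holomorphic theta_invariant_polynomial\<close>)
  then have "holomorphic_several (lift c h) \<Omega>"
    unfolding lift_def[abs_def] by (rule holomorphic_several_mult[OF chi_y_holomorphic])
  moreover have "lift c h z = 0" if "z \<notin> \<Omega>" for z
    using h that theta_mem_iff[of z] by (simp add: L2_holo_def lift_def)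
  moreover have "integrable (\<mu> \<kappa>) (\<lambda>z. (cmod (lift c h z))\<^sup>2)"
    unfolding lift_integrable_iff[OF \<kappa> HN_borel[OF h]] using h by (simp add: L2_holo_def)
  ultimately show ?thesis by (simp add: L2_holo_def)
qed

lemma lift_ip:
  assumes \<kappa>: "\<kappa> > 0" and h: "h \<in> HN \<kappa> c" "g \<in> HN \<kappa> c"
  shows "L2_ip (\<mu> \<kappa>) (lift c h) (lift c g) = of_nat (card Z) * L2_ip (\<nu> \<kappa> c) h g"
proof -
  have "cnj \<in> borel_measurable borel"
    by (intro borel_measurable_continuous_onI continuous_intros)
  then have hg: "(\<lambda>u. h u * cnj (g u)) \<in> borel_measurable borel"
    using h[THEN HN_borel] by measurable
  have "lift c h z * cnj (lift c g z) = (cmod (monomial_fun c (y z)))\<^sup>2 *\<^sub>R (h (\<theta> z) * cnj (g (\<theta> z)))" for z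
  proof -
    have "lift c h z * cnj (lift c g z) = (monomial_fun c (y z) * cnj (monomial_fun c (y z))) * (h (\<theta> z) * cnj (g (\<theta> z)))"
      by (simp add: lift_def)
    then show ?thesis by (simp only: complex_norm_square[symmetric] scaleR_conv_of_real)
  qed
  then show ?thesis
    using integral_theta(2)[OF \<kappa> hg, of c] by (simp add: L2_ip_def scaleR_conv_of_real)
qed

lemma rotate_mem_ip:
  assumes \<kappa>: "\<kappa> > 0" and \<zeta>: "\<zeta> \<in> Z" and f: "f \<in> HM \<kappa>"
  shows "(\<lambda>z. f (D \<zeta> *v z)) \<in> HM \<kappa>"
    and "g \<in> HM \<kappa> \<Longrightarrow> L2_ip (\<mu> \<kappa>) (\<lambda>z. f (D \<zeta> *v z)) (\<lambda>z. g (D \<zeta> *v z)) = L2_ip (\<mu> \<kappa>) f g"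
proof -
  have Dm: "(*v) (D \<zeta>) \<in> measurable (\<mu> \<kappa>) borel" using D_borel by (simp add: \<mu>_def)
  have fm: "f \<in> borel_measurable borel" by (rule HM_borel[OF f])
  have "integrable (distr (\<mu> \<kappa>) borel ((*v) (D \<zeta>))) (\<lambda>z. (cmod (f z))\<^sup>2)"
    using f by (simp add: distr_mu_D[OF \<zeta>] L2_holo_def)
  then have "integrable (\<mu> \<kappa>) (\<lambda>z. (cmod (f (D \<zeta> *v z)))\<^sup>2)"
    using fm by (subst (asm) integrable_distr_eq[OF Dm]) auto
  moreover have "holomorphic_several (\<lambda>z. f (D \<zeta> *v z)) \<Omega>"
    using f by (intro holomorphic_compose_D inv_\<Omega> \<zeta>) (auto simp: L2_holo_def)
  moreover have "f (D \<zeta> *v z) = 0" if "z \<notin> \<Omega>" for z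
  proof -
    have "D \<zeta> *v z \<notin> \<Omega>"
      using that theta_mem_iff[of "D \<zeta> *v z"] theta_mem_iff[of z] theta_invariant_polynomial(2)[OF \<zeta>, of z] by simp
    then show ?thesis using f by (simp add: L2_holo_def)
  qed
  ultimately show "(\<lambda>z. f (D \<zeta> *v z)) \<in> HM \<kappa>" by (simp add: L2_holo_def)
  assume g: "g \<in> HM \<kappa>"
  have "cnj \<in> borel_measurable borel"
    by (intro borel_measurable_continuous_onI continuous_intros)
  then have fg: "(\<lambda>u. f u * cnj (g u)) \<in> borel_measurable borel"
    using fm HM_borel[OF g] by measurable
  have "L2_ip (\<mu> \<kappa>) f g = (LINT z|distr (\<mu> \<kappa>) borel ((*v) (D \<zeta>)). f z * cnj (g z))"
    by (simp add: distr_mu_D[OF \<zeta>] L2_ip_def)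
  also have "\<dots> = L2_ip (\<mu> \<kappa>) (\<lambda>z. f (D \<zeta> *v z)) (\<lambda>z. g (D \<zeta> *v z))"
    using fg by (subst integral_distr[OF Dm]) (auto simp: L2_ip_def)
  finally show "L2_ip (\<mu> \<kappa>) (\<lambda>z. f (D \<zeta> *v z)) (\<lambda>z. g (D \<zeta> *v z)) = L2_ip (\<mu> \<kappa>) f g" ..
qed

text \<open>The rotation by \<open>D \<zeta>\<close> preserves the inner product and multiplies it
  by the value at \<open>\<zeta>\<close> of the character \<open>c\<close> times the conjugate of
  the character \<open>c'\<close>. Different characters differ at some
  \<open>\<zeta>\<close>.\<close>

lemma lift_orthogonal:
  assumes \<kappa>: "\<kappa> > 0" and c: "c \<in> C" "c' \<in> C" "c \<noteq> c'" and h: "h \<in> HN \<kappa> c" "g \<in> HN \<kappa> c'"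
  shows "L2_ip (\<mu> \<kappa>) (lift c h) (lift c' g) = 0"
proof (rule ccontr)
  interpret M: bergman_measure "\<mu> \<kappa>" \<Omega> by (rule bergman_measure_mu[OF \<kappa>])
  assume nz: "L2_ip (\<mu> \<kappa>) (lift c h) (lift c' g) \<noteq> 0"
  have rot: "(\<lambda>z. lift c h (D \<zeta> *v z)) = (\<lambda>z. monomial_fun c \<zeta> * lift c h z)" if "\<zeta> \<in> Z" for \<zeta> c h
    by (simp add: lift_def y_D chi_mult theta_invariant_polynomial(2)[OF that] mult_ac fun_eq_iff)
  have "monomial_fun c \<zeta> = monomial_fun c' \<zeta>" if \<zeta>: "\<zeta> \<in> Z" for \<zeta>
  proof -
    have "L2_ip (\<mu> \<kappa>) (lift c h) (lift c' g) = monomial_fun c \<zeta> * cnj (monomial_fun c' \<zeta>) * L2_ip (\<mu> \<kappa>) (lift c h) (lift c' g)"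
      using rotate_mem_ip(2)[OF \<kappa> \<zeta> lift_mem[OF \<kappa> h(1)] lift_mem[OF \<kappa> h(2)]]
      by (simp add: rot[OF \<zeta>] M.inp_scale_left M.inp_scale_right)
    then have "monomial_fun c \<zeta> * cnj (monomial_fun c' \<zeta>) = 1" using nz by simp
    then have "monomial_fun c \<zeta> * (cnj (monomial_fun c' \<zeta>) * monomial_fun c' \<zeta>) = monomial_fun c' \<zeta>" by (simp add: mult.assoc[symmetric])
    then show ?thesis using chi_cnj[OF \<zeta>, of c'] by (simp add: mult.commute)
  qed
  then show False using chi_separates c by blast
qed

text \<open>Each isotypic part of \<open>f\<close> is a combination of rotations of
  \<open>f\<close>, hence square-integrable; it is divided by \<open>ell_c\<close>, and the quotient
  descends to \<open>\<theta> ` \<Omega>\<close>.\<close>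

lemma components:
  assumes \<kappa>: "\<kappa> > 0" and f: "f \<in> HM \<kappa>"
  obtains h where "\<And>c. c \<in> C \<Longrightarrow> h c \<in> HN \<kappa> c" "\<And>z. f z = (\<Sum>c\<in>C. lift c (h c) z)"
proof -
  interpret M: bergman_measure "\<mu> \<kappa>" \<Omega> by (rule bergman_measure_mu[OF \<kappa>])
  have "\<exists>h. h \<in> HN \<kappa> c \<and> (\<forall>z. isotypic_part c f z = lift c h z)" if c: "c \<in> C" for c
  proof -
    have fh: "holomorphic_several f \<Omega>" and f0: "\<And>z. z \<notin> \<Omega> \<Longrightarrow> f z = 0" using f by (auto simp: L2_holo_def)
    have "(\<lambda>z. \<Sum>\<zeta>\<in>Z. (cnj (monomial_fun c \<zeta>) / of_nat (card Z)) * f (D \<zeta> *v z)) \<in> HM \<kappa>"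
      by (intro M.H_sum M.H_scale rotate_mem_ip(1)[OF \<kappa> _ f])
    moreover have "(\<lambda>z. \<Sum>\<zeta>\<in>Z. (cnj (monomial_fun c \<zeta>) / of_nat (card Z)) * f (D \<zeta> *v z)) = isotypic_part c f"
      by (simp add: fun_eq_iff isotypic_part_def sum_divide_distrib)
    ultimately have mem: "isotypic_part c f \<in> HM \<kappa>" by simp
    obtain q where q: "holomorphic_several q \<Omega>" "\<And>z. z \<in> \<Omega> \<Longrightarrow> isotypic_part c f z = monomial_fun c (y z) * q z"
      "\<And>\<zeta> z. \<zeta> \<in> Z \<Longrightarrow> z \<in> \<Omega> \<Longrightarrow> q (D \<zeta> *v z) = q z"
      using semi_invariant_divide[OF open_\<Omega> inv_\<Omega> isotypic_part_holomorphic[OF fh inv_\<Omega>] c isotypic_part_semi_invariant] by blast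
    obtain h where h: "holomorphic_several h (\<theta> ` \<Omega>)" "\<And>z. z \<in> \<Omega> \<Longrightarrow> h (\<theta> z) = q z"
      "\<And>u. u \<notin> \<theta> ` \<Omega> \<Longrightarrow> h u = 0"
      using invariant_descends[OF open_\<Omega> q(1) q(3)] by blast
    have eq: "isotypic_part c f z = lift c h z" for z
    proof (cases "z \<in> \<Omega>")
      case True
      then show ?thesis by (simp add: q(2) h(2) lift_def)
    next
      case False
      then have "isotypic_part c f z = 0" using mem by (simp add: L2_holo_def)
      then show ?thesis using False h(3) theta_mem_iff[of z] by (simp add: lift_def)
    qed
    have hb: "h \<in> borel_measurable borel"
      using extended_holomorphic_borel[OF theta_open[OF open_\<Omega>] h(1)] h(3) by blast
    have "integrable (\<mu> \<kappa>) (\<lambda>z. (cmod (lift c h z))\<^sup>2)" using mem by (simp add: L2_holo_def eq)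
    then have "integrable (\<nu> \<kappa> c) (\<lambda>u. (cmod (h u))\<^sup>2)" by (simp only: lift_integrable_iff[OF \<kappa> hb])
    then show ?thesis using h eq by (intro exI[of _ h]) (simp add: L2_holo_def)
  qed
  then obtain h where h: "\<And>c. c \<in> C \<Longrightarrow> h c \<in> HN \<kappa> c" "\<And>c z. c \<in> C \<Longrightarrow> isotypic_part c f z = lift c (h c) z"
    by metis
  have "f z = (\<Sum>c\<in>C. lift c (h c) z)" for z
    unfolding sum_isotypic_part[of f z, symmetric] by (rule sum.cong) (simp_all add: h(2))
  then show thesis using that h(1) by blast
qed

lemma sum_lift_mem:
  assumes \<kappa>: "\<kappa> > 0" and h: "\<And>c. c \<in> C \<Longrightarrow> h c \<in> HN \<kappa> c"
  shows "(\<lambda>z. \<Sum>c\<in>C. lift c (h c) z) \<in> HM \<kappa>"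
proof -
  interpret M: bergman_measure "\<mu> \<kappa>" \<Omega> by (rule bergman_measure_mu[OF \<kappa>])
  show ?thesis by (intro M.H_sum lift_mem[OF \<kappa>] h)
qed

lemma sum_lift_ip:
  assumes \<kappa>: "\<kappa> > 0" and h: "\<And>c. c \<in> C \<Longrightarrow> h c \<in> HN \<kappa> c" and g: "\<And>c. c \<in> C \<Longrightarrow> g c \<in> HN \<kappa> c"
  shows "L2_ip (\<mu> \<kappa>) (\<lambda>z. \<Sum>c\<in>C. lift c (h c) z) (\<lambda>z. \<Sum>c\<in>C. lift c (g c) z)
    = of_nat (card Z) * (\<Sum>c\<in>C. L2_ip (\<nu> \<kappa> c) (h c) (g c))"
proof -
  interpret M: bergman_measure "\<mu> \<kappa>" \<Omega> by (rule bergman_measure_mu[OF \<kappa>])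
  have "L2_ip (\<mu> \<kappa>) (\<lambda>z. \<Sum>c\<in>C. lift c (h c) z) (\<lambda>z. \<Sum>c\<in>C. lift c (g c) z)
      = (\<Sum>c\<in>C. L2_ip (\<mu> \<kappa>) (lift c (h c)) (\<lambda>z. \<Sum>c\<in>C. lift c (g c) z))"
    by (intro M.inp_sum_left finite_C lift_mem[OF \<kappa>] h sum_lift_mem[OF \<kappa>] g)
  also have "\<dots> = (\<Sum>c\<in>C. \<Sum>c'\<in>C. L2_ip (\<mu> \<kappa>) (lift c (h c)) (lift c' (g c')))"
    by (intro sum.cong refl M.inp_sum_right finite_C lift_mem[OF \<kappa>] h g)
  also have "\<dots> = (\<Sum>c\<in>C. \<Sum>c'\<in>C. if c' = c then of_nat (card Z) * L2_ip (\<nu> \<kappa> c) (h c) (g c) else 0)"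
  proof (intro sum.cong refl)
    fix c c' assume c: "c \<in> C" "c' \<in> C"
    show "L2_ip (\<mu> \<kappa>) (lift c (h c)) (lift c' (g c'))
      = (if c' = c then of_nat (card Z) * L2_ip (\<nu> \<kappa> c) (h c) (g c) else 0)"
      using lift_ip[OF \<kappa> h[OF c(1)] g[OF c(1)]] lift_orthogonal[OF \<kappa> c _ h[OF c(1)] g[OF c(2)]] by auto
  qed
  also have "\<dots> = of_nat (card Z) * (\<Sum>c\<in>C. L2_ip (\<nu> \<kappa> c) (h c) (g c))"
    using finite_C by (simp add: sum_distrib_left)
  finally show ?thesis .
qed

text \<open>The bijection \<open>\<beta>\<close> identifies exponent vectors with the index set of
  the direct sum. The isometry \<open>T\<close> is the sum of the lifts divided by the square root
  \<open>S\<close> of \<open>card Z\<close>. The kernel at \<open>w\<close> is the sum of the lifts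
  of \<open>cnj (ell_c w) / card Z\<close> times the kernels at \<open>\<theta> w\<close>, since
  this function reproduces the value at \<open>w\<close> of each lift.\<close>

theorem decomposition:
  assumes \<kappa>: "\<kappa> > 0" and \<beta>: "bij_betw \<beta> C I"
    and A: "vectors A = HM \<kappa>" "vadd A = (\<lambda>f g z. f z + g z)" "vscale A = (\<lambda>k f z. k * f z)"
      "\<And>f g. f \<in> HM \<kappa> \<Longrightarrow> g \<in> HM \<kappa> \<Longrightarrow> ip A f g = L2_ip (\<mu> \<kappa>) f g"
    and A': "\<And>c. c \<in> C \<Longrightarrow> vectors (A' (\<beta> c)) = HN \<kappa> c"
      "\<And>c. c \<in> C \<Longrightarrow> vadd (A' (\<beta> c)) = (\<lambda>f g z. f z + g z)"
      "\<And>c. c \<in> C \<Longrightarrow> vscale (A' (\<beta> c)) = (\<lambda>k f z. k * f z)"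
      "\<And>c f g. c \<in> C \<Longrightarrow> f \<in> HN \<kappa> c \<Longrightarrow> g \<in> HN \<kappa> c \<Longrightarrow> ip (A' (\<beta> c)) f g = L2_ip (\<nu> \<kappa> c) f g"
  shows "isometrically_isomorphic A (direct_sum I A')"
    and "z \<in> \<Omega> \<Longrightarrow> w \<in> \<Omega> \<Longrightarrow> reproducing_kernel A z w = 1 / of_nat (card Z) *
      (\<Sum>c\<in>C. monomial_fun c (y z) * reproducing_kernel (A' (\<beta> c)) (\<theta> z) (\<theta> w) * cnj (monomial_fun c (y w)))"
proof -
  interpret M: bergman_measure "\<mu> \<kappa>" \<Omega> by (rule bergman_measure_mu[OF \<kappa>])
  have N: "bergman_measure (\<nu> \<kappa> c) (\<theta> ` \<Omega>)" if "c \<in> C" for c by (rule bergman_measure_nu[OF \<kappa> that])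
  define S where "S = complex_of_real (sqrt (real (card Z)))"
  have S0: "S \<noteq> 0" using card_Z_pos by (simp add: S_def)
  have SS: "S * cnj S = of_nat (card Z)"
    by (simp add: S_def flip: of_real_mult)
  let ?Y = "direct_sum I A'"
  define T where "T hh z = (\<Sum>c\<in>C. lift c (hh (\<beta> c)) z) / S" for hh z
  have \<beta>I: "\<beta> c \<in> I" if "c \<in> C" for c using \<beta> that by (rule bij_betw_apply)
  have Y: "hh \<in> vectors ?Y \<longleftrightarrow> hh \<in> extensional I \<and> (\<forall>c\<in>C. hh (\<beta> c) \<in> HN \<kappa> c)" for hh
  proof -
    have "(\<forall>R\<in>I. hh R \<in> vectors (A' R)) \<longleftrightarrow> (\<forall>c\<in>C. hh (\<beta> c) \<in> vectors (A' (\<beta> c)))"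
      using \<beta> unfolding bij_betw_def by blast
    then show ?thesis using A'(1) by (auto simp: direct_sum_def PiE_def)
  qed
  have Yc: "hh (\<beta> c) \<in> HN \<kappa> c" if "hh \<in> vectors ?Y" "c \<in> C" for hh c using Y that by blast
  have T_mem: "T hh \<in> HM \<kappa>" if "hh \<in> vectors ?Y" for hh
    using M.H_scale[OF sum_lift_mem[OF \<kappa> Yc[OF that]], of "1 / S"] by (simp add: T_def[abs_def])
  have add: "vadd ?Y f g \<in> vectors ?Y \<and> T (vadd ?Y f g) = vadd A (T f) (T g)"
    if fg: "f \<in> vectors ?Y" "g \<in> vectors ?Y" for f g
  proof -
    have c: "vadd ?Y f g (\<beta> c) = (\<lambda>u. f (\<beta> c) u + g (\<beta> c) u)" if "c \<in> C" for c
      using that by (simp add: direct_sum_def \<beta>I A'(2))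
    have "vadd ?Y f g \<in> extensional I" by (simp add: direct_sum_def)
    moreover have "vadd ?Y f g (\<beta> c) \<in> HN \<kappa> c" if "c \<in> C" for c
      unfolding c[OF that] by (rule bergman_measure.H_add[OF N[OF that] Yc[OF fg(1) that] Yc[OF fg(2) that]])
    moreover have "T (vadd ?Y f g) = vadd A (T f) (T g)"
      by (simp add: T_def fun_eq_iff c A(2) lift_def distrib_left sum.distrib add_divide_distrib)
    ultimately show ?thesis using Y by blast
  qed
  have scale: "vscale ?Y k f \<in> vectors ?Y \<and> T (vscale ?Y k f) = vscale A k (T f)"
    if f: "f \<in> vectors ?Y" for k f
  proof -
    have c: "vscale ?Y k f (\<beta> c) = (\<lambda>u. k * f (\<beta> c) u)" if "c \<in> C" for c
      using that by (simp add: direct_sum_def \<beta>I A'(3))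
    have "vscale ?Y k f \<in> extensional I" by (simp add: direct_sum_def)
    moreover have "vscale ?Y k f (\<beta> c) \<in> HN \<kappa> c" if "c \<in> C" for c
      unfolding c[OF that] by (rule bergman_measure.H_scale[OF N[OF that] Yc[OF f that]])
    moreover have "T (vscale ?Y k f) = vscale A k (T f)"
      by (simp add: T_def fun_eq_iff c A(3) lift_def sum_distrib_left mult_ac)
    ultimately show ?thesis using Y by blast
  qed
  have ipY: "ip ?Y f g = (\<Sum>c\<in>C. L2_ip (\<nu> \<kappa> c) (f (\<beta> c)) (g (\<beta> c)))"
    if fg: "f \<in> vectors ?Y" "g \<in> vectors ?Y" for f g
  proof -
    have "ip ?Y f g = (\<Sum>c\<in>C. ip (A' (\<beta> c)) (f (\<beta> c)) (g (\<beta> c)))"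
      using sum.reindex_bij_betw[OF \<beta>, of "\<lambda>R. ip (A' R) (f R) (g R)"] by (simp add: direct_sum_def)
    also have "\<dots> = (\<Sum>c\<in>C. L2_ip (\<nu> \<kappa> c) (f (\<beta> c)) (g (\<beta> c)))"
      by (intro sum.cong refl A'(4) Yc fg)
    finally show ?thesis .
  qed
  have iso: "ip A (T f) (T g) = ip ?Y f g" if fg: "f \<in> vectors ?Y" "g \<in> vectors ?Y" for f g
  proof -
    have T': "T h = (\<lambda>z. (1 / S) * (\<Sum>c\<in>C. lift c (h (\<beta> c)) z))" for h by (simp add: T_def fun_eq_iff)
    have "ip A (T f) (T g) = L2_ip (\<mu> \<kappa>) (T f) (T g)" by (rule A(4)[OF T_mem[OF fg(1)] T_mem[OF fg(2)]])
    also have "\<dots> = (1 / S) * (cnj (1 / S) *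
        L2_ip (\<mu> \<kappa>) (\<lambda>z. \<Sum>c\<in>C. lift c (f (\<beta> c)) z) (\<lambda>z. \<Sum>c\<in>C. lift c (g (\<beta> c)) z))"
      unfolding T' by (simp only: M.inp_scale_left M.inp_scale_right)
    also have "\<dots> = (of_nat (card Z) / (S * cnj S)) * (\<Sum>c\<in>C. L2_ip (\<nu> \<kappa> c) (f (\<beta> c)) (g (\<beta> c)))"
      by (subst sum_lift_ip[OF \<kappa> Yc[OF fg(1)] Yc[OF fg(2)]]) auto
    also have "\<dots> = ip ?Y f g" using card_Z_pos by (simp add: SS ipY[OF fg])
    finally show ?thesis .
  qed
  have "bij_betw T (vectors ?Y) (vectors A)"
    unfolding bij_betw_def A(1)
  proof
    show "inj_on T (vectors ?Y)"
    proof (rule inj_onI)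
      fix f g assume fg: "f \<in> vectors ?Y" "g \<in> vectors ?Y" "T f = T g"
      define d where "d = vadd ?Y f (vscale ?Y (-1) g)"
      have mg: "vscale ?Y (-1) g \<in> vectors ?Y" using scale[OF fg(2)] by blast
      have dY: "d \<in> vectors ?Y" using add[OF fg(1) mg] by (simp add: d_def)
      have "T d = (\<lambda>z. 0)"
        using add[OF fg(1) mg] scale[OF fg(2), of "-1"] by (simp add: d_def fg(3) A(2,3))
      then have "ip A (T d) (T d) = 0" using A(4)[OF T_mem[OF dY] T_mem[OF dY]] by (simp add: M.inp_zero)
      then have "(\<Sum>c\<in>C. L2_ip (\<nu> \<kappa> c) (d (\<beta> c)) (d (\<beta> c))) = 0" using iso[OF dY dY] ipY[OF dY dY] by simp
      then have "(\<Sum>c\<in>C. complex_of_real (LINT u|\<nu> \<kappa> c. (cmod (d (\<beta> c) u))\<^sup>2)) = 0"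
        by (simp add: bergman_measure.inp_self[OF N] cong: sum.cong)
      then have "(\<Sum>c\<in>C. LINT u|\<nu> \<kappa> c. (cmod (d (\<beta> c) u))\<^sup>2) = 0"
        unfolding of_real_sum[symmetric] by (simp only: of_real_eq_0_iff)
      then have N0: "(LINT u|\<nu> \<kappa> c. (cmod (d (\<beta> c) u))\<^sup>2) = 0" if "c \<in> C" for c
        using that by (subst (asm) sum_nonneg_eq_0_iff[OF finite_C]) simp_all
      have d0: "d (\<beta> c) = (\<lambda>u. 0)" if "c \<in> C" for c
        by (rule bergman_measure.N_eq_0[OF N[OF that] Yc[OF dY that] N0[OF that]])
      show "f = g"
      proof (rule extensionalityI)
        show "f \<in> extensional I" "g \<in> extensional I" using Y fg by blast+
        fix R assume "R \<in> I"
        then obtain c where c: "c \<in> C" "R = \<beta> c" using \<beta> unfolding bij_betw_def by blast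
        have "d (\<beta> c) = (\<lambda>u. f (\<beta> c) u + (-1) * g (\<beta> c) u)"
          using c(1) by (simp add: d_def direct_sum_def \<beta>I A'(2,3))
        then show "f R = g R" using d0[OF c(1)] by (simp add: c(2) fun_eq_iff)
      qed
    qed
    show "T ` vectors ?Y = HM \<kappa>"
    proof (intro equalityI subsetI)
      fix f assume "f \<in> T ` vectors ?Y" then show "f \<in> HM \<kappa>" using T_mem by blast
    next
      fix f assume f: "f \<in> HM \<kappa>"
      obtain h where h: "\<And>c. c \<in> C \<Longrightarrow> h c \<in> HN \<kappa> c" "\<And>z. f z = (\<Sum>c\<in>C. lift c (h c) z)"
        by (rule components[OF \<kappa> f]) blast
      define hh where "hh = (\<lambda>R\<in>I. \<lambda>u. S * h (inv_into C \<beta> R) u)"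
      have hc: "hh (\<beta> c) = (\<lambda>u. S * h c u)" if "c \<in> C" for c
        using that \<beta>I[OF that] bij_betw_inv_into_left[OF \<beta> that] by (simp add: hh_def)
      have "hh (\<beta> c) \<in> HN \<kappa> c" if "c \<in> C" for c
        unfolding hc[OF that] by (rule bergman_measure.H_scale[OF N[OF that] h(1)[OF that]])
      then have "hh \<in> vectors ?Y" using Y by (simp add: hh_def)
      moreover have "T hh = f"
      proof
        fix z
        have "T hh z = (\<Sum>c\<in>C. S * lift c (h c) z) / S"
          unfolding T_def by (intro arg_cong2[where f = "(/)"] sum.cong refl) (simp add: hc lift_def)
        then show "T hh z = f z" using S0 by (simp add: h(2) sum_distrib_left[symmetric])
      qed
      ultimately show "f \<in> T ` vectors ?Y" by blast
    qed
  qed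
  from isometrically_isomorphic_inverse[OF this add scale iso]
  show "isometrically_isomorphic A (direct_sum I A')" .
  assume z: "z \<in> \<Omega>" and w: "w \<in> \<Omega>"
  define K where "K c u = reproducing_kernel (A' (\<beta> c)) u (\<theta> w)" for c u
  have w': "\<theta> w \<in> \<theta> ` \<Omega>" using w by simp
  have K: "K c \<in> HN \<kappa> c" "\<And>f. f \<in> HN \<kappa> c \<Longrightarrow> f (\<theta> w) = L2_ip (\<nu> \<kappa> c) f (K c)" if c: "c \<in> C" for c
    using bergman_measure.reproducing_kernel[OF N[OF c] A'(1)[OF c] A'(4)[OF c] w']
    unfolding K_def[abs_def] by blast+
  define kc where "kc c u = (cnj (monomial_fun c (y w)) / of_nat (card Z)) * K c u" for c u
  have kc: "kc c \<in> HN \<kappa> c" if c: "c \<in> C" for c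
    unfolding kc_def[abs_def] by (rule bergman_measure.H_scale[OF N[OF c] K(1)[OF c]])
  have "reproducing_kernel A z w = (\<Sum>c\<in>C. lift c (kc c) z)"
  proof (rule M.reproducing_kernel_eqI[OF A(1) A(4)])
    show "(\<lambda>z. \<Sum>c\<in>C. lift c (kc c) z) \<in> HM \<kappa>" by (rule sum_lift_mem[OF \<kappa> kc])
    fix f assume f: "f \<in> HM \<kappa>"
    obtain h where h: "\<And>c. c \<in> C \<Longrightarrow> h c \<in> HN \<kappa> c" "\<And>z. f z = (\<Sum>c\<in>C. lift c (h c) z)"
      by (rule components[OF \<kappa> f]) blast
    have fe: "f = (\<lambda>z. \<Sum>c\<in>C. lift c (h c) z)" using h(2) by (simp add: fun_eq_iff)
    have "L2_ip (\<mu> \<kappa>) f (\<lambda>z. \<Sum>c\<in>C. lift c (kc c) z)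
        = of_nat (card Z) * (\<Sum>c\<in>C. L2_ip (\<nu> \<kappa> c) (h c) (kc c))"
      unfolding fe by (rule sum_lift_ip[OF \<kappa> h(1) kc])
    also have "\<dots> = (\<Sum>c\<in>C. of_nat (card Z) * L2_ip (\<nu> \<kappa> c) (h c) (kc c))" by (rule sum_distrib_left)
    also have "\<dots> = (\<Sum>c\<in>C. lift c (h c) w)"
    proof (rule sum.cong[OF refl])
      fix c assume c: "c \<in> C"
      have "L2_ip (\<nu> \<kappa> c) (h c) (kc c) = cnj (cnj (monomial_fun c (y w)) / of_nat (card Z)) * L2_ip (\<nu> \<kappa> c) (h c) (K c)"
        unfolding kc_def[abs_def] by (rule bergman_measure.inp_scale_right[OF N[OF c]])
      then show "of_nat (card Z) * L2_ip (\<nu> \<kappa> c) (h c) (kc c) = lift c (h c) w"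
        using card_Z_pos K(2)[OF c h(1)[OF c]] by (simp add: lift_def)
    qed
    finally show "f w = L2_ip (\<mu> \<kappa>) f (\<lambda>z. \<Sum>c\<in>C. lift c (kc c) z)" by (simp add: h(2))
  qed
  also have "\<dots> = 1 / of_nat (card Z) * (\<Sum>c\<in>C. monomial_fun c (y z) * K c (\<theta> z) * cnj (monomial_fun c (y w)))"
    by (simp add: lift_def kc_def sum_distrib_left mult_ac)
  finally show "reproducing_kernel A z w = 1 / of_nat (card Z) *
      (\<Sum>c\<in>C. monomial_fun c (y z) * reproducing_kernel (A' (\<beta> c)) (\<theta> z) (\<theta> w) * cnj (monomial_fun c (y w)))"
    by (simp add: K_def)
qed

end

theorem proposition3p5:
  fixes G :: "(complex^'d^'d) set"
    and \<Omega> :: "(complex^'d) set"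
    and \<theta> :: "complex^'d \<Rightarrow> complex^'d"
    and wt :: "complex^'d \<Rightarrow> real"
    and L :: "(complex^'d) set \<Rightarrow> complex^'d \<Rightarrow> complex"
    and a :: "(complex^'d) set \<Rightarrow> complex^'d^'d"
  assumes "finite_reflection_group G"
    and "comm_group (GL\<lparr>carrier := G\<rparr>)"
    and "invariant_domain G \<Omega>" and "bounded \<Omega>"
    and "basic_polynomial_map G \<theta>"
    and "continuous_on (\<theta> ` \<Omega>) wt" and "\<And>u. u \<in> \<theta> ` \<Omega> \<Longrightarrow> wt u > 0"
    and "\<And>H. H \<in> hyperplanes G \<Longrightarrow>
           Vector_Spaces.linear (*s) (*) (L H) \<and> {z. L H z = 0} = H"
    and "\<And>H. H \<in> hyperplanes G \<Longrightarrow> a H \<in> fixer G H \<and> generate GL {a H} = fixer G H"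
  shows "let dV = normalized_volume \<Omega>;
             A = bergman_space dV \<Omega> (wt \<circ> \<theta>);
             A' = (\<lambda>R. bergman_space dV (\<theta> ` \<Omega>) (omega \<Omega> \<theta> (ell G L a R) wt))
         in isometrically_isomorphic A (direct_sum (dual G) A')
            \<and> is_reproducing_kernel A \<Omega> (reproducing_kernel A)
            \<and> (\<forall>R\<in>dual G. is_reproducing_kernel (A' R) (\<theta> ` \<Omega>) (reproducing_kernel (A' R)))
            \<and> (\<forall>z\<in>\<Omega>. \<forall>w\<in>\<Omega>. reproducing_kernel A z w =
                 1 / of_nat (card G) *
                 (\<Sum>R\<in>dual G. ell G L a R z * reproducing_kernel (A' R) (\<theta> z) (\<theta> w)
                                * cnj (ell G L a R w)))"
proof -
  obtain P Q m \<iota> ev where dg: "diagonal_group P Q m" and G: "G = diagonal_group.G P Q m"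
    and \<iota>: "inj_on \<iota> (hyperplanes G)" "\<And>H z. H \<in> hyperplanes G \<Longrightarrow> L H z = (P *v z) $ \<iota> H"
    and m1: "\<And>j. j \<notin> \<iota> ` hyperplanes G \<Longrightarrow> m j = 1"
    and aD: "\<And>H. H \<in> hyperplanes G \<Longrightarrow> a H = diagonal_group.D P Q (\<chi> j. if j = \<iota> H then ev H else 1)"
    and ord: "\<And>H k. H \<in> hyperplanes G \<Longrightarrow> ev H ^ k = 1 \<longleftrightarrow> m (\<iota> H) dvd k"
    using abelian_reflection_group_diagonal[OF assms(1,2,8,9)] by blast
  interpret dg: diagonal_group P Q m by (rule dg)
  interpret bm: basic_map P Q m \<theta>
    by unfold_locales (use assms(5) G in simp)
  have dom: "open \<Omega>" "\<Omega> \<noteq> {}" "\<And>\<sigma>. \<sigma> \<in> G \<Longrightarrow> act \<sigma> ` \<Omega> = \<Omega>"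
    using assms(3) by (auto simp: invariant_domain_def)
  interpret bq: bergman_quotient P Q m \<theta> \<Omega> wt
  proof
    fix \<zeta> z assume \<zeta>: "\<zeta> \<in> dg.Z" and z: "z \<in> \<Omega>"
    have "dg.D (dg.conjv \<zeta>) \<in> G" using dg.conjv_Z[OF \<zeta>] by (simp add: G dg.G_def)
    from dom(3)[OF this] have "act (dg.D (dg.conjv \<zeta>)) z \<in> \<Omega>" using z by blast
    then show "dg.D \<zeta> *v z \<in> \<Omega>" by (simp add: dg.act_D[OF dg.conjv_Z[OF \<zeta>]])
  qed (use assms(4,6,7) dom in auto)
  have finH: "finite (hyperplanes G)"
    using assms(1) by (simp add: finite_reflection_group_def hyperplanes_def)
  have ell: "ell G L a {dg.rep c} z = monomial_fun c (dg.y z)" if c: "c \<in> dg.C" for c z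
  proof -
    \<comment> \<open>With \<open>ev H = det (a H)\<close> of order \<open>m (\<iota> H)\<close>,
      the character has the value \<open>ev H ^ c (\<iota> H)\<close> at \<open>a H\<close>; since
      \<open>c (\<iota> H) < m (\<iota> H)\<close>, no smaller exponent gives this value.\<close>
    have exp: "exponent {dg.rep c} (a H) = c (\<iota> H)" if H: "H \<in> hyperplanes G" for H
    proof -
      let ?\<xi> = "\<chi> j. if j = \<iota> H then ev H else 1"
      have \<xi>Z: "?\<xi> \<in> dg.Z" using ord[OF H] by (simp add: dg.Z_def)
      have det: "det (a H) = ev H" by (simp add: aD[OF H] dg.det_D)
      have chi: "monomial_fun c ?\<xi> = ev H ^ c (\<iota> H)"
      proof -
        have "monomial_fun c ?\<xi> = (\<Prod>j\<in>UNIV. if j = \<iota> H then ev H ^ c j else 1)"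
          unfolding monomial_fun_def by (rule prod.cong) auto
        then show ?thesis by simp
      qed
      have ex: "exponent {dg.rep c} (a H) = (LEAST k. ev H ^ c (\<iota> H) = ev H ^ k)"
        unfolding exponent_def det by (simp add: aD[OF H] dg.rep_D[OF \<xi>Z] chi dg.scalar_mat_eq del: One_nat_def)
      have "(LEAST k. ev H ^ c (\<iota> H) = ev H ^ k) = c (\<iota> H)"
      proof (rule Least_equality)
        fix k assume k: "ev H ^ c (\<iota> H) = ev H ^ k"
        show "c (\<iota> H) \<le> k"
        proof (rule ccontr)
          assume "\<not> c (\<iota> H) \<le> k"
          then have lt: "k < c (\<iota> H)" by simp
          have "ev H ^ m (\<iota> H) = 1" using ord[OF H] by simp
          then have nz: "ev H \<noteq> 0" using dg.m_pos[of "\<iota> H"] by (auto simp: power_0_left)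
          have "ev H ^ k * ev H ^ (c (\<iota> H) - k) = ev H ^ k" using lt k by (simp flip: power_add)
          then have "ev H ^ (c (\<iota> H) - k) = 1" using nz by simp
          then have "m (\<iota> H) dvd c (\<iota> H) - k" using ord[OF H] by blast
          then have "m (\<iota> H) \<le> c (\<iota> H) - k" using lt by (intro dvd_imp_le) auto
          then show False using c by (auto simp: dg.C_def dest: spec[of _ "\<iota> H"])
        qed
      qed simp
      then show ?thesis using ex by simp
    qed
    have "ell G L a {dg.rep c} z = (\<Prod>H\<in>hyperplanes G. dg.y z $ \<iota> H ^ c (\<iota> H))"
      unfolding ell_def by (rule prod.cong) (simp_all add: exp \<iota>(2) dg.y_def)
    also have "\<dots> = (\<Prod>j\<in>\<iota> ` hyperplanes G. dg.y z $ j ^ c j)"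
      by (simp add: prod.reindex[OF \<iota>(1)])
    also have "\<dots> = monomial_fun c (dg.y z)"
      unfolding monomial_fun_def
    proof (rule prod.mono_neutral_left)
      show "\<forall>j\<in>UNIV - \<iota> ` hyperplanes G. dg.y z $ j ^ c j = 1"
      proof
        fix j assume "j \<in> UNIV - \<iota> ` hyperplanes G"
        \<comment> \<open>Coordinates without a reflecting hyperplane have \<open>m j = 1\<close>,
          so their exponent is 0.\<close>
        then have "c j = 0" using c m1[of j] by (auto simp: dg.C_def dest: spec[of _ j])
        then show "dg.y z $ j ^ c j = 1" by simp
      qed
    qed auto
    finally show ?thesis .
  qed
  obtain \<kappa> where \<kappa>: "\<kappa> > 0" and dV: "normalized_volume \<Omega> = density lebesgue (\<lambda>_. ennreal \<kappa>)"
    using normalized_volume_density[OF dom(1) assms(4) dom(2)] by blast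
  define A where "A = bergman_space (normalized_volume \<Omega>) \<Omega> (wt \<circ> \<theta>)"
  define A' where "A' R = bergman_space (normalized_volume \<Omega>) (\<theta> ` \<Omega>) (omega \<Omega> \<theta> (ell G L a R) wt)" for R
  have A'c: "A' {dg.rep c} = bergman_space (density lebesgue (\<lambda>_. ennreal \<kappa>)) (\<theta> ` \<Omega>) (bq.W c)" if "c \<in> dg.C" for c
  proof -
    have "ell G L a {dg.rep c} = (\<lambda>z. monomial_fun c (dg.y z))" using ell[OF that] by (rule ext)
    then show ?thesis by (simp add: A'_def dV bq.W_def)
  qed
  have A: "vectors A = bq.HM \<kappa>" "vadd A = (\<lambda>f g z. f z + g z)" "vscale A = (\<lambda>k f z. k * f z)"
    "\<And>f g. f \<in> bq.HM \<kappa> \<Longrightarrow> g \<in> bq.HM \<kappa> \<Longrightarrow> ip A f g = L2_ip (bq.\<mu> \<kappa>) f g"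
    using bergman_space_L2[OF \<kappa> dom(1), of "wt \<circ> \<theta>"] bq.weight_borel(1) bq.wt_nonneg
    by (simp_all add: A_def dV bq.\<mu>_def) (simp_all add: bergman_space_def)
  have A': "vectors (A' {dg.rep c}) = bq.HN \<kappa> c" "vadd (A' {dg.rep c}) = (\<lambda>f g z. f z + g z)"
    "vscale (A' {dg.rep c}) = (\<lambda>k f z. k * f z)"
    "\<And>f g. f \<in> bq.HN \<kappa> c \<Longrightarrow> g \<in> bq.HN \<kappa> c \<Longrightarrow> ip (A' {dg.rep c}) f g = L2_ip (bq.\<nu> \<kappa> c) f g"
    if c: "c \<in> dg.C" for c
    using bergman_space_L2[OF \<kappa> bm.theta_open[OF dom(1)], of "bq.W c"] bq.weight_borel(2) bq.W_nonneg
    by (simp_all add: A'c[OF c] bq.\<nu>_def) (simp_all add: bergman_space_def)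
  have \<beta>: "bij_betw (\<lambda>c. {dg.rep c}) dg.C (dual G)" using dg.dual_diagonal by (simp only: G)
  have iso: "isometrically_isomorphic A (direct_sum (dual G) A')"
    by (rule bq.decomposition(1)[OF \<kappa> \<beta> A A'])
  have rkA: "is_reproducing_kernel A \<Omega> (reproducing_kernel A)"
    by (rule bergman_measure.is_reproducing_kernel[OF bq.bergman_measure_mu[OF \<kappa>] A(1) A(4)])
  have rkA': "is_reproducing_kernel (A' R) (\<theta> ` \<Omega>) (reproducing_kernel (A' R))" if R: "R \<in> dual G" for R
  proof -
    obtain c where c: "c \<in> dg.C" "R = {dg.rep c}" using \<beta> R unfolding bij_betw_def by blast
    show ?thesis unfolding c(2)
      by (rule bergman_measure.is_reproducing_kernel[OF bq.bergman_measure_nu[OF \<kappa> c(1)] A'(1)[OF c(1)] A'(4)[OF c(1)]])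
  qed
  have kernel: "reproducing_kernel A z w = 1 / of_nat (card G) *
      (\<Sum>R\<in>dual G. ell G L a R z * reproducing_kernel (A' R) (\<theta> z) (\<theta> w) * cnj (ell G L a R w))"
    if zw: "z \<in> \<Omega>" "w \<in> \<Omega>" for z w
  proof -
    have "(\<Sum>R\<in>dual G. ell G L a R z * reproducing_kernel (A' R) (\<theta> z) (\<theta> w) * cnj (ell G L a R w))
       = (\<Sum>c\<in>dg.C. ell G L a {dg.rep c} z * reproducing_kernel (A' {dg.rep c}) (\<theta> z) (\<theta> w)
            * cnj (ell G L a {dg.rep c} w))"
      by (rule sum.reindex_bij_betw[OF \<beta>, symmetric])
    also have "\<dots> = (\<Sum>c\<in>dg.C. monomial_fun c (dg.y z) * reproducing_kernel (A' {dg.rep c}) (\<theta> z) (\<theta> w)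
            * cnj (monomial_fun c (dg.y w)))"
      by (rule sum.cong) (simp_all add: ell)
    finally have sums: "(\<Sum>R\<in>dual G. ell G L a R z * reproducing_kernel (A' R) (\<theta> z) (\<theta> w) * cnj (ell G L a R w))
       = (\<Sum>c\<in>dg.C. monomial_fun c (dg.y z) * reproducing_kernel (A' {dg.rep c}) (\<theta> z) (\<theta> w)
            * cnj (monomial_fun c (dg.y w)))" .
    have cardG: "card G = card dg.Z" using dg.card_G G by argo
    show ?thesis
      unfolding sums cardG by (rule bq.decomposition(2)[OF \<kappa> \<beta> A A' zw])
  qed
  show ?thesis
    unfolding Let_def A_def[symmetric] A'_def[symmetric]
    by (intro conjI ballI iso rkA rkA' kernel)
qed

end
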